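(* (Dimension 3 / $\mathbb P^2$.) Up to isomorphism there are exactly three complex Jordan algebras of rank $3$ and dimension $3$, namely the (pairwise non-isomorphic) associative algebras $\mathbb C\times\mathbb C\times\mathbb C$, $\mathbb C\times\mathbb C[\varepsilon]/(\varepsilon^2)$ and $\mathbb C[\varepsilon]/(\varepsilon^3)$. Correspondingly, every quadro-quadric Cremona transformation of $\mathbb P^2$ over $\mathbb C$ is linearly equivalent to the projectivization of exactly one of the quadratic maps $$(x,y,z)\mapsto(yz,xz,xy),\qquad (x,y,z)\mapsto(y^2,xy,-xz),\qquad (x,y,z)\mapsto(x^2,-xy,y^2-xz),$$ which are, respectively, the adjoints of these three algebras in suitable coordinates.
   Context: A Jordan algebra is a finite-dimensional commutative complex algebra with unity satisfying $x^2(xy)=x(x^2y)$. Its rank is the dimension of the subalgebra generated by the unity and a general element. For a rank $3$ Jordan algebra with unity $e$, whose elements satisfy the generic equation $x^3-T(x)x^2+S(x)x-N(x)e=0$ ($T,S,N$ forms of degrees $1,2,3$), the adjoint is $x^\#=x^2-T(x)x+S(x)e$. A quadro-quadric Cremona transformation of $\mathbb P^n$ is a birational map given by quadratic forms without common factor whose inverse is also given by quadratic forms without common factor. Two Cremona transformations $f,\tilde f$ of $\mathbb P^n$ are linearly equivalent if $\tilde f=\ell_1\circ f\circ\ell_2$ with $\ell_1,\ell_2\in\mathrm{Aut}(\mathbb P^n)$. *)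

theory Defs
  imports "HOL-Analysis.Analysis" "HOL-Computational_Algebra.Polynomial"
begin

section \<open>Polynomial functions and forms on a complex vector space\<close>

text \<open>The vector space structure on the type is given by the scalar multiplication \<open>sc\<close>. Since the
  complex numbers are infinite, polynomials in coordinates are identified with the functions they
  define, and a form of degree \<open>d\<close> is a polynomial function that is homogeneous of degree \<open>d\<close>.\<close>

inductive polyfun :: "(complex \<Rightarrow> 'a::ab_group_add \<Rightarrow> 'a) \<Rightarrow> ('a \<Rightarrow> complex) \<Rightarrow> bool"
  for sc :: "complex \<Rightarrow> 'a::ab_group_add \<Rightarrow> 'a" where
  const: "polyfun sc (\<lambda>x. c)"
| linear: "Vector_Spaces.linear sc (*) l \<Longrightarrow> polyfun sc l"
| add: "polyfun sc f \<Longrightarrow> polyfun sc g \<Longrightarrow> polyfun sc (\<lambda>x. f x + g x)"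
| mult: "polyfun sc f \<Longrightarrow> polyfun sc g \<Longrightarrow> polyfun sc (\<lambda>x. f x * g x)"

definition form :: "(complex \<Rightarrow> 'a::ab_group_add \<Rightarrow> 'a) \<Rightarrow> nat \<Rightarrow> ('a \<Rightarrow> complex) \<Rightarrow> bool" where
  "form sc d f \<longleftrightarrow> polyfun sc f \<and> (\<forall>c x. f (sc c x) = c ^ d * f x)"

text \<open>A property holds for a general element if it holds on a nonempty Zariski open set. Every such
  set contains a nonempty set of the form \<open>{x. f x \<noteq> 0}\<close>.\<close>

definition general :: "(complex \<Rightarrow> 'a::ab_group_add \<Rightarrow> 'a) \<Rightarrow> ('a \<Rightarrow> bool) \<Rightarrow> bool" where
  "general sc P \<longleftrightarrow> (\<exists>f. polyfun sc f \<and> (\<exists>x. f x \<noteq> 0) \<and> (\<forall>x. f x \<noteq> 0 \<longrightarrow> P x))"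


section \<open>Jordan algebras\<close>

text \<open>The additive group of an algebra is that of its underlying type.\<close>

record 'a calgebra =
  smul :: "complex \<Rightarrow> 'a \<Rightarrow> 'a"
  mul :: "'a \<Rightarrow> 'a \<Rightarrow> 'a"
  unity :: 'a

locale jordan_algebra = vector_space "smul A" for A :: "'a::ab_group_add calgebra" +
  assumes finite_dimensional: "\<exists>B. finite B \<and> span B = UNIV"
    and mul_add_left: "mul A (x + y) z = mul A x z + mul A y z"
    and mul_smul_left: "mul A (smul A c x) y = smul A c (mul A x y)"
    and mul_commute: "mul A x y = mul A y x"
    and mul_unity: "mul A (unity A) x = x"
    and jordan_identity:
      "mul A (mul A x x) (mul A x y) = mul A x (mul A (mul A x x) y)"

definition alg_dim :: "'a::ab_group_add calgebra \<Rightarrow> nat" where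
  "alg_dim A = vector_space.dim (smul A) UNIV"

definition subalgebra :: "'a::ab_group_add calgebra \<Rightarrow> 'a set \<Rightarrow> bool" where
  "subalgebra A U \<longleftrightarrow> module.subspace (smul A) U \<and> (\<forall>x\<in>U. \<forall>y\<in>U. mul A x y \<in> U)"

definition has_rank :: "'a::ab_group_add calgebra \<Rightarrow> nat \<Rightarrow> bool" where
  "has_rank A r \<longleftrightarrow>
     general (smul A) (\<lambda>x. vector_space.dim (smul A) (subalgebra A hull {unity A, x}) = r)"

definition associative :: "'a calgebra \<Rightarrow> bool" where
  "associative A \<longleftrightarrow> (\<forall>x y z. mul A (mul A x y) z = mul A x (mul A y z))"

definition isomorphic :: "'a::ab_group_add calgebra \<Rightarrow> 'b::ab_group_add calgebra \<Rightarrow> bool" where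
  "isomorphic A B \<longleftrightarrow> (\<exists>\<phi>. Vector_Spaces.linear (smul A) (smul B) \<phi> \<and> bij \<phi> \<and>
     \<phi> (unity A) = unity B \<and> (\<forall>x y. \<phi> (mul A x y) = mul B (\<phi> x) (\<phi> y)))"

definition generic_equation ::
  "'a::ab_group_add calgebra \<Rightarrow> ('a \<Rightarrow> complex) \<Rightarrow> ('a \<Rightarrow> complex) \<Rightarrow> ('a \<Rightarrow> complex) \<Rightarrow> bool" where
  "generic_equation A T S N \<longleftrightarrow>
     form (smul A) 1 T \<and> form (smul A) 2 S \<and> form (smul A) 3 N \<and>
     (\<forall>x. mul A x (mul A x x) - smul A (T x) (mul A x x) + smul A (S x) x
            - smul A (N x) (unity A) = 0)"

text \<open>In rank 3 the forms \<open>T\<close>, \<open>S\<close>, \<open>N\<close>, and hence the adjoint, are unique.\<close>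

definition is_adjoint :: "'a::ab_group_add calgebra \<Rightarrow> ('a \<Rightarrow> 'a) \<Rightarrow> bool" where
  "is_adjoint A adj \<longleftrightarrow> (\<exists>T S N. generic_equation A T S N \<and>
     (\<forall>x. adj x = mul A x x - smul A (T x) x + smul A (S x) (unity A)))"

text \<open>In the coordinates \<open>\<phi>\<close> on the algebra (the same on source and target), \<open>F\<close> is the adjoint.\<close>

definition adjoint_in_coordinates ::
  "'a::ab_group_add calgebra \<Rightarrow> (complex^'n \<Rightarrow> complex^'n) \<Rightarrow> bool" where
  "adjoint_in_coordinates A F \<longleftrightarrow> (\<exists>\<phi> adj. Vector_Spaces.linear (*s) (smul A) \<phi> \<and> bij \<phi> \<and>
     is_adjoint A adj \<and> (\<forall>v. \<phi> (F v) = adj (\<phi> v)))"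


section \<open>The three algebras\<close>

text \<open>The ring \<open>\<complex>[\<epsilon>]/(\<epsilon>\<^sup>n)\<close>, where \<open>n\<close> is the cardinality of the index type.\<close>

quotient_type 'n trunc = "complex poly" / "\<lambda>p q. [:0, 1:] ^ CARD('n::finite) dvd p - q"
proof (rule equivpI)
  show "reflp (\<lambda>p q :: complex poly. [:0, 1:] ^ CARD('n) dvd p - q)"
    by (simp add: reflp_def)
  show "symp (\<lambda>p q :: complex poly. [:0, 1:] ^ CARD('n) dvd p - q)"
    by (simp add: symp_def dvd_diff_commute)
  show "transp (\<lambda>p q :: complex poly. [:0, 1:] ^ CARD('n) dvd p - q)"
  proof (rule transpI)
    fix p q r :: "complex poly"
    assume "[:0, 1:] ^ CARD('n) dvd p - q" "[:0, 1:] ^ CARD('n) dvd q - r"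
    then have "[:0, 1:] ^ CARD('n) dvd (p - q) + (q - r)"
      by (rule dvd_add)
    then show "[:0, 1:] ^ CARD('n) dvd p - r"
      by simp
  qed
qed

instantiation trunc :: (finite) comm_ring
begin

lift_definition zero_trunc :: "'a trunc" is 0 .

lift_definition plus_trunc :: "'a trunc \<Rightarrow> 'a trunc \<Rightarrow> 'a trunc" is "(+)"
  by (simp only: add_diff_add dvd_add)

lift_definition uminus_trunc :: "'a trunc \<Rightarrow> 'a trunc" is "uminus"
  by (simp only: minus_diff_minus dvd_minus_iff)

lift_definition minus_trunc :: "'a trunc \<Rightarrow> 'a trunc \<Rightarrow> 'a trunc" is "(-)"
proof -
  fix p q r s :: "complex poly"
  assume "[:0, 1:] ^ CARD('a) dvd p - q" "[:0, 1:] ^ CARD('a) dvd r - s"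
  then have "[:0, 1:] ^ CARD('a) dvd (p - q) - (r - s)"
    by (rule dvd_diff)
  moreover have "(p - q) - (r - s) = (p - r) - (q - s)"
    by simp
  ultimately show "[:0, 1:] ^ CARD('a) dvd (p - r) - (q - s)"
    by (simp only:)
qed

lift_definition times_trunc :: "'a trunc \<Rightarrow> 'a trunc \<Rightarrow> 'a trunc" is "(*)"
proof -
  fix p q r s :: "complex poly"
  assume h: "[:0, 1:] ^ CARD('a) dvd p - q" "[:0, 1:] ^ CARD('a) dvd r - s"
  have "p * r - q * s = (p - q) * r + q * (r - s)"
    by (simp add: algebra_simps)
  with h show "[:0, 1:] ^ CARD('a) dvd p * r - q * s"
    by (simp only: dvd_add dvd_mult dvd_mult2)
qed

instance
  by standard (transfer; simp add: algebra_simps)+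

end

lift_definition trunc_one :: "'n::finite trunc" is 1 .

lift_definition trunc_smul :: "complex \<Rightarrow> 'n::finite trunc \<Rightarrow> 'n trunc" is smult
  by (simp only: smult_diff_right[symmetric] dvd_smult)

definition alg_C :: "complex calgebra" where
  "alg_C = \<lparr>smul = (*), mul = (*), unity = 1\<rparr>"

definition alg_trunc :: "'n::finite trunc calgebra" where
  "alg_trunc = \<lparr>smul = trunc_smul, mul = (*), unity = trunc_one\<rparr>"

definition alg_prod :: "'a calgebra \<Rightarrow> 'b calgebra \<Rightarrow> ('a \<times> 'b) calgebra" where
  "alg_prod A B = \<lparr>
     smul = (\<lambda>c x. (smul A c (fst x), smul B c (snd x))),
     mul = (\<lambda>x y. (mul A (fst x) (fst y), mul B (snd x) (snd y))),
     unity = (unity A, unity B)\<rparr>"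

definition alg_CCC :: "(complex \<times> complex \<times> complex) calgebra" where
  "alg_CCC = alg_prod alg_C (alg_prod alg_C alg_C)"

definition alg_C_eps2 :: "(complex \<times> 2 trunc) calgebra" where
  "alg_C_eps2 = alg_prod alg_C alg_trunc"

definition alg_eps3 :: "3 trunc calgebra" where
  "alg_eps3 = alg_trunc"


section \<open>Rational maps of projective space and Cremona transformations\<close>

text \<open>The projective space of dimension \<open>n\<close> is the one of lines in \<open>complex^'n\<close> with
  \<open>CARD('n) = n + 1\<close>. A rational self-map is given by forms of the same degree, not all zero, where
  two such tuples define the same map iff they are proportional. It is represented by the set of all
  tuples that define it.\<close>

definition form_map :: "nat \<Rightarrow> (complex^'n \<Rightarrow> complex^'n) \<Rightarrow> bool" where
  "form_map d F \<longleftrightarrow> (\<forall>i. form (*s) d (\<lambda>x. F x $ i)) \<and> (\<exists>x. F x \<noteq> 0)"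

type_synonym 'n ratmap = "(complex^'n \<Rightarrow> complex^'n) set"

definition projectivization :: "(complex^'n \<Rightarrow> complex^'n) \<Rightarrow> 'n ratmap" where
  "projectivization F = {G. (\<exists>x. F x \<noteq> 0) \<and> (\<exists>d. form_map d G) \<and>
     (\<forall>x i j. F x $ i * G x $ j = F x $ j * G x $ i)}"

text \<open>All representatives give the same class below. The composition is empty, hence not a rational
  map, when the image of \<open>g\<close> lies in the locus where \<open>f\<close> is undefined.\<close>

definition ratmap_comp :: "'n::finite ratmap \<Rightarrow> 'n ratmap \<Rightarrow> 'n ratmap" where
  "ratmap_comp f g = (\<Union>F\<in>f. \<Union>G\<in>g. projectivization (F \<circ> G))"

definition birational_inverse :: "'n::finite ratmap \<Rightarrow> 'n ratmap \<Rightarrow> bool" where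
  "birational_inverse f g \<longleftrightarrow>
     ratmap_comp f g = projectivization id \<and> ratmap_comp g f = projectivization id"

definition no_common_factor :: "(complex^'n \<Rightarrow> complex^'n) \<Rightarrow> bool" where
  "no_common_factor F \<longleftrightarrow>
     (\<forall>h. polyfun (*s) h \<and> (\<forall>i. \<exists>g. polyfun (*s) g \<and> (\<forall>x. F x $ i = h x * g x)) \<longrightarrow>
        (\<exists>c. \<forall>x. h x = c))"

definition quadratic_ratmap :: "'n::finite ratmap \<Rightarrow> bool" where
  "quadratic_ratmap f \<longleftrightarrow> (\<exists>F. form_map 2 F \<and> no_common_factor F \<and> f = projectivization F)"

definition quadro_quadric_cremona :: "'n::finite ratmap \<Rightarrow> bool" where
  "quadro_quadric_cremona f \<longleftrightarrow>
     quadratic_ratmap f \<and> (\<exists>g. quadratic_ratmap g \<and> birational_inverse f g)"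

text \<open>The automorphisms of projective space are the projective linear transformations.\<close>

definition proj_aut :: "'n::finite ratmap set" where
  "proj_aut = {projectivization ((*v) M) | M :: complex^'n^'n. invertible M}"

definition linearly_equivalent :: "'n::finite ratmap \<Rightarrow> 'n ratmap \<Rightarrow> bool" where
  "linearly_equivalent f f' \<longleftrightarrow>
     (\<exists>l1\<in>proj_aut. \<exists>l2\<in>proj_aut. f' = ratmap_comp l1 (ratmap_comp f l2))"

definition map_1 :: "complex^3 \<Rightarrow> complex^3" where
  "map_1 v = (let x = v $ 1; y = v $ 2; z = v $ 3 in vector [y * z, x * z, x * y])"

definition map_2 :: "complex^3 \<Rightarrow> complex^3" where
  "map_2 v = (let x = v $ 1; y = v $ 2; z = v $ 3 in vector [y\<^sup>2, x * y, - (x * z)])"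

definition map_3 :: "complex^3 \<Rightarrow> complex^3" where
  "map_3 v = (let x = v $ 1; y = v $ 2; z = v $ 3 in vector [x\<^sup>2, - (x * y), y\<^sup>2 - x * z])"

end

(* Algebras: in a rank 3 algebra A of dimension 3 a general element g has 1, g, g^2 as a basis, and
   the Jordan identity with y = x forces g^2 g^2 = g (g g^2), so that A is C[t] modulo the cubic of g.
   The three algebras correspond to the multiplicities of the roots of this cubic.

   Cremona transformations: let F have the inverse G and choose e with G(F(e)) = n e, n <> 0. The
   t-coefficient of "G(F(e + tv)) is proportional to e + tv" gives 4 C(F(e), B(e,v)) = T(v) e + n v for
   the polarisations B and C of F and G. Composing F with a linear map one may therefore assume
   2 B(e,v) = T(v) e - v, as for the adjoint of an algebra with unity e and generic trace T, and then G
   satisfies the same. For v with e, v, F(v) independent the remaining coefficients for F and for G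
   determine F on this basis up to the three numbers T(v), T(F(v)) and n(v) with F(F(v)) = n(v) v: it is
   the adjoint of C[t]/(t^3 - T(v) t^2 + T(F(v)) t - n(v)). If there is no such v, then F is divisible by a
   linear form. The three maps are inequivalent since they have three, two and one base points. *)

theory Submission
  imports Defs "HOL-Computational_Algebra.Fundamental_Theorem_Algebra"
begin

section \<open>Polynomial functions\<close>

text \<open>Besides adjoints, the shape 2 B(e,v) = T(v) e - v has a second origin. Once F is
  composed with a linear map and G rescaled so that F(e) = e = G(e), the t-coefficient says that v
  \<mapsto> C(e, B(e,v)) is the operator v \<mapsto> (T(v) e + v) / 4, and v = e forces T(e) = 3.
  The map \<sigma>: v \<mapsto> (T(v) e - v) / 2 is a square root of this operator, so imposing
  B(e,v) = \<sigma>(v) yields C(e,v) = \<sigma>(v) too. This puts F and G on an equal footing: each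
  identity for F may be used with F and G exchanged, and the equality F(v) = G(v) comes out at the
  end instead of being assumed. The other difficulty is that a rational map is the set of all its
  representatives, of every degree, with no factor cancelled. Proportionality is therefore expressed
  by 2x2 minors, polynomials that vanish everywhere as soon as they vanish at general points, and
  questions of divisibility are settled on lines, where a nonconstant polynomial has a zero.\<close>

lemma polyfun_uminus:
  assumes "polyfun sc f" shows "polyfun sc (\<lambda>x. - f x)"
  using polyfun.mult[OF polyfun.const[of sc "-1"] assms] by simp

lemma polyfun_diff:
  assumes "polyfun sc f" "polyfun sc g" shows "polyfun sc (\<lambda>x. f x - g x)"
  using polyfun.add[OF assms(1) polyfun_uminus[OF assms(2)]] by simp

lemma polyfun_power: "polyfun sc f \<Longrightarrow> polyfun sc (\<lambda>x. f x ^ n)"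
  by (induction n) (auto intro: polyfun.intros)

lemma polyfun_sum: "(\<And>i. i \<in> I \<Longrightarrow> polyfun sc (f i)) \<Longrightarrow> polyfun sc (\<lambda>x. \<Sum>i\<in>I. f i x)"
  by (induction I rule: infinite_finite_induct) (auto intro: polyfun.intros)

lemmas polyfun_intros = polyfun.const polyfun.add polyfun.mult polyfun_uminus polyfun_diff polyfun_power
  polyfun_sum

section \<open>Restriction to lines and general points\<close>

lemma polyfun_line:
  assumes f: "polyfun sc f" and V: "vector_space sc"
  shows "\<exists>p. \<forall>t. f (x + sc t y) = poly p t"
  using f
proof induction
  case (const c)
  have "\<forall>t. c = poly [:c:] t" by simp
  then show ?case by blast
next
  case (linear l)
  interpret l: Vector_Spaces.linear sc "(*)" l by fact
  have "\<forall>t. l (x + sc t y) = poly [:l x, l y:] t"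
    by (simp add: l.add l.scale)
  then show ?case by blast
next
  case (add f g)
  then obtain p q where "\<forall>t. f (x + sc t y) = poly p t" "\<forall>t. g (x + sc t y) = poly q t"
    by blast
  then have "\<forall>t. f (x + sc t y) + g (x + sc t y) = poly (p + q) t"
    by simp
  then show ?case by blast
next
  case (mult f g)
  then obtain p q where "\<forall>t. f (x + sc t y) = poly p t" "\<forall>t. g (x + sc t y) = poly q t"
    by blast
  then have "\<forall>t. f (x + sc t y) * g (x + sc t y) = poly (p * q) t"
    by simp
  then show ?case by blast
qed

lemma poly_eq_0_if_nonzero:
  fixes p :: "complex poly"
  assumes "\<And>t. t \<noteq> 0 \<Longrightarrow> poly p t = 0"
  shows "p = 0"
proof (rule ccontr)
  assume "p \<noteq> 0"
  then have "finite {t. poly p t = 0}"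
    by (rule poly_roots_finite)
  then have "finite (insert 0 {t. poly p t = 0})"
    by simp
  moreover have "insert 0 {t. poly p t = 0} = UNIV"
    using assms by auto
  ultimately show False
    using infinite_UNIV_char_0[where 'a = complex] by simp
qed

text \<open>The limit t \<rightarrow> 0 without topology: the restriction to the line is a
  polynomial in t with infinitely many zeros.\<close>

lemma polyfun_eq_0_limit:
  assumes "polyfun sc f" "vector_space sc" "\<And>t. t \<noteq> 0 \<Longrightarrow> f (x + sc t y) = 0"
  shows "f x = 0"
proof -
  interpret vector_space sc by fact
  obtain p where p: "\<And>t. f (x + sc t y) = poly p t"
    using polyfun_line[OF assms(1,2)] by metis
  then have "p = 0"
    using assms(3) by (intro poly_eq_0_if_nonzero) metis
  then show ?thesis
    using p[of 0] by simp
qed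

text \<open>On the line through \<open>x\<close> and \<open>y\<close> both functions become nonzero
  elements of C[t], which is a domain. So any two nonempty sets of the form {f \<noteq> 0} meet,
  which is what justifies arguing at general points.\<close>

lemma polyfun_common_nonzero:
  assumes "polyfun sc f" "polyfun sc g" "vector_space sc" "f x \<noteq> 0" "g y \<noteq> 0"
  shows "\<exists>z. f z \<noteq> 0 \<and> g z \<noteq> 0"
proof (rule ccontr)
  assume none: "\<not> ?thesis"
  interpret vector_space sc by fact
  obtain p where p: "\<And>t. f (x + sc t (y - x)) = poly p t"
    using polyfun_line[OF assms(1,3)] by metis
  obtain q where q: "\<And>t. g (x + sc t (y - x)) = poly q t"
    using polyfun_line[OF assms(2,3)] by metis
  have "poly (p * q) t = 0" for t
    using none p[of t] q[of t] by (metis mult_eq_0_iff poly_mult)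
  then have "p * q = 0"
    by (intro poly_eq_0_if_nonzero)
  moreover have "p \<noteq> 0"
    using p[of 0] assms(4) by auto
  moreover have "q \<noteq> 0"
    using q[of 1] assms(5) by auto
  ultimately show False by simp
qed

lemma polyfun_eq_0_generic:
  assumes "polyfun sc f" "polyfun sc g" "vector_space sc" "g y \<noteq> 0"
    and "\<And>x. g x \<noteq> 0 \<Longrightarrow> f x = 0"
  shows "f x = 0"
  using polyfun_common_nonzero[OF assms(1-3) _ assms(4)] assms(5) by blast

text \<open>The Taylor expansion of order 2 at 0. The inductive definition of \<open>polyfun\<close>
  offers no coefficients to read off, and the space comes without a basis, so the polarisation
  \<open>b\<close> of the quadratic part is carried through the induction. The remainder is recorded
  separately on each ray.\<close>

definition jet2 ::
  "(complex \<Rightarrow> 'a::ab_group_add \<Rightarrow> 'a) \<Rightarrow> ('a \<Rightarrow> complex) \<Rightarrow> complex \<Rightarrow> ('a \<Rightarrow> complex) \<Rightarrow>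
    ('a \<Rightarrow> 'a \<Rightarrow> complex) \<Rightarrow> bool" where
  "jet2 sc f c l b \<longleftrightarrow>
    Vector_Spaces.linear sc (*) l \<and> (\<forall>y. Vector_Spaces.linear sc (*) (\<lambda>x. b x y)) \<and>
    (\<forall>x y. b x y = b y x) \<and>
    (\<forall>x. \<exists>p. \<forall>t. f (sc t x) = c + t * l x + t\<^sup>2 * b x x + t ^ 3 * poly p t)"

lemma polyfun_jet2:
  assumes "polyfun sc f" and V: "vector_space sc"
  shows "\<exists>c l b. jet2 sc f c l b"
  using assms(1)
proof induction
  interpret V: vector_space sc by fact
  interpret P: vector_space_pair sc "(*) :: complex \<Rightarrow> complex \<Rightarrow> complex" ..
  note [simp] = P.linear_zero
  {
    case (const c)
    have "jet2 sc (\<lambda>x. c) c (\<lambda>x. 0) (\<lambda>x y. 0)"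
      by (auto simp: jet2_def intro: exI[of _ 0])
    then show ?case by blast
  next
    case (linear l)
    then interpret l: Vector_Spaces.linear sc "(*)" l .
    have "jet2 sc l 0 l (\<lambda>x y. 0)"
      using linear by (auto simp: jet2_def l.scale intro: exI[of _ 0])
    then show ?case by blast
  next
    case (add f g)
    then obtain c l b c' l' b' where fg: "jet2 sc f c l b" "jet2 sc g c' l' b'"
      by blast
    have "\<exists>p. \<forall>t. f (sc t x) + g (sc t x) =
      c + c' + t * (l x + l' x) + t\<^sup>2 * (b x x + b' x x) + t ^ 3 * poly p t" for x
    proof -
      obtain p q where "\<forall>t. f (sc t x) = c + t * l x + t\<^sup>2 * b x x + t ^ 3 * poly p t"
        "\<forall>t. g (sc t x) = c' + t * l' x + t\<^sup>2 * b' x x + t ^ 3 * poly q t"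
        using fg unfolding jet2_def by blast
      then show ?thesis
        by (intro exI[of _ "p + q"]) (simp add: algebra_simps)
    qed
    moreover have "b x y + b' x y = b y x + b' y x" for x y
      using fg unfolding jet2_def by metis
    moreover have "Vector_Spaces.linear sc (*) (\<lambda>x. l x + l' x)"
      "Vector_Spaces.linear sc (*) (\<lambda>x. b x y + b' x y)" for y
      using fg unfolding jet2_def by (auto intro!: P.linear_compose_add)
    ultimately have "jet2 sc (\<lambda>x. f x + g x) (c + c') (\<lambda>x. l x + l' x) (\<lambda>x y. b x y + b' x y)"
      unfolding jet2_def by blast
    then show ?case by blast
  next
    case (mult f g)
    then obtain c l b c' l' b' where fg: "jet2 sc f c l b" "jet2 sc g c' l' b'"
      by blast
    \<comment> \<open>On the diagonal the quadratic part of the product is c b' + c' b + l l'; the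
      last term is symmetrised to obtain a polarisation.\<close>
    define b'' where "b'' x y = c * b' x y + c' * b x y + (l x * l' y + l y * l' x) / 2" for x y
    have "\<exists>p. \<forall>t. f (sc t x) * g (sc t x) =
      c * c' + t * (c * l' x + c' * l x) + t\<^sup>2 * b'' x x + t ^ 3 * poly p t" for x
    proof -
      obtain p q where p: "\<forall>t. f (sc t x) = c + t * l x + t\<^sup>2 * b x x + t ^ 3 * poly p t"
        and q: "\<forall>t. g (sc t x) = c' + t * l' x + t\<^sup>2 * b' x x + t ^ 3 * poly q t"
        using fg unfolding jet2_def by blast
      \<comment> \<open>All products of order at least 3, divided by t^3.\<close>
      define r where "r = [:l x * b' x x + l' x * b x x, b x x * b' x x:]
        + p * [:c', l' x, b' x x:] + q * [:c, l x, b x x:] + [:0,0,0,1:] * p * q"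
      have "f (sc t x) * g (sc t x) =
        c * c' + t * (c * l' x + c' * l x) + t\<^sup>2 * b'' x x + t ^ 3 * poly r t" for t
      proof -
        have "t\<^sup>2 * b'' x x = t\<^sup>2 * (c * b' x x + c' * b x x + l x * l' x)"
          by (simp add: b''_def)
        then show ?thesis
          unfolding p[rule_format] q[rule_format]
          by (simp add: r_def) algebra
      qed
      then show ?thesis by blast
    qed
    moreover have "b'' x y = b'' y x" for x y
      using fg unfolding jet2_def b''_def by (metis add.commute)
    moreover have "Vector_Spaces.linear sc (*) (\<lambda>x. c * l' x + c' * l x)"
      using fg unfolding jet2_def
      by (intro P.linear_compose_add P.linear_compose_scale_right) auto
    moreover have "Vector_Spaces.linear sc (*) (\<lambda>x. b'' x y)" for y
    proof -
      have eq: "(\<lambda>x. b'' x y) = (\<lambda>x. c * b' x y + c' * b x y + ((l' y / 2) * l x + (l y / 2) * l' x))"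
        by (simp add: b''_def field_simps fun_eq_iff)
      show ?thesis
        unfolding eq using fg unfolding jet2_def
        by (intro P.linear_compose_add P.linear_compose_scale_right) auto
    qed
    ultimately have "jet2 sc (\<lambda>x. f x * g x) (c * c') (\<lambda>x. c * l' x + c' * l x) b''"
      unfolding jet2_def by blast
    then show ?case by blast
  }
qed

lemma form_2_bilinear:
  assumes f: "form sc 2 f" and V: "vector_space sc"
  obtains b where "\<And>y. Vector_Spaces.linear sc (*) (\<lambda>x. b x y)" "\<And>x y. b x y = b y x" "\<And>x. f x = b x x"
proof -
  have pf: "polyfun sc f" and hom: "\<And>c x. f (sc c x) = c ^ 2 * f x"
    using f by (auto simp: form_def)
  obtain c l b where b: "\<And>y. Vector_Spaces.linear sc (*) (\<lambda>x. b x y)" "\<And>x y. b x y = b y x"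
      and p: "\<And>x. \<exists>p. \<forall>t. f (sc t x) = c + t * l x + t\<^sup>2 * b x x + t ^ 3 * poly p t"
    using polyfun_jet2[OF pf V] unfolding jet2_def by blast
  have "f x = b x x" for x
  proof -
    obtain p where p: "\<And>t. f (sc t x) = c + t * l x + t\<^sup>2 * b x x + t ^ 3 * poly p t"
      using p[of x] by metis
    \<comment> \<open>The coefficients of \<open>f (sc t x)\<close> - t^2 \<open>f x\<close>, which
      is identically 0 by homogeneity.\<close>
    define q where "q = [:c, l x, b x x - f x:] + [:0,0,0,1:] * p"
    have "poly q t = 0" for t
      using p[of t] hom[of t x] by (simp add: q_def field_simps power2_eq_square power3_eq_cube)
    then have "q = 0"
      by (intro poly_eq_0_if_nonzero)
    then have "coeff q 2 = 0"
      by simp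
    then show ?thesis
      by (simp add: q_def coeff_pCons numeral_2_eq_2)
  qed
  with b show ?thesis
    by (rule that)
qed

section \<open>Proportional tuples of forms\<close>

lemma vector_space_vec: "vector_space ((*s) :: complex \<Rightarrow> complex^'n \<Rightarrow> complex^'n)"
  by (rule vec.vector_space_axioms)

lemma linear_nth: "Vector_Spaces.linear (*s) (*) (\<lambda>x :: complex^'n. x $ i)"
  by unfold_locales (simp_all add: algebra_simps)

lemma polyfun_nth: "polyfun (*s) (\<lambda>x :: complex^'n. x $ i)"
  by (rule polyfun.linear[OF linear_nth])

lemma linear_matrix_nth: "Vector_Spaces.linear (*s) (*) (\<lambda>x. (M *v x) $ i)"
  for M :: "complex^'n^'m"
  by unfold_locales (simp_all add: matrix_vector_right_distrib matrix_vector_mult_scaleR vector_scalar_commute)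

definition poly_tuple :: "(complex^'n \<Rightarrow> complex^'m) \<Rightarrow> bool" where
  "poly_tuple F \<longleftrightarrow> (\<forall>i. polyfun (*s) (\<lambda>x. F x $ i))"

lemma form_map_poly_tuple: "form_map d F \<Longrightarrow> poly_tuple F"
  by (simp add: form_map_def poly_tuple_def form_def)

lemma form_map_scale: "form_map d F \<Longrightarrow> F (c *s x) = c ^ d *s F x"
  by (simp add: form_map_def form_def vec_eq_iff)

lemma form_map_iff:
  "form_map d F \<longleftrightarrow> poly_tuple F \<and> (\<forall>c x. F (c *s x) = c ^ d *s F x) \<and> (\<exists>x. F x \<noteq> 0)"
  by (auto simp: form_map_def poly_tuple_def form_def vec_eq_iff)

lemma polyfun_compose:
  fixes G :: "complex^'n \<Rightarrow> complex^'m"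
  assumes "polyfun (*s) f" "poly_tuple G"
  shows "polyfun (*s) (\<lambda>x. f (G x))"
  using assms(1)
proof induction
  case (linear l)
  interpret l: Vector_Spaces.linear "(*s)" "(*)" l by fact
  have l: "l v = (\<Sum>i\<in>UNIV. v $ i * l (axis i 1))" for v
  proof -
    have "l (\<Sum>i\<in>UNIV. v $ i *s axis i 1) = (\<Sum>i\<in>UNIV. v $ i * l (axis i 1))"
      by (simp only: l.sum l.scale)
    then show ?thesis
      by (simp only: basis_expansion)
  qed
  have "(\<lambda>x. l (G x)) = (\<lambda>x. \<Sum>i\<in>UNIV. G x $ i * l (axis i 1))"
    by (rule ext) (rule l)
  then show ?case
    using assms(2) by (auto simp: poly_tuple_def intro!: polyfun_intros)
qed (auto intro: polyfun.intros)

lemma poly_tuple_compose: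
  assumes "poly_tuple F" "poly_tuple G"
  shows "poly_tuple (F \<circ> G)"
  unfolding poly_tuple_def
proof
  fix i
  have "polyfun (*s) (\<lambda>x. F x $ i)"
    using assms(1) by (simp add: poly_tuple_def)
  from polyfun_compose[OF this assms(2)] show "polyfun (*s) (\<lambda>x. (F \<circ> G) x $ i)"
    by simp
qed

lemma poly_tuple_matrix: "poly_tuple ((*v) M)" for M :: "complex^'n^'m"
  unfolding poly_tuple_def using polyfun.linear[OF linear_matrix_nth] by blast

lemma form_map_compose:
  assumes "form_map d F" "form_map e G" "\<exists>x. F (G x) \<noteq> 0"
  shows "form_map (d * e) (F \<circ> G)"
  using assms poly_tuple_compose[of F G]
  by (auto simp: form_map_iff power_mult mult.commute simp flip: power_mult)

lemma form_map_matrix: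
  fixes M :: "complex^'n^'n"
  assumes "invertible M"
  shows "form_map 1 ((*v) M)"
proof -
  obtain N where "M ** N = mat 1"
    using assms by (auto simp: invertible_def)
  then have "M *v (N *v axis undefined 1) \<noteq> 0"
    by (simp add: matrix_vector_mul_assoc axis_eq_0_iff)
  then show ?thesis
    by (auto simp: form_map_iff poly_tuple_matrix vector_scalar_commute)
qed

lemma form_map_id: "form_map 1 (id :: complex^'n \<Rightarrow> complex^'n)"
  by (auto simp: form_map_iff poly_tuple_def polyfun_nth intro!: exI[of _ "axis undefined 1"] simp: axis_eq_0_iff)

text \<open>Vanishing of the 2x2 minors: a polynomial condition, hence inherited from general
  points. It includes zero vectors, so it is transitive only across a nonzero middle vector.\<close>

definition parallel :: "'a::comm_ring_1^'n \<Rightarrow> 'a^'n \<Rightarrow> bool" where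
  "parallel u v \<longleftrightarrow> (\<forall>i j. u $ i * v $ j = u $ j * v $ i)"

lemma parallel_refl: "parallel u u"
  by (simp add: parallel_def mult.commute)

lemma parallel_sym: "parallel u v \<Longrightarrow> parallel v u"
  by (simp add: parallel_def mult.commute)

lemma parallel_scale: "parallel u v \<Longrightarrow> parallel (c *s u) v"
  by (simp add: parallel_def mult.assoc)

lemma parallel_scale_self: "parallel (c *s u) u"
  by (simp add: parallel_def)

lemma parallel_imp_scale:
  fixes u v :: "complex^'n"
  assumes "parallel u v" "u \<noteq> 0"
  obtains c where "v = c *s u"
proof -
  obtain i where "u $ i \<noteq> 0"
    using assms(2) by (auto simp: vec_eq_iff)
  then have "v = (v $ i / u $ i) *s u"
    using assms(1) by (auto simp: vec_eq_iff parallel_def field_simps)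
  then show ?thesis by (rule that)
qed

lemma parallel_unscale:
  fixes u v :: "complex^'n"
  shows "parallel (c *s u) v \<Longrightarrow> c \<noteq> 0 \<Longrightarrow> parallel u v"
  by (simp add: parallel_def)

lemma parallel_trans:
  fixes u v w :: "complex^'n"
  assumes "parallel u v" "parallel v w" "v \<noteq> 0"
  shows "parallel u w"
proof -
  obtain a b where "u = a *s v" "w = b *s v"
    using assms parallel_imp_scale parallel_sym by metis
  then show ?thesis
    by (simp add: parallel_def)
qed

lemma parallel_matrix:
  fixes u v :: "complex^'n"
  assumes "parallel u v" shows "parallel (M *v u) (M *v v)"
proof (cases "u = 0")
  case True
  then show ?thesis by (simp add: parallel_def)
next
  case False
  then obtain c where "v = c *s u"
    using assms parallel_imp_scale by blast
  then show ?thesis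
    by (metis parallel_scale_self parallel_sym vector_scalar_commute)
qed

lemma poly_tuple_nonzero_component:
  assumes "poly_tuple F" "F x \<noteq> 0"
  obtains f where "polyfun (*s) f" "f x \<noteq> 0" "\<And>x. f x \<noteq> 0 \<Longrightarrow> F x \<noteq> 0"
proof -
  obtain i where "F x $ i \<noteq> 0"
    using assms(2) by (auto simp: vec_eq_iff)
  with assms(1) show ?thesis
    by (intro that[of "\<lambda>x. F x $ i"]) (auto simp: poly_tuple_def)
qed

lemma poly_tuple_common_nonzero:
  assumes "poly_tuple F" "poly_tuple G" "F x \<noteq> 0" "G y \<noteq> 0"
  obtains z where "F z \<noteq> 0" "G z \<noteq> 0"
proof -
  obtain f where f: "polyfun (*s) f" "f x \<noteq> 0" "\<And>x. f x \<noteq> 0 \<Longrightarrow> F x \<noteq> 0"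
    using poly_tuple_nonzero_component[OF assms(1,3)] by metis
  obtain g where g: "polyfun (*s) g" "g y \<noteq> 0" "\<And>x. g x \<noteq> 0 \<Longrightarrow> G x \<noteq> 0"
    using poly_tuple_nonzero_component[OF assms(2,4)] by metis
  show ?thesis
    using polyfun_common_nonzero[OF f(1) g(1) vector_space_vec f(2) g(2)] f(3) g(3) that by blast
qed

lemma parallel_generic:
  assumes "poly_tuple F" "poly_tuple G" "polyfun (*s) h" "h y \<noteq> 0"
    and "\<And>x. h x \<noteq> 0 \<Longrightarrow> parallel (F x) (G x)"
  shows "parallel (F x) (G x)"
proof -
  have "F x $ i * G x $ j - F x $ j * G x $ i = 0" for i j
  proof -
    have "polyfun (*s) (\<lambda>x. F x $ i * G x $ j - F x $ j * G x $ i)"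
      using assms(1,2) unfolding poly_tuple_def by (intro polyfun_intros) blast+
    from polyfun_eq_0_generic[OF this assms(3) vector_space_vec assms(4)] show ?thesis
      using assms(5) by (simp add: parallel_def)
  qed
  then show ?thesis
    by (simp add: parallel_def)
qed

text \<open>Where \<open>G\<close> is nonzero plain transitivity applies; such points are general,
  and the minors of \<open>F\<close> and \<open>H\<close> are polynomials.\<close>

lemma parallel_trans_generic:
  assumes "poly_tuple F" "poly_tuple G" "poly_tuple H" "G y \<noteq> 0"
    and "\<And>x. parallel (F x) (G x)" "\<And>x. parallel (G x) (H x)"
  shows "parallel (F x) (H x)"
proof -
  obtain g where g: "polyfun (*s) g" "g y \<noteq> 0" "\<And>x. g x \<noteq> 0 \<Longrightarrow> G x \<noteq> 0"
    using poly_tuple_nonzero_component[OF assms(2,4)] by metis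
  show ?thesis
    by (rule parallel_generic[OF assms(1,3) g(1,2)])
      (rule parallel_trans[OF assms(5,6) g(3)])
qed

section \<open>Classes of representatives and their composition\<close>

lemma mem_projectivization_iff:
  "G \<in> projectivization F \<longleftrightarrow>
    (\<exists>x. F x \<noteq> 0) \<and> (\<exists>d. form_map d G) \<and> (\<forall>x. parallel (F x) (G x))"
  by (simp add: projectivization_def parallel_def)

lemma form_map_mem_projectivization: "form_map d F \<Longrightarrow> F \<in> projectivization F"
  by (auto simp: mem_projectivization_iff parallel_refl form_map_def)

lemma projectivization_cong:
  assumes "poly_tuple F" "poly_tuple G" "\<exists>x. F x \<noteq> 0" "\<exists>x. G x \<noteq> 0" "\<And>x. parallel (F x) (G x)"
  shows "projectivization F = projectivization G"
proof -
  have "projectivization F \<subseteq> projectivization G"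
    if fg: "poly_tuple F" "poly_tuple G" "\<exists>x. F x \<noteq> 0" "\<exists>x. G x \<noteq> 0" "\<And>x. parallel (F x) (G x)"
    for F G :: "complex^'a \<Rightarrow> complex^'a"
  proof
    fix H assume H: "H \<in> projectivization F"
    from H obtain d where d: "form_map d H" and FH: "\<And>x. parallel (F x) (H x)"
      unfolding mem_projectivization_iff by blast
    obtain y where y: "F y \<noteq> 0"
      using fg(3) by blast
    have "parallel (G x) (H x)" for x
      using parallel_trans_generic[where F = G and G = F and H = H,
          OF fg(2,1) form_map_poly_tuple[OF d] y parallel_sym[OF fg(5)] FH] .
    with d fg(4) show "H \<in> projectivization G"
      unfolding mem_projectivization_iff by blast
  qed
  from this[of F G] this[of G F] assms show ?thesis
    by (blast intro: parallel_sym)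
qed

text \<open>At points with \<open>G x\<close> \<noteq> 0 the vector \<open>G' x\<close> is a
  multiple of \<open>G x\<close>, and homogeneity of \<open>F'\<close> turns the multiple into a
  scalar factor of the value. The other points follow by genericity.\<close>

lemma form_map_parallel_compose:
  assumes "form_map d F" "form_map d' F'" "form_map e G" "form_map e' G'"
    and FF': "\<And>x. parallel (F x) (F' x)" and GG': "\<And>x. parallel (G x) (G' x)"
  shows "parallel (F (G x)) (F' (G' x))"
proof -
  note pt = assms(1-4)[THEN form_map_poly_tuple]
  obtain y where y: "G y \<noteq> 0" "G' y \<noteq> 0"
    using poly_tuple_common_nonzero[OF pt(3,4)] assms(3,4) unfolding form_map_def by metis
  obtain g where g: "polyfun (*s) g" "g y \<noteq> 0" "\<And>x. g x \<noteq> 0 \<Longrightarrow> G x \<noteq> 0"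
    using poly_tuple_nonzero_component[OF pt(3) y(1)] by metis
  have "parallel ((F \<circ> G) x) ((F' \<circ> G') x)"
  proof (rule parallel_generic[OF poly_tuple_compose[OF pt(1,3)] poly_tuple_compose[OF pt(2,4)] g(1,2)])
    fix x assume "g x \<noteq> 0"
    then have "G x \<noteq> 0"
      by (rule g(3))
    then obtain c where "G' x = c *s G x"
      using GG'[of x] parallel_imp_scale by blast
    then have "F' (G' x) = c ^ d' *s F' (G x)"
      using form_map_scale[OF assms(2)] by simp
    then show "parallel ((F \<circ> G) x) ((F' \<circ> G') x)"
      using FF'[of "G x"] by (simp add: parallel_scale parallel_sym)
  qed
  then show ?thesis by simp
qed

text \<open>Composites of representatives are proportional, so the union collapses to one class. A
  representative of the outer map may carry a factor that vanishes on the image of the inner one;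
  its composite is 0 and contributes the empty set.\<close>

lemma ratmap_comp_projectivization:
  assumes F: "form_map d F" and G: "form_map e G" and nz: "\<exists>x. F (G x) \<noteq> 0"
  shows "ratmap_comp (projectivization F) (projectivization G) = projectivization (F \<circ> G)"
proof
  show "projectivization (F \<circ> G) \<subseteq> ratmap_comp (projectivization F) (projectivization G)"
    unfolding ratmap_comp_def using F G form_map_mem_projectivization by blast
next
  have "projectivization (F' \<circ> G') \<subseteq> projectivization (F \<circ> G)"
    if F': "F' \<in> projectivization F" and G': "G' \<in> projectivization G" for F' G'
  proof (cases "\<exists>x. F' (G' x) \<noteq> 0")
    case True
    obtain d' e' where de: "form_map d' F'" "form_map e' G'"
      using F' G' by (auto simp: mem_projectivization_iff)
    have "parallel ((F' \<circ> G') x) ((F \<circ> G) x)" for x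
      using F' G' form_map_parallel_compose[OF F de(1) G de(2)]
      by (auto simp: mem_projectivization_iff intro: parallel_sym)
    then have "projectivization (F' \<circ> G') = projectivization (F \<circ> G)"
      using F G de nz True
      by (intro projectivization_cong poly_tuple_compose) (auto dest: form_map_poly_tuple)
    then show ?thesis by simp
  next
    case False
    then show ?thesis by (auto simp: mem_projectivization_iff)
  qed
  then show "ratmap_comp (projectivization F) (projectivization G) \<subseteq> projectivization (F \<circ> G)"
    unfolding ratmap_comp_def by blast
qed

section \<open>Algebras generated by one element over the unity\<close>

definition comb :: "'a::ab_group_add calgebra \<Rightarrow> 'a \<Rightarrow> complex \<Rightarrow> complex \<Rightarrow> complex \<Rightarrow> 'a" where
  "comb A g u v w = smul A u (unity A) + smul A v g + smul A w (mul A g g)"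

text \<open>The algebra C[t] modulo t^3 - T t^2 + S t - N with \<open>g\<close> the class of t.
  \<open>T\<close>, \<open>S\<close>, \<open>N\<close> are numbers attached to this one generator,
  not forms. Associativity is not assumed: \<open>quartic\<close>, the Jordan identity with y = x =
  g, has to provide it.\<close>

locale cubic_algebra = vector_space "smul A" for A :: "'a::ab_group_add calgebra" +
  fixes g :: 'a and T S N :: complex
  assumes mul_add_left: "mul A (x + y) z = mul A x z + mul A y z"
    and mul_smul_left: "mul A (smul A c x) y = smul A c (mul A x y)"
    and mul_commute: "mul A x y = mul A y x"
    and mul_unity: "mul A (unity A) x = x"
    and comb_surj: "\<exists>u v w. z = comb A g u v w"
    and comb_eq_0: "comb A g u v w = 0 \<Longrightarrow> u = 0 \<and> v = 0 \<and> w = 0"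
    and cubic: "mul A g (mul A g g) = comb A g N (- S) T"
    and quartic: "mul A (mul A g g) (mul A g g) = mul A g (mul A g (mul A g g))"
begin

lemma mul_add_right: "mul A z (x + y) = mul A z x + mul A z y"
  using mul_add_left mul_commute by metis

lemma mul_smul_right: "mul A y (smul A c x) = smul A c (mul A y x)"
  using mul_smul_left mul_commute by metis

lemma comb_add: "comb A g u v w + comb A g u' v' w' = comb A g (u + u') (v + v') (w + w')"
  by (simp add: comb_def scale_left_distrib algebra_simps)

lemma comb_scale: "smul A c (comb A g u v w) = comb A g (c * u) (c * v) (c * w)"
  by (simp add: comb_def scale_right_distrib)

lemma comb_minus: "- comb A g u v w = comb A g (- u) (- v) (- w)"
  by (simp add: comb_def scale_minus_left)

lemma comb_inject: "comb A g u v w = comb A g u' v' w' \<longleftrightarrow> u = u' \<and> v = v' \<and> w = w'"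
proof
  assume "comb A g u v w = comb A g u' v' w'"
  then have "comb A g u v w + - comb A g u' v' w' = 0"
    by simp
  then have "comb A g (u - u') (v - v') (w - w') = 0"
    by (simp add: comb_minus comb_add)
  then show "u = u' \<and> v = v' \<and> w = w'"
    using comb_eq_0 by fastforce
qed simp

lemma mul_g_comb: "mul A g (comb A g u v w) = comb A g (w * N) (u - w * S) (v + w * T)"
proof -
  have "mul A g (unity A) = g"
    using mul_unity mul_commute by metis
  then have "mul A g (comb A g u v w) =
    smul A u g + smul A v (mul A g g) + smul A w (comb A g N (- S) T)"
    by (simp add: comb_def[of A g u v w] mul_add_right mul_smul_right cubic)
  also have "\<dots> = comb A g 0 u v + comb A g (w * N) (w * - S) (w * T)"
    by (simp only: comb_scale) (simp add: comb_def)
  finally show ?thesis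
    by (simp add: comb_add)
qed

text \<open>Linear in \<open>z\<close>, so it is enough to check 1, g and g^2; the first two cases
  are commutativity, the third is \<open>quartic\<close>.\<close>

lemma mul_square_g: "mul A (mul A g g) z = mul A g (mul A g z)"
proof -
  obtain u v w where z: "z = comb A g u v w"
    using comb_surj by blast
  have 1: "mul A g (unity A) = g" "mul A (mul A g g) (unity A) = mul A g g"
    "mul A (mul A g g) g = mul A g (mul A g g)"
    using mul_unity mul_commute by metis+
  show ?thesis
    unfolding z comb_def by (simp add: mul_add_right mul_smul_right 1 quartic)
qed

text \<open>Multiplication by any element is a polynomial in the operator of multiplication by
  \<open>g\<close>. Such operators commute, which is the reason for associativity.\<close>

lemma mul_comb:
  "mul A (comb A g u v w) z = smul A u z + smul A v (mul A g z) + smul A w (mul A g (mul A g z))"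
  by (simp add: comb_def mul_add_left mul_smul_left mul_unity mul_square_g)

lemma unity_comb: "unity A = comb A g 1 0 0" and g_comb: "g = comb A g 0 1 0"
  by (simp_all add: comb_def)

lemma mul_assoc: "mul A (mul A x y) z = mul A x (mul A y z)"
proof -
  obtain x0 x1 x2 y0 y1 y2 z0 z1 z2 where xyz:
    "x = comb A g x0 x1 x2" "y = comb A g y0 y1 y2" "z = comb A g z0 z1 z2"
    using comb_surj by metis
  show ?thesis
    unfolding xyz
    by (simp add: mul_comb mul_g_comb comb_scale comb_add comb_inject) (intro conjI; algebra)
qed

lemma jordan_algebra: "jordan_algebra A"
proof
  have "z \<in> span {unity A, g, mul A g g}" for z
  proof -
    obtain u v w where z: "z = comb A g u v w"
      using comb_surj by blast
    show ?thesis
      unfolding z comb_def by (intro span_add span_scale span_base) auto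
  qed
  then show "\<exists>B. finite B \<and> span B = UNIV"
    by (intro exI[of _ "{unity A, g, mul A g g}"]) auto
  show "mul A (mul A x x) (mul A x y) = mul A x (mul A (mul A x x) y)" for x y
    using mul_assoc mul_commute by metis
qed (fact mul_add_left mul_smul_left mul_commute mul_unity)+

lemma associative: "associative A"
  by (simp add: associative_def mul_assoc)

lemma independent_powers: "independent {unity A, g, mul A g g}" "card {unity A, g, mul A g g} = 3"
proof -
  have comb: "comb A g 1 0 0 = unity A" "comb A g 0 1 0 = g" "comb A g 0 0 1 = mul A g g"
    by (simp_all add: comb_def)
  have ne: "unity A \<noteq> 0" "unity A \<noteq> g" "g \<noteq> mul A g g" "unity A \<noteq> mul A g g"
    using comb_eq_0[of 1 0 0] comb_inject[of 1 0 0 0 1 0] comb_inject[of 0 1 0 0 0 1]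
      comb_inject[of 1 0 0 0 0 1] unfolding comb by auto
  then show "card {unity A, g, mul A g g} = 3"
    by simp
  have 1: "g \<notin> span {unity A}"
  proof
    assume "g \<in> span {unity A}"
    then obtain k where "g = smul A k (unity A)"
      by (auto simp: span_singleton)
    then have "comb A g k (-1) 0 = 0"
      by (simp add: comb_def)
    then show False using comb_eq_0 by force
  qed
  have 2: "mul A g g \<notin> span {g, unity A}"
  proof
    assume "mul A g g \<in> span {g, unity A}"
    then obtain k l where "mul A g g - smul A k g = smul A l (unity A)"
      unfolding span_insert[of g] span_singleton by blast
    then have "mul A g g = smul A k g + smul A l (unity A)"
      by (simp add: algebra_simps)
    then have "comb A g l k (-1) = 0"
      by (simp add: comb_def)
    then show False using comb_eq_0 by force
  qed
  have "independent {mul A g g, g, unity A}"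
    using 1 2 ne by (simp add: independent_insert)
  moreover have "{mul A g g, g, unity A} = {unity A, g, mul A g g}"
    by auto
  ultimately show "independent {unity A, g, mul A g g}"
    by simp
qed

lemma alg_dim: "alg_dim A = 3"
proof -
  have "z \<in> span {unity A, g, mul A g g}" for z
  proof -
    obtain u v w where z: "z = comb A g u v w"
      using comb_surj by blast
    show ?thesis
      unfolding z comb_def by (intro span_add span_scale span_base) auto
  qed
  then have "dim UNIV = card {unity A, g, mul A g g}"
    using independent_powers(1) by (intro dim_unique) auto
  then show ?thesis
    by (simp add: alg_dim_def independent_powers(2))
qed

section \<open>Coordinates and the rank of a cubic algebra\<close>

definition coord :: "nat \<Rightarrow> 'a \<Rightarrow> complex" where
  "coord i z = (case (THE c. z = comb A g (fst c) (fst (snd c)) (snd (snd c))) of (u, v, w) \<Rightarrow>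
     if i = 0 then u else if i = 1 then v else w)"

lemma coord_comb: "coord 0 (comb A g u v w) = u" "coord 1 (comb A g u v w) = v" 
  "coord 2 (comb A g u v w) = w"
proof -
  have "(THE c. comb A g u v w = comb A g (fst c) (fst (snd c)) (snd (snd c))) = (u, v, w)"
    by (rule the_equality) (auto simp: comb_inject)
  then show "coord 0 (comb A g u v w) = u" "coord 1 (comb A g u v w) = v" 
    "coord 2 (comb A g u v w) = w"
    by (simp_all add: coord_def)
qed

lemma comb_coord: "comb A g (coord 0 z) (coord 1 z) (coord 2 z) = z"
  using comb_surj[of z] coord_comb by metis

lemma coord_add: "i \<in> {0,1,2} \<Longrightarrow> coord i (x + y) = coord i x + coord i y"
  and coord_scale: "i \<in> {0,1,2} \<Longrightarrow> coord i (smul A c x) = c * coord i x"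
proof -
  obtain x0 x1 x2 y0 y1 y2 where
    "x = comb A g x0 x1 x2" "y = comb A g y0 y1 y2"
    using comb_surj by metis
  then show "i \<in> {0,1,2} \<Longrightarrow> coord i (x + y) = coord i x + coord i y"
    and "i \<in> {0,1,2} \<Longrightarrow> coord i (smul A c x) = c * coord i x"
    using coord_comb by (auto simp: comb_add comb_scale)
qed

lemma polyfun_coord: "i \<in> {0,1,2} \<Longrightarrow> polyfun (smul A) (coord i)"
  by (rule polyfun.linear, unfold_locales) (auto simp: coord_add coord_scale algebra_simps)

text \<open>The polynomial \<open>f\<close> is the determinant of the coordinates of 1, x, x^2.
  Where it is nonzero these three elements span, and every subalgebra containing 1 and x contains
  them; at \<open>g\<close> its value is 1.\<close>

lemma has_rank: "has_rank A 3"
proof -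
  define q where "q i x = coord i (mul A x x)" for i x
  have sq: "mul A (comb A g u v w) (comb A g u v w) =
     comb A g (u * u + 2 * v * w * N + w * w * T * N)
       (2 * u * v - 2 * v * w * S + w * w * (N - T * S))
       (2 * u * w + v * v + 2 * v * w * T + w * w * (T * T - S))" for u v w
    by (simp add: mul_comb mul_g_comb comb_scale comb_add comb_inject) (intro conjI; algebra)
  have q1: "q 1 x = 2 * coord 0 x * coord 1 x - 2 * coord 1 x * coord 2 x * S
     + coord 2 x * coord 2 x * (N - T * S)"
    and q2: "q 2 x = 2 * coord 0 x * coord 2 x + coord 1 x * coord 1 x + 2 * coord 1 x * coord 2 x * T
     + coord 2 x * coord 2 x * (T * T - S)" for x
    using sq[of "coord 0 x" "coord 1 x" "coord 2 x"] coord_comb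
    unfolding comb_coord q_def by metis+
  define f where "f x = coord 1 x * q 2 x - coord 2 x * q 1 x" for x
  have "polyfun (smul A) f"
    unfolding f_def q1 q2
    by (intro polyfun_intros polyfun_coord) auto
  moreover have "f g \<noteq> 0"
    using coord_comb[of 0 1 0] unfolding g_comb[symmetric] f_def q1 q2 by simp
  moreover have "dim (subalgebra A hull {unity A, x}) = 3" if "f x \<noteq> 0" for x
  proof -
    let ?H = "subalgebra A hull {unity A, x}"
    have "z \<in> U" if U: "subalgebra A U" "{unity A, x} \<subseteq> U" for z U
    proof -
      from U have sub: "subspace U" and mem: "unity A \<in> U" "x \<in> U" "mul A x x \<in> U"
        by (auto simp: subalgebra_def)
      \<comment> \<open>Cramer's rule for the coordinates 1 and 2 of \<open>z\<close> in terms of x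
        and x^2; \<open>c\<close> then corrects the coordinate along the unity.\<close>
      define a b where "a = (coord 1 z * q 2 x - coord 2 z * q 1 x) / f x"
        and "b = (coord 1 x * coord 2 z - coord 2 x * coord 1 z) / f x"
      define c where "c = coord 0 z - a * coord 0 x - b * q 0 x"
      have "a * f x = coord 1 z * q 2 x - coord 2 z * q 1 x"
        "b * f x = coord 1 x * coord 2 z - coord 2 x * coord 1 z"
        using \<open>f x \<noteq> 0\<close> by (simp_all add: a_def b_def)
      then have "f x * (a * coord 1 x + b * q 1 x) = f x * coord 1 z"
        "f x * (a * coord 2 x + b * q 2 x) = f x * coord 2 z"
        unfolding f_def by algebra+
      then have ab: "a * coord 1 x + b * q 1 x = coord 1 z" "a * coord 2 x + b * q 2 x = coord 2 z"
        using \<open>f x \<noteq> 0\<close> by simp_all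
      have "smul A c (unity A) + smul A a x + smul A b (mul A x x) =
        smul A c (comb A g 1 0 0) + smul A a (comb A g (coord 0 x) (coord 1 x) (coord 2 x))
          + smul A b (comb A g (q 0 x) (q 1 x) (q 2 x))"
        unfolding comb_coord q_def unity_comb[symmetric] ..
      also have "\<dots> = comb A g (coord 0 z) (coord 1 z) (coord 2 z)"
        using ab by (simp add: comb_scale comb_add comb_inject c_def)
      finally have "z = smul A c (unity A) + smul A a x + smul A b (mul A x x)"
        by (simp only: comb_coord)
      then show ?thesis
        using sub mem by (auto intro: subspace_add subspace_scale)
    qed
    then have "?H = UNIV"
      unfolding hull_def by blast
    then show ?thesis
      using alg_dim by (simp add: alg_dim_def)
  qed
  ultimately show ?thesis
    unfolding has_rank_def general_def by blast
qed

end

text \<open>In the bases 1, g, g^2 and 1, h, h^2 the structure constants are the same expressions in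
  \<open>T\<close>, \<open>S\<close>, \<open>N\<close>.\<close>

lemma isomorphic_cubic:
  assumes "cubic_algebra A g T S N" "cubic_algebra B h T S N"
  shows "isomorphic A B"
proof -
  interpret A: cubic_algebra A g T S N by fact
  interpret B: cubic_algebra B h T S N by fact
  define \<phi> where "\<phi> z = comb B h (A.coord 0 z) (A.coord 1 z) (A.coord 2 z)" for z
  have \<phi>: "\<phi> (comb A g u v w) = comb B h u v w" for u v w
    unfolding \<phi>_def A.coord_comb ..
  have "Vector_Spaces.linear (smul A) (smul B) \<phi>"
    by unfold_locales
      (simp_all add: \<phi>_def A.coord_add A.coord_scale B.comb_add B.comb_scale)
  moreover have "bij \<phi>"
  proof (rule bijI)
    show "inj \<phi>"
    proof (rule injI)
      fix x y assume "\<phi> x = \<phi> y"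
      then have "A.coord 0 x = A.coord 0 y" "A.coord 1 x = A.coord 1 y" "A.coord 2 x = A.coord 2 y"
        by (simp_all add: \<phi>_def B.comb_inject)
      then show "x = y"
        using A.comb_coord by metis
    qed
    show "surj \<phi>"
      using B.comb_surj \<phi> by (metis surjI surj_def)
  qed
  moreover have "\<phi> (unity A) = unity B"
    unfolding A.unity_comb B.unity_comb \<phi> ..
  moreover have "\<phi> (mul A x y) = mul B (\<phi> x) (\<phi> y)" for x y
  proof -
    obtain x0 x1 x2 y0 y1 y2 where
      "x = comb A g x0 x1 x2" "y = comb A g y0 y1 y2"
      using A.comb_surj by metis
    then show ?thesis
      by (simp add: A.mul_comb A.mul_g_comb A.comb_scale A.comb_add \<phi>
         B.mul_comb B.mul_g_comb B.comb_scale B.comb_add)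
  qed
  ultimately show ?thesis
    unfolding isomorphic_def by blast
qed

text \<open>If x^2 were a combination of 1 and x, their span would be a subalgebra of dimension at
  most 2, against the rank. Hence 1, x, x^2 are independent, span for reasons of dimension, and the
  coordinates of x^3 give \<open>T\<close>, \<open>S\<close>, \<open>N\<close>.\<close>

lemma cubic_algebra_if_rank_3:
  assumes "jordan_algebra A" "has_rank A 3" "alg_dim A = 3"
  obtains g T S N where "cubic_algebra A g T S N"
proof -
  interpret jordan_algebra A by fact
  obtain Basis where "independent Basis" "span Basis = UNIV" "finite Basis"
    using finite_dimensional maximal_independent_subset[of UNIV] basis_exists[of UNIV]
      finiteI_independent independent_span_bound
    by (metis UNIV_I subsetI top.extremum_uniqueI)
  then interpret F: finite_dimensional_vector_space "smul A" Basis
    by unfold_locales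
  obtain x where x: "dim (subalgebra A hull {unity A, x}) = 3"
    using assms(2) unfolding has_rank_def general_def by blast
  let ?e = "unity A" and ?x2 = "mul A x x"
  have mul_add_right: "mul A z (x + y) = mul A z x + mul A z y" for x y z
    using mul_add_left mul_commute by metis
  have mul_smul_right: "mul A y (smul A c x) = smul A c (mul A y x)" for x y c
    using mul_smul_left mul_commute by metis
  have mul_unity_right: "mul A y ?e = y" for y
    using mul_unity mul_commute by metis
  have mem2: "\<exists>a b. z = smul A a ?e + smul A b x" if "z \<in> span {?e, x}" for z
  proof -
    obtain a b where "z - smul A a ?e = smul A b x"
      using \<open>z \<in> span {?e, x}\<close> unfolding span_insert[of ?e] span_singleton by blast
    then show ?thesis
      by (metis add.commute diff_add_cancel)
  qed
  have x2: "?x2 \<notin> span {?e, x}"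
  proof
    assume x2: "?x2 \<in> span {?e, x}"
    have "mul A y z \<in> span {?e, x}" if "y \<in> span {?e, x}" "z \<in> span {?e, x}" for y z
    proof -
      obtain a b c d where yz: "y = smul A a ?e + smul A b x" "z = smul A c ?e + smul A d x"
        using mem2 \<open>y \<in> _\<close> \<open>z \<in> _\<close> by metis
      show ?thesis
        unfolding yz mul_add_left mul_add_right mul_smul_left mul_smul_right mul_unity mul_unity_right
        by (intro span_add span_scale x2 span_base) auto
    qed
    then have "subalgebra A (span {?e, x})"
      by (simp add: subalgebra_def)
    then have "subalgebra A hull {?e, x} \<subseteq> span {?e, x}"
      by (intro hull_minimal) (auto intro: span_base)
    then have "dim (subalgebra A hull {?e, x}) \<le> card {?e, x}"
      by (intro dim_le_card) auto
    also have "\<dots> \<le> 2"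
      by (simp add: card_insert_if)
    finally show False
      using x by simp
  qed
  have e: "?e \<noteq> 0"
  proof
    assume "?e = 0"
    then have "?x2 = 0"
      by (metis mul_smul_left mul_unity scale_zero_left)
    with x2 show False
      by (simp add: span_zero)
  qed
  have x1: "x \<notin> span {?e}"
  proof
    assume "x \<in> span {?e}"
    then obtain k where "x = smul A k ?e"
      by (auto simp: span_singleton)
    then have "?x2 = smul A k x"
      by (metis mul_smul_left mul_unity)
    with x2 show False
      by (metis insertCI span_base span_scale)
  qed
  have ne: "?x2 \<noteq> ?e" "?x2 \<noteq> x" "x \<noteq> ?e"
    using x2 x1 by (auto intro: span_base)
  have "?x2 \<notin> span {x, ?e}"
    using x2 by (simp add: insert_commute)
  then have "independent {?x2, x, ?e}"
    using x1 e ne by (simp add: independent_insert)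
  moreover have "card {?x2, x, ?e} = dim UNIV"
    using ne assms(3) by (simp add: alg_dim_def)
  ultimately have span: "span {?x2, x, ?e} = UNIV"
    using F.card_eq_dim[of "{?x2, x, ?e}" UNIV] by auto
  have surj: "\<exists>u v w. z = comb A x u v w" for z
  proof -
    have "z \<in> span {?x2, ?e, x}"
      using span by (simp add: insert_commute)
    then obtain w where "z - smul A w ?x2 \<in> span {?e, x}"
      unfolding span_insert[of ?x2] by blast
    then obtain u v where "z - smul A w ?x2 = smul A u ?e + smul A v x"
      using mem2 by blast
    then have "z = comb A x u v w"
      by (simp add: comb_def algebra_simps)
    then show ?thesis by blast
  qed
  have inj: "u = 0 \<and> v = 0 \<and> w = 0" if "comb A x u v w = 0" for u v w
  proof -
    have "w = 0"
    proof (rule ccontr)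
      assume "w \<noteq> 0"
      have "smul A w ?x2 = smul A (- u) ?e + smul A (- v) x"
        using that by (simp add: comb_def algebra_simps eq_neg_iff_add_eq_0)
      also have "\<dots> \<in> span {?e, x}"
        by (intro span_add span_scale span_base) auto
      finally have "smul A (inverse w) (smul A w ?x2) \<in> span {?e, x}"
        by (rule span_scale)
      with x2 \<open>w \<noteq> 0\<close> show False by simp
    qed
    moreover have "v = 0"
    proof (rule ccontr)
      assume "v \<noteq> 0"
      have "smul A v x = smul A (- u) ?e"
        using that \<open>w = 0\<close> by (simp add: comb_def algebra_simps eq_neg_iff_add_eq_0)
      also have "\<dots> \<in> span {?e}"
        by (intro span_scale span_base) auto
      finally have "smul A (inverse v) (smul A v x) \<in> span {?e}"
        by (rule span_scale)
      with x1 \<open>v \<noteq> 0\<close> show False by simp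
    qed
    ultimately show ?thesis
      using that e by (simp add: comb_def)
  qed
  obtain t s n where cub: "mul A x ?x2 = comb A x n s t"
    using surj by metis
  have "cubic_algebra A x t (- s) n"
  proof
    show "mul A x ?x2 = comb A x n (- (- s)) t"
      using cub by simp
    show "mul A ?x2 ?x2 = mul A x (mul A x ?x2)"
      using jordan_identity[of x x] mul_commute by metis
  qed (fact mul_add_left mul_smul_left mul_commute mul_unity surj inj)+
  then show ?thesis by (rule that)
qed

lemma cubic_roots:
  fixes T S N :: complex
  obtains \<alpha> \<beta> \<gamma> where "T = \<alpha> + \<beta> + \<gamma>" "S = \<alpha> * \<beta> + \<alpha> * \<gamma> + \<beta> * \<gamma>" "N = \<alpha> * \<beta> * \<gamma>"
proof -
  have "\<not> constant (poly [:- N, S, - T, 1:])"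
    by (simp add: constant_degree)
  then obtain \<alpha> where \<alpha>: "poly [:- N, S, - T, 1:] \<alpha> = 0"
    using fundamental_theorem_of_algebra by blast
  \<comment> \<open>The quotient of the cubic by t - \<alpha>; the third root will be T - \<alpha> -
    \<beta>.\<close>
  have "\<not> constant (poly [:S - \<alpha> * (T - \<alpha>), \<alpha> - T, 1:])"
    by (simp add: constant_degree)
  then obtain \<beta> where \<beta>: "poly [:S - \<alpha> * (T - \<alpha>), \<alpha> - T, 1:] \<beta> = 0"
    using fundamental_theorem_of_algebra by blast
  have S: "S = \<alpha> * \<beta> + \<alpha> * (T - \<alpha> - \<beta>) + \<beta> * (T - \<alpha> - \<beta>)"
    using \<beta> by simp algebra
  moreover have "N = \<alpha> * (S + \<alpha> * (\<alpha> - T))"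
    using \<alpha> by simp
  then have "N = \<alpha> * \<beta> * (T - \<alpha> - \<beta>)"
    unfolding S by algebra
  ultimately show ?thesis
    by (intro that[of \<alpha> \<beta> "T - \<alpha> - \<beta>"]) simp_all
qed

section \<open>The three algebras\<close>

lemma pCons_0_1_power_dvd_iff: "[:0, 1:] ^ n dvd p \<longleftrightarrow> (\<forall>k<n. coeff p k = 0)"
  for p :: "'a::field poly"
  using monom_1_dvd_iff'[of n p] by (simp add: monom_altdef)

text \<open>The cutoff at \<open>CARD('n)\<close> makes the entire coefficient function independent
  of the representative.\<close>

lift_definition trunc_coeff :: "'n::finite trunc \<Rightarrow> nat \<Rightarrow> complex"
  is "\<lambda>p i. if i < CARD('n) then coeff p i else 0"
proof -
  fix p q :: "complex poly"
  assume "[:0, 1:] ^ CARD('n) dvd p - q"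
  then have "\<forall>i<CARD('n). coeff (p - q) i = 0"
    by (simp only: pCons_0_1_power_dvd_iff)
  then show "(\<lambda>i. if i < CARD('n) then coeff p i else 0) = (\<lambda>i. if i < CARD('n) then coeff q i else 0)"
    by auto
qed

lemma trunc_eq_iff:
  fixes x y :: "'n::finite trunc"
  shows "x = y \<longleftrightarrow> (\<forall>i<CARD('n). trunc_coeff x i = trunc_coeff y i)"
  by transfer (simp add: pCons_0_1_power_dvd_iff)

lemma trunc_coeff_simps:
  fixes x y :: "'n::finite trunc"
  assumes "i < CARD('n)"
  shows "trunc_coeff (x + y) i = trunc_coeff x i + trunc_coeff y i"
    and "trunc_coeff (x - y) i = trunc_coeff x i - trunc_coeff y i"
    and "trunc_coeff (0 :: 'n trunc) i = 0"
    and "trunc_coeff (trunc_one :: 'n trunc) i = (if i = 0 then 1 else 0)"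
    and "trunc_coeff (trunc_smul c x) i = c * trunc_coeff x i"
    and "trunc_coeff (abs_trunc p :: 'n trunc) i = coeff p i"
    and "trunc_coeff (x * y) i = (\<Sum>k\<le>i. trunc_coeff x k * trunc_coeff y (i - k))"
proof -
  show "trunc_coeff (x + y) i = trunc_coeff x i + trunc_coeff y i"
    using assms by transfer simp
  show "trunc_coeff (x - y) i = trunc_coeff x i - trunc_coeff y i"
    using assms by transfer simp
  show "trunc_coeff (0 :: 'n trunc) i = 0"
    using assms by transfer simp
  show "trunc_coeff (trunc_one :: 'n trunc) i = (if i = 0 then 1 else 0)"
    using assms by transfer simp
  show "trunc_coeff (trunc_smul c x) i = c * trunc_coeff x i"
    using assms by transfer simp
  show "trunc_coeff (abs_trunc p :: 'n trunc) i = coeff p i"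
    using assms by (simp add: trunc_coeff.abs_eq)
  have "\<exists>p. z = abs_trunc p" for z :: "'n trunc"
    by (induction z rule: trunc.abs_induct) blast
  then obtain p q where "x = abs_trunc p" "y = abs_trunc q"
    by blast
  then show "trunc_coeff (x * y) i = (\<Sum>k\<le>i. trunc_coeff x k * trunc_coeff y (i - k))"
    using assms by (auto simp: times_trunc.abs_eq trunc_coeff.abs_eq coeff_mult intro!: sum.cong)
qed

lemma trunc2_eq_iff:
  fixes x y :: "2 trunc"
  shows "x = y \<longleftrightarrow> trunc_coeff x 0 = trunc_coeff y 0 \<and> trunc_coeff x 1 = trunc_coeff y 1"
  by (auto simp: trunc_eq_iff numeral_2_eq_2 All_less_Suc)

lemma trunc3_eq_iff:
  fixes x y :: "3 trunc"
  shows "x = y \<longleftrightarrow> trunc_coeff x 0 = trunc_coeff y 0 \<and> trunc_coeff x 1 = trunc_coeff y 1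
    \<and> trunc_coeff x 2 = trunc_coeff y 2"
  by (auto simp: trunc_eq_iff numeral_3_eq_3 All_less_Suc numeral_2_eq_2)

lemma trunc2_times:
  fixes x y :: "2 trunc"
  shows "trunc_coeff (x * y) 0 = trunc_coeff x 0 * trunc_coeff y 0"
    and "trunc_coeff (x * y) 1 = trunc_coeff x 0 * trunc_coeff y 1 + trunc_coeff x 1 * trunc_coeff y 0"
  by (simp_all add: trunc_coeff_simps)

lemma trunc3_times:
  fixes x y :: "3 trunc"
  shows "trunc_coeff (x * y) 0 = trunc_coeff x 0 * trunc_coeff y 0"
    and "trunc_coeff (x * y) 1 = trunc_coeff x 0 * trunc_coeff y 1 + trunc_coeff x 1 * trunc_coeff y 0"
    and "trunc_coeff (x * y) 2 = trunc_coeff x 0 * trunc_coeff y 2 + trunc_coeff x 1 * trunc_coeff y 1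
      + trunc_coeff x 2 * trunc_coeff y 0"
  by (simp_all add: trunc_coeff_simps numeral_2_eq_2)

definition trunc2 :: "complex \<Rightarrow> complex \<Rightarrow> 2 trunc" where
  "trunc2 a b = abs_trunc [:a, b:]"

definition trunc3 :: "complex \<Rightarrow> complex \<Rightarrow> complex \<Rightarrow> 3 trunc" where
  "trunc3 a b c = abs_trunc [:a, b, c:]"

lemma trunc_coeff_trunc2: "trunc_coeff (trunc2 a b) 0 = a" "trunc_coeff (trunc2 a b) 1 = b"
  by (simp_all add: trunc2_def trunc_coeff_simps)

lemma trunc_coeff_trunc3: "trunc_coeff (trunc3 a b c) 0 = a" "trunc_coeff (trunc3 a b c) 1 = b"
  "trunc_coeff (trunc3 a b c) 2 = c"
  by (simp_all add: trunc3_def trunc_coeff_simps coeff_pCons numeral_2_eq_2)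

lemma trunc2_surj: "trunc2 (trunc_coeff x 0) (trunc_coeff x 1) = x"
  by (simp only: trunc2_eq_iff trunc_coeff_trunc2)

lemma trunc3_surj: "trunc3 (trunc_coeff x 0) (trunc_coeff x 1) (trunc_coeff x 2) = x"
  by (simp only: trunc3_eq_iff trunc_coeff_trunc3)

lemma trunc2_ops:
  "trunc2 a b + trunc2 a' b' = trunc2 (a + a') (b + b')"
  "trunc2 a b - trunc2 a' b' = trunc2 (a - a') (b - b')"
  "trunc2 a b * trunc2 a' b' = trunc2 (a * a') (a * b' + b * a')"
  "trunc_smul c (trunc2 a b) = trunc2 (c * a) (c * b)"
  "trunc_one = trunc2 1 0" "0 = trunc2 0 0"
  "trunc2 a b = trunc2 a' b' \<longleftrightarrow> a = a' \<and> b = b'"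
  by (simp_all only: trunc2_eq_iff trunc_coeff_trunc2 trunc2_times)
    (simp_all add: trunc_coeff_simps trunc_coeff_trunc2 del: One_nat_def)

lemma trunc3_ops:
  "trunc3 a b c + trunc3 a' b' c' = trunc3 (a + a') (b + b') (c + c')"
  "trunc3 a b c - trunc3 a' b' c' = trunc3 (a - a') (b - b') (c - c')"
  "trunc3 a b c * trunc3 a' b' c' = trunc3 (a * a') (a * b' + b * a') (a * c' + b * b' + c * a')"
  "trunc_smul k (trunc3 a b c) = trunc3 (k * a) (k * b) (k * c)"
  "trunc_one = trunc3 1 0 0" "0 = trunc3 0 0 0"
  "trunc3 a b c = trunc3 a' b' c' \<longleftrightarrow> a = a' \<and> b = b' \<and> c = c'"
  by (simp_all only: trunc3_eq_iff trunc_coeff_trunc3 trunc3_times)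
    (simp_all add: trunc_coeff_simps trunc_coeff_trunc3 del: One_nat_def)

lemma ex_trunc2: "\<exists>a b. x = trunc2 a b"
  using trunc2_surj by metis

lemma ex_trunc3: "\<exists>a b c. x = trunc3 a b c"
  using trunc3_surj by metis

lemmas alg_CCC_simps = alg_CCC_def alg_prod_def alg_C_def
lemmas alg_C_eps2_simps = alg_C_eps2_def alg_prod_def alg_C_def alg_trunc_def
lemmas alg_eps3_simps = alg_eps3_def alg_trunc_def

lemma vector_space_algs:
  "vector_space (smul alg_CCC)" "vector_space (smul alg_C_eps2)" "vector_space (smul alg_eps3)"
proof -
  show "vector_space (smul alg_CCC)"
    by unfold_locales (auto simp: alg_CCC_simps algebra_simps)
  show "vector_space (smul alg_C_eps2)"
    by unfold_locales (auto simp: alg_C_eps2_simps trunc2_eq_iff trunc_coeff_simps algebra_simps)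
  show "vector_space (smul alg_eps3)"
    by unfold_locales (auto simp: alg_eps3_simps trunc3_eq_iff trunc_coeff_simps algebra_simps)
qed

text \<open>The witnesses of \<open>comb_surj\<close> are the coefficients of the Newton interpolation polynomial.\<close>

lemma cubic_algebra_CCC:
  assumes "\<alpha> \<noteq> \<beta>" "\<alpha> \<noteq> \<gamma>" "\<beta> \<noteq> \<gamma>"
  shows "cubic_algebra alg_CCC (\<alpha>, \<beta>, \<gamma>) (\<alpha> + \<beta> + \<gamma>) (\<alpha> * \<beta> + \<alpha> * \<gamma> + \<beta> * \<gamma>) (\<alpha> * \<beta> * \<gamma>)"
proof -
  interpret vector_space "smul alg_CCC" by (rule vector_space_algs)
  have comb: "comb alg_CCC (\<alpha>, \<beta>, \<gamma>) u v w =
    (u + v * \<alpha> + w * \<alpha>\<^sup>2, u + v * \<beta> + w * \<beta>\<^sup>2, u + v * \<gamma> + w * \<gamma>\<^sup>2)" for u v w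
    by (simp add: comb_def alg_CCC_simps power2_eq_square)
  show ?thesis
  proof
    fix z :: "complex \<times> complex \<times> complex"
    obtain z1 z2 z3 where z: "z = (z1, z2, z3)"
      by (metis prod.exhaust)
    define d where "d = (z2 - z1) / (\<beta> - \<alpha>)"
    define e where "e = (z3 - z1 - d * (\<gamma> - \<alpha>)) / ((\<gamma> - \<alpha>) * (\<gamma> - \<beta>))"
    have z2: "z2 = z1 + d * (\<beta> - \<alpha>)"
      using assms by (simp add: d_def)
    have z3: "z3 = z1 + d * (\<gamma> - \<alpha>) + e * ((\<gamma> - \<alpha>) * (\<gamma> - \<beta>))"
      using assms by (simp add: e_def)
    have "z = comb alg_CCC (\<alpha>, \<beta>, \<gamma>) (z1 - d * \<alpha> + e * \<alpha> * \<beta>) (d - e * (\<alpha> + \<beta>)) e"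
      unfolding z comb prod.inject z2 z3 by (simp add: algebra_simps power2_eq_square)
    then show "\<exists>u v w. z = comb alg_CCC (\<alpha>, \<beta>, \<gamma>) u v w"
      by blast
  next
    fix u v w
    assume "comb alg_CCC (\<alpha>, \<beta>, \<gamma>) u v w = 0"
    then have eqs: "u + v * \<alpha> + w * \<alpha>\<^sup>2 = 0" "u + v * \<beta> + w * \<beta>\<^sup>2 = 0" "u + v * \<gamma> + w * \<gamma>\<^sup>2 = 0"
      by (simp_all add: comb zero_prod_def)
    then have "(\<alpha> - \<beta>) * (v + w * (\<alpha> + \<beta>)) = 0" "(\<alpha> - \<gamma>) * (v + w * (\<alpha> + \<gamma>)) = 0"
      by algebra+
    then have vw: "v + w * (\<alpha> + \<beta>) = 0" "v + w * (\<alpha> + \<gamma>) = 0"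
      using assms by simp_all
    then have "w * (\<beta> - \<gamma>) = 0"
      by algebra
    then have "w = 0"
      using assms by simp
    with vw eqs show "u = 0 \<and> v = 0 \<and> w = 0"
      by simp
  next
    show "mul alg_CCC (\<alpha>, \<beta>, \<gamma>) (mul alg_CCC (\<alpha>, \<beta>, \<gamma>) (\<alpha>, \<beta>, \<gamma>)) =
      comb alg_CCC (\<alpha>, \<beta>, \<gamma>) (\<alpha> * \<beta> * \<gamma>) (- (\<alpha> * \<beta> + \<alpha> * \<gamma> + \<beta> * \<gamma>)) (\<alpha> + \<beta> + \<gamma>)"
      unfolding comb by (simp add: alg_CCC_simps) (intro conjI; algebra)
  qed (auto simp: alg_CCC_simps algebra_simps)
qed

lemma cubic_algebra_C_eps2:
  assumes "\<alpha> \<noteq> \<beta>"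
  shows "cubic_algebra alg_C_eps2 (\<alpha>, trunc2 \<beta> 1) (\<alpha> + \<beta> + \<beta>) (\<alpha> * \<beta> + \<alpha> * \<beta> + \<beta> * \<beta>) (\<alpha> * \<beta> * \<beta>)"
proof -
  interpret vector_space "smul alg_C_eps2" by (rule vector_space_algs)
  let ?g = "(\<alpha>, trunc2 \<beta> 1)"
  \<comment> \<open>For p = u + v t + w t^2 the components are p(\<alpha>), p(\<beta>) and
    p'(\<beta>), so surjectivity is Hermite interpolation with a simple and a double node.\<close>
  have comb: "comb alg_C_eps2 ?g u v w =
    (u + v * \<alpha> + w * \<alpha>\<^sup>2, trunc2 (u + v * \<beta> + w * \<beta>\<^sup>2) (v + 2 * w * \<beta>))" for u v w
    by (simp add: comb_def alg_C_eps2_simps power2_eq_square trunc2_ops)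
  show ?thesis
  proof
    fix z :: "complex \<times> 2 trunc"
    obtain z1 z2 z3 where z: "z = (z1, trunc2 z2 z3)"
      using ex_trunc2 by (metis prod.exhaust)
    define d where "d = (z1 - z2 - z3 * (\<alpha> - \<beta>)) / (\<alpha> - \<beta>)\<^sup>2"
    have z1: "z1 = z2 + z3 * (\<alpha> - \<beta>) + d * (\<alpha> - \<beta>)\<^sup>2"
      using assms by (simp add: d_def)
    have "z = comb alg_C_eps2 ?g (z2 - z3 * \<beta> + d * \<beta>\<^sup>2) (z3 - 2 * d * \<beta>) d"
      unfolding z comb prod.inject trunc2_ops z1 by (simp add: algebra_simps power2_eq_square)
    then show "\<exists>u v w. z = comb alg_C_eps2 ?g u v w"
      by blast
  next
    fix u v w
    assume "comb alg_C_eps2 ?g u v w = 0"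
    then have eqs: "u + v * \<alpha> + w * \<alpha>\<^sup>2 = 0" "u + v * \<beta> + w * \<beta>\<^sup>2 = 0" "v + 2 * w * \<beta> = 0"
      by (simp_all add: comb zero_prod_def trunc2_ops)
    then have "w * (\<alpha> - \<beta>)\<^sup>2 = 0"
      by algebra
    then have "w = 0"
      using assms by simp
    with eqs show "u = 0 \<and> v = 0 \<and> w = 0"
      by simp
  next
    show "mul alg_C_eps2 ?g (mul alg_C_eps2 ?g ?g) =
      comb alg_C_eps2 ?g (\<alpha> * \<beta> * \<beta>) (- (\<alpha> * \<beta> + \<alpha> * \<beta> + \<beta> * \<beta>)) (\<alpha> + \<beta> + \<beta>)"
      unfolding comb by (simp add: alg_C_eps2_simps trunc2_ops) (intro conjI; algebra)
  next
    fix x y z :: "complex \<times> 2 trunc"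
    show "mul alg_C_eps2 (smul alg_C_eps2 c x) y = smul alg_C_eps2 c (mul alg_C_eps2 x y)" for c
      using ex_trunc2[of "snd x"] ex_trunc2[of "snd y"]
      by (auto simp: alg_C_eps2_simps trunc2_ops algebra_simps)
    show "mul alg_C_eps2 (unity alg_C_eps2) x = x"
      using ex_trunc2[of "snd x"]
      by (cases x) (auto simp: alg_C_eps2_simps trunc2_ops)
  qed (auto simp: alg_C_eps2_simps algebra_simps)
qed

lemma cubic_algebra_eps3:
  "cubic_algebra alg_eps3 (trunc3 \<alpha> 1 0) (\<alpha> + \<alpha> + \<alpha>) (\<alpha> * \<alpha> + \<alpha> * \<alpha> + \<alpha> * \<alpha>) (\<alpha> * \<alpha> * \<alpha>)"
proof -
  interpret vector_space "smul alg_eps3" by (rule vector_space_algs)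
  let ?g = "trunc3 \<alpha> 1 0"
  \<comment> \<open>The coefficients are those of the Taylor expansion of p = u + v t + w t^2 at the
    triple node \<alpha>.\<close>
  have comb: "comb alg_eps3 ?g u v w = trunc3 (u + v * \<alpha> + w * \<alpha>\<^sup>2) (v + 2 * w * \<alpha>) w" for u v w
    by (simp add: comb_def alg_eps3_simps power2_eq_square trunc3_ops)
  show ?thesis
  proof
    fix z :: "3 trunc"
    obtain z1 z2 z3 where z: "z = trunc3 z1 z2 z3"
      using ex_trunc3 by metis
    have "z = comb alg_eps3 ?g (z1 - z2 * \<alpha> + z3 * \<alpha>\<^sup>2) (z2 - 2 * z3 * \<alpha>) z3"
      unfolding z comb trunc3_ops by (simp add: algebra_simps power2_eq_square)
    then show "\<exists>u v w. z = comb alg_eps3 ?g u v w"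
      by blast
  next
    fix u v w
    assume "comb alg_eps3 ?g u v w = 0"
    then show "u = 0 \<and> v = 0 \<and> w = 0"
      by (auto simp add: comb trunc3_ops)
  next
    show "mul alg_eps3 ?g (mul alg_eps3 ?g ?g) =
      comb alg_eps3 ?g (\<alpha> * \<alpha> * \<alpha>) (- (\<alpha> * \<alpha> + \<alpha> * \<alpha> + \<alpha> * \<alpha>)) (\<alpha> + \<alpha> + \<alpha>)"
      unfolding comb by (simp add: alg_eps3_simps trunc3_ops power2_eq_square)
  next
    fix x y z :: "3 trunc"
    show "mul alg_eps3 (smul alg_eps3 c x) y = smul alg_eps3 c (mul alg_eps3 x y)" for c
      using ex_trunc3[of x] ex_trunc3[of y]
      by (auto simp: alg_eps3_simps trunc3_ops algebra_simps)
    show "mul alg_eps3 (unity alg_eps3) x = x"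
      using ex_trunc3[of x]
      by (auto simp: alg_eps3_simps trunc3_ops)
  qed (auto simp: alg_eps3_simps algebra_simps)
qed

section \<open>Classification and isomorphism invariants\<close>

lemma isomorphic_if_rank_3:
  assumes "jordan_algebra A" "has_rank A 3" "alg_dim A = 3"
  shows "isomorphic A alg_CCC \<or> isomorphic A alg_C_eps2 \<or> isomorphic A alg_eps3"
proof -
  obtain g T S N where A: "cubic_algebra A g T S N"
    using cubic_algebra_if_rank_3[OF assms] .
  obtain \<alpha> \<beta> \<gamma> where roots: "T = \<alpha> + \<beta> + \<gamma>" "S = \<alpha> * \<beta> + \<alpha> * \<gamma> + \<beta> * \<gamma>" "N = \<alpha> * \<beta> * \<gamma>"
    using cubic_roots .
  have eps2: "isomorphic A alg_C_eps2"
    if "a \<noteq> b" "T = a + b + b" "S = a * b + a * b + b * b" "N = a * b * b" for a b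
    using isomorphic_cubic[OF A] cubic_algebra_C_eps2[OF that(1)] that(2-4) by simp
  consider "\<alpha> \<noteq> \<beta>" "\<alpha> \<noteq> \<gamma>" "\<beta> \<noteq> \<gamma>" | "\<alpha> \<noteq> \<beta>" "\<beta> = \<gamma>" | "\<alpha> \<noteq> \<beta>" "\<alpha> = \<gamma>"
    | "\<alpha> \<noteq> \<gamma>" "\<alpha> = \<beta>" | "\<alpha> = \<beta>" "\<beta> = \<gamma>"
    by blast
  then show ?thesis
  proof cases
    case 1
    then show ?thesis
      using isomorphic_cubic[OF A[unfolded roots] cubic_algebra_CCC] by blast
  next
    case 2
    then show ?thesis
      using eps2[of \<alpha> \<beta>] roots by simp
  next
    case 3
    then show ?thesis
      using eps2[of \<beta> \<alpha>] roots by (simp add: mult.commute add.commute add.left_commute)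
  next
    case 4
    then show ?thesis
      using eps2[of \<gamma> \<alpha>] roots by (simp add: mult.commute add.commute add.left_commute)
  next
    case 5
    then have "cubic_algebra alg_eps3 (trunc3 \<gamma> 1 0) T S N"
      using cubic_algebra_eps3[of \<gamma>] roots by simp
    then show ?thesis
      using isomorphic_cubic[OF A] by blast
  qed
qed

lemma algs_properties:
  "jordan_algebra alg_CCC \<and> has_rank alg_CCC 3 \<and> alg_dim alg_CCC = 3 \<and> associative alg_CCC"
  "jordan_algebra alg_C_eps2 \<and> has_rank alg_C_eps2 3 \<and> alg_dim alg_C_eps2 = 3 \<and> associative alg_C_eps2"
  "jordan_algebra alg_eps3 \<and> has_rank alg_eps3 3 \<and> alg_dim alg_eps3 = 3 \<and> associative alg_eps3"
  \<comment> \<open>One generator per algebra is enough; the only condition on these roots is that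
    those with different names differ.\<close>
  using cubic_algebra_CCC[of 0 1 "-1"] cubic_algebra_C_eps2[of 0 1] cubic_algebra_eps3[of 0]
    cubic_algebra.jordan_algebra cubic_algebra.has_rank cubic_algebra.alg_dim cubic_algebra.associative
  by (simp, blast)+

text \<open>Elements of square zero tell the reduced algebra \<open>alg_CCC\<close> from the other
  two. \<open>isomorphic\<close> is directed, and the map is used to pull such an element back from
  \<open>B\<close> to \<open>A\<close>.\<close>

lemma isomorphic_nilpotent:
  assumes "isomorphic A B" "\<And>x. mul A x x = 0 \<Longrightarrow> x = 0" "mul B y y = 0"
  shows "y = 0"
proof -
  obtain \<phi> where lin: "Vector_Spaces.linear (smul A) (smul B) \<phi>" and bij: "bij \<phi>"
    and mul: "\<And>x y. \<phi> (mul A x y) = mul B (\<phi> x) (\<phi> y)"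
    using assms(1) unfolding isomorphic_def by blast
  interpret Vector_Spaces.linear "smul A" "smul B" \<phi> by (rule lin)
  obtain x where x: "y = \<phi> x"
    using bij by (metis bij_pointE)
  then have "\<phi> (mul A x x) = \<phi> 0"
    using mul assms(3) zero by simp
  then have "mul A x x = 0"
    using bij by (metis bij_def injD)
  then have "x = 0"
    by (rule assms(2))
  then show ?thesis
    using x zero by simp
qed

text \<open>Idempotents tell the decomposable \<open>alg_C_eps2\<close>, which contains (1,0), from
  the local algebra \<open>alg_eps3\<close>.\<close>

lemma isomorphic_idempotent:
  assumes "isomorphic A B" "\<And>y. mul B y y = y \<Longrightarrow> y = 0 \<or> y = unity B" "mul A x x = x"
  shows "x = 0 \<or> x = unity A"
proof -
  obtain \<phi> where lin: "Vector_Spaces.linear (smul A) (smul B) \<phi>" and bij: "bij \<phi>"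
    and unity: "\<phi> (unity A) = unity B" and mul: "\<And>x y. \<phi> (mul A x y) = mul B (\<phi> x) (\<phi> y)"
    using assms(1) unfolding isomorphic_def by blast
  interpret Vector_Spaces.linear "smul A" "smul B" \<phi> by (rule lin)
  have "\<phi> x = \<phi> 0 \<or> \<phi> x = \<phi> (unity A)"
    using assms(2)[of "\<phi> x"] assms(3) mul unity zero by metis
  then show ?thesis
    using bij by (metis bij_def injD)
qed

lemma CCC_nilpotent: "mul alg_CCC x x = 0 \<Longrightarrow> x = 0"
  by (cases x) (auto simp: alg_CCC_simps zero_prod_def)

lemma not_isomorphic_CCC_C_eps2: "\<not> isomorphic alg_CCC alg_C_eps2"
proof
  assume "isomorphic alg_CCC alg_C_eps2"
  then have "(0 :: complex, trunc2 0 1) = 0"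
    by (rule isomorphic_nilpotent[OF _ CCC_nilpotent])
      (auto simp: alg_C_eps2_simps zero_prod_def trunc2_ops)
  then show False
    by (simp add: zero_prod_def trunc2_ops)
qed

lemma not_isomorphic_CCC_eps3: "\<not> isomorphic alg_CCC alg_eps3"
proof
  assume "isomorphic alg_CCC alg_eps3"
  then have "trunc3 0 0 1 = 0"
    by (rule isomorphic_nilpotent[OF _ CCC_nilpotent])
      (auto simp: alg_eps3_simps trunc3_ops)
  then show False
    by (simp add: trunc3_ops)
qed

lemma not_isomorphic_C_eps2_eps3: "\<not> isomorphic alg_C_eps2 alg_eps3"
proof
  assume iso: "isomorphic alg_C_eps2 alg_eps3"
  have "y = 0 \<or> y = unity alg_eps3" if "mul alg_eps3 y y = y" for y
  proof -
    obtain a b c where y: "y = trunc3 a b c"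
      using ex_trunc3 by metis
    have eqs: "a * a = a" "a * b + b * a = b" "a * c + b * b + c * a = c"
      using that by (simp_all add: y alg_eps3_simps trunc3_ops)
    then consider "a = 0" | "a = 1"
      by auto
    then have "b = 0 \<and> c = 0"
      using eqs by cases auto
    with eqs show ?thesis
      by (auto simp: y alg_eps3_simps trunc3_ops)
  qed
  then have "(1 :: complex, trunc2 0 0) = 0 \<or> (1, trunc2 0 0) = unity alg_C_eps2"
    by (rule isomorphic_idempotent[OF iso]) (auto simp: alg_C_eps2_simps trunc2_ops)
  then show False
    by (simp add: zero_prod_def trunc2_ops alg_C_eps2_simps)
qed

section \<open>Adjoints\<close>

lemma map_1_nth: "map_1 v $ 1 = v $ 2 * v $ 3" "map_1 v $ 2 = v $ 1 * v $ 3" "map_1 v $ 3 = v $ 1 * v $ 2"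
  by (simp_all add: map_1_def Let_def vector_3)

lemma map_2_nth: "map_2 v $ 1 = (v $ 2)\<^sup>2" "map_2 v $ 2 = v $ 1 * v $ 2" "map_2 v $ 3 = - (v $ 1 * v $ 3)"
  by (simp_all add: map_2_def Let_def vector_3)

lemma map_3_nth: "map_3 v $ 1 = (v $ 1)\<^sup>2" "map_3 v $ 2 = - (v $ 1 * v $ 2)"
  "map_3 v $ 3 = (v $ 2)\<^sup>2 - v $ 1 * v $ 3"
  by (simp_all add: map_3_def Let_def vector_3)

lemmas map_components = map_1_nth map_2_nth map_3_nth

lemma vec3_eq_iff: "v = w \<longleftrightarrow> v $ 1 = w $ 1 \<and> v $ 2 = w $ 2 \<and> v $ 3 = w $ 3" for v w :: "'a^3"
  by (simp add: vec_eq_iff forall_3)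

lemma bij_if_coordinates:
  fixes \<phi> :: "'a^3 \<Rightarrow> 'b"
  assumes "\<And>v. p (\<phi> v) = v $ 1" "\<And>v. q (\<phi> v) = v $ 2" "\<And>v. r (\<phi> v) = v $ 3"
    and "\<And>x. \<exists>v. x = \<phi> v"
  shows "bij \<phi>"
proof (rule bijI)
  show "inj \<phi>"
    using assms(1-3) by (intro injI) (metis vec3_eq_iff)
  show "surj \<phi>"
    using assms(4) by (auto simp: surj_def)
qed

lemma adjoint_CCC: "adjoint_in_coordinates alg_CCC map_1"
proof -
  interpret vector_space "smul alg_CCC" by (rule vector_space_algs)
  define x y z :: "complex \<times> complex \<times> complex \<Rightarrow> complex"
    where "x = fst" and "y = fst \<circ> snd" and "z = snd \<circ> snd"
  note [simp] = x_def y_def z_def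
  have pf: "polyfun (smul alg_CCC) x" "polyfun (smul alg_CCC) y" "polyfun (smul alg_CCC) z"
    by (rule polyfun.linear, unfold_locales; simp add: alg_CCC_simps algebra_simps)+
  define T S N where "T a = x a + y a + z a" and "S a = x a * y a + x a * z a + y a * z a"
    and "N a = x a * y a * z a" for a
  define adj where "adj a = mul alg_CCC a a - smul alg_CCC (T a) a + smul alg_CCC (S a) (unity alg_CCC)" for a
  define \<phi> where "\<phi> v = (v $ 1, v $ 2, v $ 3)" for v :: "complex^3"
  have "polyfun (smul alg_CCC) T" "polyfun (smul alg_CCC) S" "polyfun (smul alg_CCC) N"
    unfolding T_def S_def N_def by (intro polyfun_intros pf)+
  moreover have "T (smul alg_CCC c a) = c ^ 1 * T a \<and> S (smul alg_CCC c a) = c\<^sup>2 * S a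
    \<and> N (smul alg_CCC c a) = c ^ 3 * N a" for c a
    by (simp add: T_def S_def N_def alg_CCC_simps algebra_simps power2_eq_square power3_eq_cube)
  moreover have "mul alg_CCC a (mul alg_CCC a a) - smul alg_CCC (T a) (mul alg_CCC a a)
    + smul alg_CCC (S a) a - smul alg_CCC (N a) (unity alg_CCC) = 0" for a
    by (simp add: T_def S_def N_def alg_CCC_simps algebra_simps zero_prod_def)
  ultimately have "generic_equation alg_CCC T S N"
    unfolding generic_equation_def form_def by blast
  then have "is_adjoint alg_CCC adj"
    unfolding is_adjoint_def adj_def by blast
  moreover have "Vector_Spaces.linear (*s) (smul alg_CCC) \<phi>"
    by unfold_locales (simp_all add: \<phi>_def alg_CCC_simps)
  moreover have "bij \<phi>"
  proof (rule bij_if_coordinates[where p = x and q = y and r = z])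
    show "\<exists>v. a = \<phi> v" for a
      by (rule exI[of _ "vector [x a, y a, z a]"]) (simp add: \<phi>_def vector_3)
  qed (auto simp: \<phi>_def)
  moreover have "\<phi> (map_1 v) = adj (\<phi> v)" for v
    by (simp add: \<phi>_def adj_def T_def S_def alg_CCC_simps map_components algebra_simps)
  ultimately show ?thesis
    unfolding adjoint_in_coordinates_def by blast
qed

lemma adjoint_C_eps2: "adjoint_in_coordinates alg_C_eps2 map_2"
proof -
  interpret vector_space "smul alg_C_eps2" by (rule vector_space_algs)
  define x y z :: "complex \<times> 2 trunc \<Rightarrow> complex"
    where "x = fst" and "y a = trunc_coeff (snd a) 0" and "z a = trunc_coeff (snd a) 1" for a
  have xyz: "x (a, trunc2 b c) = a" "y (a, trunc2 b c) = b" "z (a, trunc2 b c) = c" for a b c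
    by (simp_all only: x_def y_def z_def fst_conv snd_conv trunc_coeff_trunc2)
  have ex: "\<exists>b c d. a = (b, trunc2 c d)" for a :: "complex \<times> 2 trunc"
    using ex_trunc2[of "snd a"] by (cases a) auto
  have pf: "polyfun (smul alg_C_eps2) x" "polyfun (smul alg_C_eps2) y" "polyfun (smul alg_C_eps2) z"
    by (rule polyfun.linear, unfold_locales;
        simp add: x_def y_def z_def alg_C_eps2_simps trunc_coeff_simps algebra_simps)+
  \<comment> \<open>The elementary symmetric functions of the eigenvalues of multiplication by
    \<open>a\<close>: \<open>x a\<close> once and \<open>y a\<close> twice. The nilpotent coordinate
    \<open>z\<close> does not affect them.\<close>
  define T S N where "T a = x a + 2 * y a" and "S a = 2 * x a * y a + (y a)\<^sup>2"
    and "N a = x a * (y a)\<^sup>2" for a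
  define adj where "adj a = mul alg_C_eps2 a a - smul alg_C_eps2 (T a) a
    + smul alg_C_eps2 (S a) (unity alg_C_eps2)" for a
  define \<phi> where "\<phi> v = (v $ 1, trunc2 (v $ 2) (v $ 3))" for v :: "complex^3"
  have "polyfun (smul alg_C_eps2) T" "polyfun (smul alg_C_eps2) S" "polyfun (smul alg_C_eps2) N"
    unfolding T_def S_def N_def by (intro polyfun_intros pf)+
  moreover have "T (smul alg_C_eps2 c a) = c ^ 1 * T a \<and> S (smul alg_C_eps2 c a) = c\<^sup>2 * S a
    \<and> N (smul alg_C_eps2 c a) = c ^ 3 * N a" for c a
    using ex[of a]
    by (auto simp: T_def S_def N_def alg_C_eps2_simps trunc2_ops xyz algebra_simps power2_eq_square power3_eq_cube)
  moreover have "mul alg_C_eps2 a (mul alg_C_eps2 a a) - smul alg_C_eps2 (T a) (mul alg_C_eps2 a a)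
    + smul alg_C_eps2 (S a) a - smul alg_C_eps2 (N a) (unity alg_C_eps2) = 0" for a
    using ex[of a]
    by (auto simp: T_def S_def N_def alg_C_eps2_simps trunc2_ops xyz algebra_simps power2_eq_square
        power3_eq_cube zero_prod_def)
  ultimately have "generic_equation alg_C_eps2 T S N"
    unfolding generic_equation_def form_def by blast
  then have "is_adjoint alg_C_eps2 adj"
    unfolding is_adjoint_def adj_def by blast
  moreover have "Vector_Spaces.linear (*s) (smul alg_C_eps2) \<phi>"
    by unfold_locales (simp_all add: \<phi>_def alg_C_eps2_simps trunc2_ops)
  moreover have "bij \<phi>"
  proof (rule bij_if_coordinates[where p = x and q = y and r = z])
    show "\<exists>v. a = \<phi> v" for a
      using ex[of a] by (auto simp: \<phi>_def xyz vector_3 intro!: exI[of _ "vector [x a, y a, z a]"])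
  qed (auto simp: \<phi>_def xyz)
  moreover have "\<phi> (map_2 v) = adj (\<phi> v)" for v
    by (simp add: \<phi>_def adj_def T_def S_def alg_C_eps2_simps trunc2_ops xyz map_components
        algebra_simps power2_eq_square)
  ultimately show ?thesis
    unfolding adjoint_in_coordinates_def by blast
qed

lemma adjoint_eps3: "adjoint_in_coordinates alg_eps3 map_3"
proof -
  interpret vector_space "smul alg_eps3" by (rule vector_space_algs)
  define x y z :: "3 trunc \<Rightarrow> complex"
    where "x a = trunc_coeff a 0" and "y a = trunc_coeff a 1" and "z a = trunc_coeff a 2" for a
  have xyz: "x (trunc3 a b c) = a" "y (trunc3 a b c) = b" "z (trunc3 a b c) = c" for a b c
    by (simp_all only: x_def y_def z_def trunc_coeff_trunc3)
  have pf: "polyfun (smul alg_eps3) x"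
    by (rule polyfun.linear, unfold_locales;
        simp add: x_def alg_eps3_simps trunc_coeff_simps algebra_simps)+
  \<comment> \<open>Here \<open>x a\<close> is a triple eigenvalue of multiplication by
    \<open>a\<close>.\<close>
  define T S N where "T a = 3 * x a" and "S a = 3 * (x a)\<^sup>2" and "N a = x a ^ 3" for a
  define adj where "adj a = mul alg_eps3 a a - smul alg_eps3 (T a) a
    + smul alg_eps3 (S a) (unity alg_eps3)" for a
  define \<phi> where "\<phi> v = trunc3 (v $ 1) (v $ 2) (v $ 3)" for v :: "complex^3"
  have "polyfun (smul alg_eps3) T" "polyfun (smul alg_eps3) S" "polyfun (smul alg_eps3) N"
    unfolding T_def S_def N_def by (intro polyfun_intros pf)+
  moreover have "T (smul alg_eps3 c a) = c ^ 1 * T a \<and> S (smul alg_eps3 c a) = c\<^sup>2 * S a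
    \<and> N (smul alg_eps3 c a) = c ^ 3 * N a" for c a
    using ex_trunc3[of a]
    by (auto simp: T_def S_def N_def alg_eps3_simps trunc3_ops xyz algebra_simps power2_eq_square power3_eq_cube)
  moreover have "mul alg_eps3 a (mul alg_eps3 a a) - smul alg_eps3 (T a) (mul alg_eps3 a a)
    + smul alg_eps3 (S a) a - smul alg_eps3 (N a) (unity alg_eps3) = 0" for a
    using ex_trunc3[of a]
    by (auto simp: T_def S_def N_def alg_eps3_simps trunc3_ops xyz algebra_simps power2_eq_square
        power3_eq_cube)
  ultimately have "generic_equation alg_eps3 T S N"
    unfolding generic_equation_def form_def by blast
  then have "is_adjoint alg_eps3 adj"
    unfolding is_adjoint_def adj_def by blast
  moreover have "Vector_Spaces.linear (*s) (smul alg_eps3) \<phi>"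
    by unfold_locales (simp_all add: \<phi>_def alg_eps3_simps trunc3_ops)
  moreover have "bij \<phi>"
  proof (rule bij_if_coordinates[where p = x and q = y and r = z])
    show "\<exists>v. a = \<phi> v" for a
      using ex_trunc3[of a] by (auto simp: \<phi>_def xyz vector_3 intro!: exI[of _ "vector [x a, y a, z a]"])
  qed (auto simp: \<phi>_def xyz)
  moreover have "\<phi> (map_3 v) = adj (\<phi> v)" for v
    by (simp add: \<phi>_def adj_def T_def S_def alg_eps3_simps trunc3_ops xyz map_components
        algebra_simps power2_eq_square)
  ultimately show ?thesis
    unfolding adjoint_in_coordinates_def by blast
qed

section \<open>The three quadratic maps\<close>

lemma form_map_map_1: "form_map 2 map_1" and form_map_map_2: "form_map 2 map_2"
  and form_map_map_3: "form_map 2 map_3"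
proof -
  have "map_1 (vector [1, 1, 1]) \<noteq> 0" "map_2 (vector [1, 1, 1]) \<noteq> 0" "map_3 (vector [1, 1, 1]) \<noteq> 0"
    by (simp_all add: vec3_eq_iff map_components vector_3)
  moreover have "map_1 (c *s x) = c\<^sup>2 *s map_1 x" "map_2 (c *s x) = c\<^sup>2 *s map_2 x"
    "map_3 (c *s x) = c\<^sup>2 *s map_3 x" for c x
    by (simp_all add: vec3_eq_iff map_components algebra_simps power2_eq_square)
  moreover have "poly_tuple map_1" "poly_tuple map_2" "poly_tuple map_3"
    unfolding poly_tuple_def forall_3 map_components by (intro conjI polyfun_intros polyfun_nth)+
  ultimately show "form_map 2 map_1" "form_map 2 map_2" "form_map 2 map_3"
    unfolding form_map_iff by blast+
qed

text \<open>On a line a nonconstant factor would have a zero, which is then a zero of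
  \<open>F\<close>. So a common factor is constant along each line from \<open>p\<close> to a
  general point, hence constant. This takes the place of factorisation into irreducibles.\<close>

lemma no_common_factor_if_lines_avoid_zeros:
  fixes F :: "complex^'n \<Rightarrow> complex^'n"
  assumes w: "polyfun (*s) w" "w y \<noteq> 0"
    and avoid: "\<And>x t. w x \<noteq> 0 \<Longrightarrow> F (p + t *s (x - p)) \<noteq> 0"
  shows "no_common_factor F"
  unfolding no_common_factor_def
proof (intro allI impI)
  fix h assume h: "polyfun (*s) h \<and> (\<forall>i. \<exists>g. polyfun (*s) g \<and> (\<forall>x. F x $ i = h x * g x))"
  have "h x - h p = 0" if "w x \<noteq> 0" for x
  proof -
    obtain q where q: "\<And>t. h (p + t *s (x - p)) = poly q t"
      using polyfun_line[OF conjunct1[OF h] vector_space_vec] by metis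
    have "poly q t \<noteq> 0" for t
    proof
      assume "poly q t = 0"
      then have "F (p + t *s (x - p)) = 0"
        using h q by (metis mult_zero_left vec_eq_iff zero_index)
      with avoid[OF that] show False by blast
    qed
    then have "constant (poly q)"
      using fundamental_theorem_of_algebra by blast
    then have "poly q 1 = poly q 0"
      unfolding constant_def by blast
    then show ?thesis
      using q[of 0] q[of 1] by simp
  qed
  then have "h x - h p = 0" for x
    using polyfun_eq_0_generic[where f = "\<lambda>x. h x - h p", OF _ w(1) vector_space_vec w(2)]
      polyfun_diff[OF conjunct1[OF h] polyfun.const] by blast
  then show "\<exists>c. \<forall>x. h x = c"
    by (intro exI[of _ "h p"]) simp
qed

text \<open>The zeros lie on the coordinate axes. A line from (1,1,1) to \<open>v\<close> meets an
  axis only if two coordinates vanish for the same t, which forces two coordinates of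
  \<open>v\<close> to coincide; \<open>?w\<close> excludes this.\<close>

lemma no_common_factor_if_zeros:
  fixes F :: "complex^3 \<Rightarrow> complex^3"
  assumes "\<And>v. F v = 0 \<Longrightarrow> v $ 1 = 0 \<and> v $ 2 = 0 \<or> v $ 1 = 0 \<and> v $ 3 = 0 \<or> v $ 2 = 0 \<and> v $ 3 = 0"
  shows "no_common_factor F"
proof (rule no_common_factor_if_lines_avoid_zeros)
  let ?w = "\<lambda>v :: complex^3. (v $ 1 - v $ 2) * (v $ 1 - v $ 3) * (v $ 2 - v $ 3)"
  show "polyfun (*s) ?w"
    by (intro polyfun_intros polyfun_nth)
  show "?w (vector [0, 1, 2]) \<noteq> 0"
    by (simp add: vector_3)
  fix v and t :: complex assume w: "?w v \<noteq> 0"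
  have eq: "a = b" if "1 + t * (a - 1) = 0" "1 + t * (b - 1) = 0" for a b
  proof -
    have "t \<noteq> 0"
      using that by auto
    moreover have "t * (a - b) = (1 + t * (a - 1)) - (1 + t * (b - 1))"
      by (simp add: algebra_simps)
    then have "t * (a - b) = 0"
      using that by simp
    ultimately show ?thesis by simp
  qed
  show "F (vector [1, 1, 1] + t *s (v - vector [1, 1, 1])) \<noteq> 0"
  proof
    assume "F (vector [1, 1, 1] + t *s (v - vector [1, 1, 1])) = 0"
    from assms[OF this] have "v $ 1 = v $ 2 \<or> v $ 1 = v $ 3 \<or> v $ 2 = v $ 3"
      unfolding vector_add_component vector_smult_component vector_minus_component vector_3
      using eq by blast
    with w show False by auto
  qed
qed

text \<open>Intended for adjoints, which satisfy (x#)# = N(x) x: here \<open>n\<close> is the norm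
  and the map is its own inverse.\<close>

lemma quadro_quadric_cremona_involution:
  assumes F: "form_map 2 F" "no_common_factor F" and "\<And>v. F (F v) = n v *s v" "F (F y) \<noteq> 0"
  shows "quadro_quadric_cremona (projectivization F)"
proof -
  have "ratmap_comp (projectivization F) (projectivization F) = projectivization (F \<circ> F)"
    using assms by (intro ratmap_comp_projectivization) auto
  also have "\<dots> = projectivization id"
  proof (rule projectivization_cong)
    show "poly_tuple (F \<circ> F)" "poly_tuple (id :: complex^'a \<Rightarrow> complex^'a)"
      using F(1) form_map_id by (auto intro: form_map_poly_tuple poly_tuple_compose)
    show "\<exists>x. (F \<circ> F) x \<noteq> 0"
      using assms(4) by auto
    show "\<exists>x. (id x :: complex^'a) \<noteq> 0"
      using form_map_id unfolding form_map_def by blast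
    show "parallel ((F \<circ> F) x) (id x)" for x
      by (simp add: assms(3) parallel_scale_self)
  qed
  finally have "birational_inverse (projectivization F) (projectivization F)"
    by (simp add: birational_inverse_def)
  with F show ?thesis
    unfolding quadro_quadric_cremona_def quadratic_ratmap_def by blast
qed

lemma quadro_quadric_maps:
  assumes "F \<in> {map_1, map_2, map_3}"
  shows "quadro_quadric_cremona (projectivization F)"
proof -
  have zeros: "v $ 1 = 0 \<and> v $ 2 = 0 \<or> v $ 1 = 0 \<and> v $ 3 = 0 \<or> v $ 2 = 0 \<and> v $ 3 = 0"
    if "map_1 v = 0 \<or> map_2 v = 0 \<or> map_3 v = 0" for v
    using that by (auto simp: vec3_eq_iff map_components)
  \<comment> \<open>The cubic factors are the generic norms of the three algebras.\<close>
  have inv: "map_1 (map_1 v) = (v $ 1 * v $ 2 * v $ 3) *s v" "map_2 (map_2 v) = (v $ 1 * (v $ 2)\<^sup>2) *s v"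
    "map_3 (map_3 v) = (v $ 1 ^ 3) *s v" for v
    by (simp_all add: vec3_eq_iff map_components algebra_simps power2_eq_square power3_eq_cube)
  have nz: "map_1 (map_1 (vector [1, 1, 1])) \<noteq> 0" "map_2 (map_2 (vector [1, 1, 1])) \<noteq> 0"
     "map_3 (map_3 (vector [1, 1, 1])) \<noteq> 0"
    by (simp_all add: vec3_eq_iff map_components vector_3)
  have "no_common_factor map_1" "no_common_factor map_2" "no_common_factor map_3"
    by (rule no_common_factor_if_zeros, use zeros in blast)+
  note ncf = this
  show ?thesis
    using assms quadro_quadric_cremona_involution[OF form_map_map_1 ncf(1) inv(1) nz(1)]
      quadro_quadric_cremona_involution[OF form_map_map_2 ncf(2) inv(2) nz(2)]
      quadro_quadric_cremona_involution[OF form_map_map_3 ncf(3) inv(3) nz(3)]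
    by blast
qed

section \<open>Linear equivalence by matrices, and base points\<close>

lemma invertible_inverse:
  fixes A :: "complex^'n^'n"
  assumes "invertible A"
  obtains A' where "invertible A'" "\<And>x. A *v (A' *v x) = x" "\<And>x. A' *v (A *v x) = x"
proof -
  obtain A' where "A ** A' = mat 1" "A' ** A = mat 1"
    using assms by (auto simp: invertible_def)
  then show ?thesis
    by (intro that[of A']) (auto simp: invertible_def matrix_vector_mul_assoc)
qed

lemma invertible_mult_eq_0:
  fixes A :: "complex^'n^'n"
  assumes "invertible A"
  shows "A *v x = 0 \<longleftrightarrow> x = 0"
  using invertible_inverse[OF assms] matrix_vector_mult_0_right by metis

lemma linearly_equivalent_projectivization_iff:
  assumes F: "form_map d F"
  shows "linearly_equivalent (projectivization F) f \<longleftrightarrow>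
    (\<exists>A B. invertible A \<and> invertible B \<and> f = projectivization (\<lambda>x. A *v F (B *v x)))"
proof -
  have "ratmap_comp (projectivization ((*v) A)) (ratmap_comp (projectivization F) (projectivization ((*v) B)))
    = projectivization (\<lambda>x. A *v F (B *v x))" if AB: "invertible A" "invertible B" for A B
  proof -
    obtain y where y: "F y \<noteq> 0"
      using F by (auto simp: form_map_def)
    obtain x where x: "F (B *v x) \<noteq> 0"
      using invertible_inverse[OF AB(2)] y by metis
    then have Ax: "A *v F (B *v x) \<noteq> 0"
      using invertible_mult_eq_0[OF AB(1)] by simp
    have "ratmap_comp (projectivization F) (projectivization ((*v) B)) = projectivization (F \<circ> (*v) B)"
      using x by (intro ratmap_comp_projectivization[OF F form_map_matrix[OF AB(2)]]) blast
    moreover have "form_map (d * 1) (F \<circ> (*v) B)"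
      using x by (intro form_map_compose[OF F form_map_matrix[OF AB(2)]]) blast
    then have "ratmap_comp (projectivization ((*v) A)) (projectivization (F \<circ> (*v) B))
      = projectivization ((*v) A \<circ> (F \<circ> (*v) B))"
      using Ax by (intro ratmap_comp_projectivization[OF form_map_matrix[OF AB(1)]]) auto
    ultimately show ?thesis
      by (simp add: comp_def)
  qed
  then show ?thesis
    unfolding linearly_equivalent_def proj_aut_def by (auto; metis)
qed

lemma form_map_linear_change:
  fixes A B :: "complex^'n^'n"
  assumes F: "form_map d F" and AB: "invertible A" "invertible B"
  shows "form_map d (\<lambda>x. A *v F (B *v x))"
proof -
  obtain y where y: "F y \<noteq> 0"
    using F by (auto simp: form_map_def)
  obtain x where x: "F (B *v x) \<noteq> 0"
    using invertible_inverse[OF AB(2)] y by metis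
  then have "form_map (d * 1) (F \<circ> (*v) B)"
    by (intro form_map_compose[OF F form_map_matrix[OF AB(2)]]) blast
  then have "form_map (1 * (d * 1)) ((*v) A \<circ> (F \<circ> (*v) B))"
    using x invertible_mult_eq_0[OF AB(1)]
    by (intro form_map_compose[OF form_map_matrix[OF AB(1)]]) auto
  then show ?thesis
    by (simp add: comp_def)
qed

text \<open>Symmetry and transitivity of linear equivalence in one step: if \<open>F1\<close> is
  proportional to A F B and \<open>F2\<close> to C F D, then \<open>F2\<close> is proportional to C
  A' \<open>F1\<close> B' D with the inverses A', B'.\<close>

lemma linearly_equivalent_common_source:
  assumes F: "form_map d F" and F1: "form_map d1 F1" and F2: "form_map d2 F2"
    and le1: "linearly_equivalent (projectivization F) (projectivization F1)"
    and le2: "linearly_equivalent (projectivization F) (projectivization F2)"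
  obtains A B where "invertible A" "invertible B" "(\<lambda>x. A *v F1 (B *v x)) \<in> projectivization F2"
proof -
  obtain A B where AB: "invertible A" "invertible B"
    "projectivization F1 = projectivization (\<lambda>x. A *v F (B *v x))"
    using le1 linearly_equivalent_projectivization_iff[OF F] by blast
  obtain C D where CD: "invertible C" "invertible D"
    "projectivization F2 = projectivization (\<lambda>x. C *v F (D *v x))"
    using le2 linearly_equivalent_projectivization_iff[OF F] by blast
  obtain A' where A': "invertible A'" "\<And>x. A *v (A' *v x) = x" "\<And>x. A' *v (A *v x) = x"
    using invertible_inverse[OF AB(1)] by metis
  obtain B' where B': "invertible B'" "\<And>x. B *v (B' *v x) = x" "\<And>x. B' *v (B *v x) = x"
    using invertible_inverse[OF AB(2)] by metis
  let ?G = "\<lambda>x. (C ** A') *v F1 ((B' ** D) *v x)"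
  have inv: "invertible (C ** A')" "invertible (B' ** D)"
    using CD A' B' by (auto intro: invertible_mult)
  have "parallel (A *v F (B *v x)) (F1 x)" for x
    using form_map_mem_projectivization[OF F1] unfolding AB(3) mem_projectivization_iff by blast
  from parallel_matrix[OF this[of "B' *v (D *v x)" for x], of "C ** A'"]
  have "parallel (C *v F (D *v x)) (?G x)" for x
    by (simp add: A' B' flip: matrix_vector_mul_assoc)
  then have "?G \<in> projectivization F2"
    unfolding CD(3) mem_projectivization_iff
    using form_map_linear_change[OF F1 inv] form_map_linear_change[OF F CD(1,2)]
    by (auto simp: form_map_def)
  with inv show ?thesis by (rule that)
qed

text \<open>Base points must be visible in every representative, whatever its degree. Off
  \<open>p\<close> the minor with index \<open>j\<close> forces the component \<open>i\<close> of
  \<open>G\<close> to vanish along the line, and polynomiality extends this to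
  \<open>p\<close>.\<close>

lemma representative_nth_eq_0:
  assumes G: "G \<in> projectivization F"
    and F: "\<And>t. t \<noteq> 0 \<Longrightarrow> F (p + t *s q) $ i = 0" "\<And>t. t \<noteq> 0 \<Longrightarrow> F (p + t *s q) $ j \<noteq> 0"
  shows "G p $ i = 0"
proof (rule polyfun_eq_0_limit[OF _ vector_space_vec, where f = "\<lambda>x. G x $ i" and y = q])
  show "polyfun (*s) (\<lambda>x. G x $ i)"
    using G form_map_poly_tuple by (auto simp: mem_projectivization_iff poly_tuple_def)
  fix t :: complex assume "t \<noteq> 0"
  have "F (p + t *s q) $ i * G (p + t *s q) $ j = F (p + t *s q) $ j * G (p + t *s q) $ i"
    using G unfolding mem_projectivization_iff parallel_def by blast
  then show "G (p + t *s q) $ i = 0"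
    using F[OF \<open>t \<noteq> 0\<close>] by simp
qed

text \<open>Through each coordinate point run two lines in coordinate planes whose images are
  different coordinate points; together they annihilate all three components of
  \<open>G\<close>.\<close>

lemma base_points_map_1:
  assumes "G \<in> projectivization map_1"
  shows "G (vector [1, 0, 0]) = 0" "G (vector [0, 1, 0]) = 0" "G (vector [0, 0, 1]) = 0"
proof -
  note 0 = representative_nth_eq_0[OF assms]
  show "G (vector [1, 0, 0]) = 0"
    using 0[of "vector [1, 0, 0]" "vector [0, 1, 0]" 1 3] 0[of "vector [1, 0, 0]" "vector [0, 1, 0]" 2 3]
      0[of "vector [1, 0, 0]" "vector [0, 0, 1]" 3 2]
    by (simp add: vec3_eq_iff map_components vector_3)
  show "G (vector [0, 1, 0]) = 0"
    using 0[of "vector [0, 1, 0]" "vector [1, 0, 0]" 1 3] 0[of "vector [0, 1, 0]" "vector [1, 0, 0]" 2 3]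
      0[of "vector [0, 1, 0]" "vector [0, 0, 1]" 3 1]
    by (simp add: vec3_eq_iff map_components vector_3)
  show "G (vector [0, 0, 1]) = 0"
    using 0[of "vector [0, 0, 1]" "vector [1, 0, 0]" 1 2] 0[of "vector [0, 0, 1]" "vector [1, 0, 0]" 3 2]
      0[of "vector [0, 0, 1]" "vector [0, 1, 0]" 2 1]
    by (simp add: vec3_eq_iff map_components vector_3)
qed

lemma base_points_map_2:
  assumes "G \<in> projectivization map_2"
  shows "G (vector [1, 0, 0]) = 0" "G (vector [0, 0, 1]) = 0"
proof -
  note 0 = representative_nth_eq_0[OF assms]
  show "G (vector [1, 0, 0]) = 0"
    using 0[of "vector [1, 0, 0]" "vector [0, 0, 1]" 1 3] 0[of "vector [1, 0, 0]" "vector [0, 0, 1]" 2 3]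
      0[of "vector [1, 0, 0]" "vector [0, 1, 0]" 3 2]
    by (simp add: vec3_eq_iff map_components vector_3)
  show "G (vector [0, 0, 1]) = 0"
    using 0[of "vector [0, 0, 1]" "vector [1, 0, 0]" 1 3] 0[of "vector [0, 0, 1]" "vector [1, 0, 0]" 2 3]
      0[of "vector [0, 0, 1]" "vector [0, 1, 0]" 3 1]
    by (simp add: vec3_eq_iff map_components vector_3)
qed

lemma invertible_basis_not_in_plane:
  fixes B :: "complex^3^3"
  assumes "invertible B" "(B *v vector [1, 0, 0]) $ i = 0" "(B *v vector [0, 1, 0]) $ i = 0"
    "(B *v vector [0, 0, 1]) $ i = 0"
  shows False
proof -
  have "(B *v v) $ i = 0" for v
  proof -
    have "v $ 1 *s vector [1, 0, 0] + v $ 2 *s vector [0, 1, 0] + v $ 3 *s vector [0, 0, 1] = v"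
      by (simp add: vec3_eq_iff vector_3)
    moreover have "(B *v (v $ 1 *s vector [1, 0, 0] + v $ 2 *s vector [0, 1, 0]
      + v $ 3 *s vector [0, 0, 1])) $ i = 0"
      using assms by (simp only: matrix_vector_right_distrib vector_scalar_commute) simp
    ultimately show ?thesis by (simp only:)
  qed
  moreover obtain v where "B *v v = axis i 1"
    using invertible_inverse[OF assms(1)] by metis
  ultimately show False
    by (metis axis_nth zero_neq_one)
qed

lemma invertible_not_same_line:
  fixes B :: "complex^3^3"
  assumes "invertible B" "(B *v vector [1, 0, 0]) $ 1 = 0" "(B *v vector [1, 0, 0]) $ 2 = 0"
    "(B *v vector [0, 0, 1]) $ 1 = 0" "(B *v vector [0, 0, 1]) $ 2 = 0"
  shows False
proof -
  let ?c = "(B *v vector [0, 0, 1]) $ 3" and ?d = "(B *v vector [1, 0, 0]) $ 3"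
  have "B *v (?c *s vector [1, 0, 0] - ?d *s vector [0, 0, 1]) = 0"
    using assms by (simp add: vec3_eq_iff matrix_vector_mult_diff_distrib vector_scalar_commute)
  then have "?c *s vector [1, 0, 0] - ?d *s vector [0, 0, 1] = (0 :: complex^3)"
    using invertible_mult_eq_0[OF assms(1)] by blast
  then have "?d = 0"
    by (simp add: vec3_eq_iff vector_3)
  with assms have "B *v vector [1, 0, 0] = 0"
    by (simp add: vec3_eq_iff)
  then have "vector [1, 0, 0] = (0 :: complex^3)"
    using invertible_mult_eq_0[OF assms(1)] by blast
  then show False
    by (simp add: vec3_eq_iff vector_3)
qed

text \<open>No points are counted: \<open>B\<close> carries the base points of \<open>F2\<close>
  into zeros of \<open>F1\<close>. The zeros of \<open>map_2\<close> and \<open>map_3\<close> lie in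
  the plane v2 = 0, too small for the images of three independent vectors, and those of
  \<open>map_3\<close> on the line v1 = v2 = 0, too small for two.\<close>

lemma not_both_linearly_equivalent:
  assumes F: "form_map d F" and 12: "(F1, F2) \<in> {(map_2, map_1), (map_3, map_1), (map_3, map_2)}"
    and le1: "linearly_equivalent (projectivization F) (projectivization F1)"
    and le2: "linearly_equivalent (projectivization F) (projectivization F2)"
  shows False
proof -
  have "form_map 2 F1" "form_map 2 F2"
    using 12 form_map_map_1 form_map_map_2 form_map_map_3 by auto
  then obtain A B where AB: "invertible A" "invertible B"
    and mem: "(\<lambda>x. A *v F1 (B *v x)) \<in> projectivization F2"
    using linearly_equivalent_common_source[OF F _ _ le1 le2] by metis
  have zero2: "map_2 v = 0 \<Longrightarrow> v $ 2 = 0" and zero3: "map_3 v = 0 \<Longrightarrow> v $ 1 = 0 \<and> v $ 2 = 0" for v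
    by (auto simp: vec3_eq_iff map_components)
  consider "F1 = map_2 \<or> F1 = map_3" "F2 = map_1" | "F1 = map_3" "F2 = map_2"
    using 12 by auto
  then show False
  proof cases
    case 1
    with base_points_map_1[OF mem[unfolded 1(2)]] have "(B *v vector [1, 0, 0]) $ 2 = 0"
      "(B *v vector [0, 1, 0]) $ 2 = 0" "(B *v vector [0, 0, 1]) $ 2 = 0"
      unfolding invertible_mult_eq_0[OF AB(1)] using zero2 zero3 by blast+
    with AB(2) show False
      by (rule invertible_basis_not_in_plane)
  next
    case 2
    from base_points_map_2[OF mem[unfolded 2]] show False
      unfolding invertible_mult_eq_0[OF AB(1)] using zero3 invertible_not_same_line[OF AB(2)] by blast
  qed
qed

section \<open>Quadratic forms and their bilinear maps\<close>

definition sym_bilinear :: "(complex^'n \<Rightarrow> complex^'n \<Rightarrow> complex^'n) \<Rightarrow> bool" where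
  "sym_bilinear b \<longleftrightarrow> (\<forall>x y z. b (x + y) z = b x z + b y z) \<and>
    (\<forall>r x y. b (r *s x) y = r *s b x y) \<and> (\<forall>x y. b x y = b y x)"

lemma sym_bilinear_commute: "sym_bilinear b \<Longrightarrow> b x y = b y x"
  unfolding sym_bilinear_def by blast

lemma sym_bilinear_simps:
  assumes "sym_bilinear b"
  shows "b (x + y) z = b x z + b y z" "b z (x + y) = b z x + b z y"
    "b (r *s x) y = r *s b x y" "b y (r *s x) = r *s b y x"
    "b (- x) y = - b x y" "b y (- x) = - b y x"
    "b (x - y) z = b x z - b y z" "b z (x - y) = b z x - b z y"
    "b 0 y = 0" "b y 0 = 0"
proof -
  show add: "b (x + y) z = b x z + b y z" and scale: "b (r *s x) y = r *s b x y" for x y z r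
    using assms unfolding sym_bilinear_def by blast+
  have minus: "b (- x) y = - b x y" for x y
    using scale[of "-1" x y] by simp
  have diff: "b (x - y) z = b x z - b y z" for x y z
    using add[of x "- y" z] minus by simp
  have zero: "b 0 y = 0" for y
    using scale[of 0 0 y] by simp
  show "b (- x) y = - b x y" "b (x - y) z = b x z - b y z" "b 0 y = 0"
    by (fact minus diff zero)+
  note c = sym_bilinear_commute[OF assms]
  show "b z (x + y) = b z x + b z y" "b y (r *s x) = r *s b y x" "b y (- x) = - b y x"
    "b z (x - y) = b z x - b z y" "b y 0 = 0"
    using add[of x y z] scale[of r x y] minus[of x y] diff[of x y z] zero c by metis+
qed

lemma form_map_2_bilinear:
  fixes F :: "complex^'n \<Rightarrow> complex^'n"
  assumes "form_map 2 F"
  obtains b where "sym_bilinear b" "\<And>x. F x = b x x"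
proof -
  have "\<exists>b. (\<forall>y. Vector_Spaces.linear (*s) (*) (\<lambda>x. b x y)) \<and> (\<forall>x y. b x y = b y x) \<and> (\<forall>x. F x $ i = b x x)" for i
  proof -
    have "form (*s) 2 (\<lambda>x. F x $ i)"
      using assms unfolding form_map_def by blast
    from this vector_space_vec obtain b' where "\<And>y. Vector_Spaces.linear (*s) (*) (\<lambda>x. b' x y)"
      "\<And>x y. b' x y = b' y x" "\<And>x. F x $ i = b' x x"
      by (rule form_2_bilinear) (rule that)
    then show ?thesis
      by (intro exI[of _ b'] conjI allI)
  qed
  then obtain b where lin: "\<And>i y. Vector_Spaces.linear (*s) (*) (\<lambda>x. b i x y)"
    and sym: "\<And>i x y. b i x y = b i y x" and F: "\<And>i x. F x $ i = b i x x"
    by metis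
  have "b i (x + y) z = b i x z + b i y z" "b i (r *s x) z = r * b i x z" for i x y z r
  proof -
    interpret l: Vector_Spaces.linear "(*s)" "(*)" "\<lambda>x. b i x z" by (rule lin)
    show "b i (x + y) z = b i x z + b i y z" "b i (r *s x) z = r * b i x z"
      by (rule l.add l.scale)+
  qed
  then have "sym_bilinear (\<lambda>x y. \<chi> i. b i x y)"
    using sym by (simp add: sym_bilinear_def vec_eq_iff)
  moreover have "F x = (\<chi> i. b i x x)" for x
    using F by (simp add: vec_eq_iff)
  ultimately show ?thesis by (rule that)
qed

lemma cremona_representatives:
  fixes f :: "'n::finite ratmap"
  assumes "quadro_quadric_cremona f"
  obtains F b c where "f = projectivization F" "form_map 2 F" "no_common_factor F"
    "sym_bilinear b" "sym_bilinear c" "\<And>x. F x = b x x"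
    "\<And>x. parallel (c (F x) (F x)) x" "\<And>y. parallel (F (c y y)) y" "\<exists>x. c (F x) (F x) \<noteq> 0"
proof -
  obtain g where f: "quadratic_ratmap f" and g: "quadratic_ratmap g"
    and inv: "ratmap_comp f g = projectivization id" "ratmap_comp g f = projectivization id"
    using assms unfolding quadro_quadric_cremona_def birational_inverse_def by blast
  obtain F where F: "form_map 2 F" "no_common_factor F" "f = projectivization F"
    using f unfolding quadratic_ratmap_def by blast
  obtain G where G: "form_map 2 G" "g = projectivization G"
    using g unfolding quadratic_ratmap_def by blast
  \<comment> \<open>Being a union, the composition yields only some representatives
    \<open>F'\<close>, \<open>G'\<close> whose composite is proportional to the identity. At a
    general \<open>x\<close> the vector G'(F'(x)) is a nonzero multiple of \<open>x\<close>, so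
    \<open>F\<close> does not vanish on the image of \<open>G'\<close>; at general points
    \<open>G'\<close> is then replaced by the proportional \<open>G\<close>.\<close>
  have nonzero: "\<exists>y. F (G y) \<noteq> 0"
    if F: "form_map 2 F" and G: "form_map 2 G"
    and id: "ratmap_comp (projectivization G) (projectivization F) = projectivization id"
    for F G :: "complex^'n \<Rightarrow> complex^'n"
  proof -
    have "id \<in> ratmap_comp (projectivization G) (projectivization F)"
      unfolding id by (rule form_map_mem_projectivization[OF form_map_id])
    then obtain F' G' where F': "F' \<in> projectivization F" and G': "G' \<in> projectivization G"
      and GF: "id \<in> projectivization (G' \<circ> F')"
      unfolding ratmap_comp_def by blast
    from GF obtain x0 where x0: "G' (F' x0) \<noteq> 0" and par: "\<And>x. parallel (G' (F' x)) x"
      unfolding mem_projectivization_iff by auto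
    have pt: "poly_tuple F" "poly_tuple F'" "poly_tuple G" "poly_tuple G'"
      using F G F' G' form_map_poly_tuple unfolding mem_projectivization_iff by blast+
    obtain x1 where "F x1 \<noteq> 0"
      using F unfolding form_map_def by blast
    then obtain x where x: "F x \<noteq> 0" "G' (F' x) \<noteq> 0"
      using poly_tuple_common_nonzero[OF pt(1) poly_tuple_compose[OF pt(4,2)], of x1 x0] x0 by auto
    then obtain k where "x = k *s G' (F' x)"
      using parallel_imp_scale[OF par] by blast
    then have "F (G' (F' x)) \<noteq> 0"
      using x(1) form_map_scale[OF F, of k "G' (F' x)"] by auto
    moreover obtain y1 where "G y1 \<noteq> 0"
      using G unfolding form_map_def by blast
    ultimately obtain z where z: "F (G' z) \<noteq> 0" "G z \<noteq> 0"
      using poly_tuple_common_nonzero[OF poly_tuple_compose[OF pt(1,4)] pt(3), of "F' x" y1] by auto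
    have "parallel (G z) (G' z)"
      using G' unfolding mem_projectivization_iff by blast
    then obtain k where "G' z = k *s G z"
      using parallel_imp_scale z(2) by blast
    then have "F (G z) \<noteq> 0"
      using z(1) form_map_scale[OF F, of k "G z"] by auto
    then show ?thesis by blast
  qed
  have parallel: "parallel (F (G y)) y"
    if F: "form_map 2 F" and G: "form_map 2 G" and nz: "\<exists>y. F (G y) \<noteq> 0"
    and id: "ratmap_comp (projectivization F) (projectivization G) = projectivization id"
    for F G :: "complex^'n \<Rightarrow> complex^'n" and y
  proof -
    have "F \<circ> G \<in> projectivization (F \<circ> G)"
      using form_map_compose[OF F G nz] by (rule form_map_mem_projectivization)
    then have "F \<circ> G \<in> projectivization id"
      using ratmap_comp_projectivization[OF F G nz] id by simp
    then show ?thesis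
      by (simp add: mem_projectivization_iff parallel_sym)
  qed
  have nz: "\<exists>y. F (G y) \<noteq> 0" "\<exists>x. G (F x) \<noteq> 0"
    using nonzero F(1) G(1) inv unfolding F(3) G(2) by blast+
  have par: "parallel (F (G y)) y" "parallel (G (F y)) y" for y
    using parallel F(1) G(1) nz inv unfolding F(3) G(2) by blast+
  obtain b where b: "sym_bilinear b" "\<And>x. F x = b x x"
    by (rule form_map_2_bilinear[OF F(1)]) (rule that)
  obtain c where c: "sym_bilinear c" "\<And>x. G x = c x x"
    by (rule form_map_2_bilinear[OF G(1)]) (rule that)
  show ?thesis
    using that[OF F(3,1,2) b(1) c(1) b(2)] par nz(2) unfolding c(2) by blast
qed

section \<open>Comparison of coefficients along a line\<close>

lemma poly_function_eq_0:
  fixes a0 a1 a2 a3 a4 a5 :: complex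
  assumes "\<And>t. a0 + t * a1 + t\<^sup>2 * a2 + t ^ 3 * a3 + t ^ 4 * a4 + t ^ 5 * a5 = 0"
  shows "a0 = 0 \<and> a1 = 0 \<and> a2 = 0 \<and> a3 = 0 \<and> a4 = 0 \<and> a5 = 0"
proof -
  have "poly [:a0, a1, a2, a3, a4, a5:] t = 0" for t
    using assms[of t] by (simp add: algebra_simps power2_eq_square power3_eq_cube eval_nat_numeral)
  then have "[:a0, a1, a2, a3, a4, a5:] = 0"
    by (intro poly_eq_0_if_nonzero)
  then show ?thesis by simp
qed

text \<open>The numbers n0, n1, ... are the successive quotients when w0 + t w1 + ... is divided by
  p + t v as a power series in t. Each minor coefficient makes the next remainder parallel to
  \<open>p\<close>, hence a multiple of it. The condition of degree 5 is kept as
  \<open>parallel w4 v\<close>; it forces n4 = 0 once \<open>p\<close> and \<open>v\<close> are not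
  parallel.\<close>

lemma parallel_line_coefficients:
  fixes p v :: "complex^'n"
  assumes "\<And>t. parallel (w0 + t *s w1 + t\<^sup>2 *s w2 + t ^ 3 *s w3 + t ^ 4 *s w4) (p + t *s v)"
    and p: "p \<noteq> 0" and w0: "w0 = n0 *s p"
  obtains n1 n2 n3 n4 where "w1 = n1 *s p + n0 *s v" "w2 = n2 *s p + n1 *s v"
    "w3 = n3 *s p + n2 *s v" "w4 = n4 *s p + n3 *s v" "parallel w4 v"
proof -
  have coeffs: "w0 $ i * p $ j - w0 $ j * p $ i = 0 \<and>
    w1 $ i * p $ j + w0 $ i * v $ j - w1 $ j * p $ i - w0 $ j * v $ i = 0 \<and>
    w2 $ i * p $ j + w1 $ i * v $ j - w2 $ j * p $ i - w1 $ j * v $ i = 0 \<and>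
    w3 $ i * p $ j + w2 $ i * v $ j - w3 $ j * p $ i - w2 $ j * v $ i = 0 \<and>
    w4 $ i * p $ j + w3 $ i * v $ j - w4 $ j * p $ i - w3 $ j * v $ i = 0 \<and>
    w4 $ i * v $ j - w4 $ j * v $ i = 0" for i j
  proof (rule poly_function_eq_0)
    fix t
    have "(w0 + t *s w1 + t\<^sup>2 *s w2 + t ^ 3 *s w3 + t ^ 4 *s w4) $ i * (p + t *s v) $ j
      - (w0 + t *s w1 + t\<^sup>2 *s w2 + t ^ 3 *s w3 + t ^ 4 *s w4) $ j * (p + t *s v) $ i = 0"
      using assms(1)[of t] unfolding parallel_def by simp
    then show "w0 $ i * p $ j - w0 $ j * p $ i +
      t * (w1 $ i * p $ j + w0 $ i * v $ j - w1 $ j * p $ i - w0 $ j * v $ i) +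
      t\<^sup>2 * (w2 $ i * p $ j + w1 $ i * v $ j - w2 $ j * p $ i - w1 $ j * v $ i) +
      t ^ 3 * (w3 $ i * p $ j + w2 $ i * v $ j - w3 $ j * p $ i - w2 $ j * v $ i) +
      t ^ 4 * (w4 $ i * p $ j + w3 $ i * v $ j - w4 $ j * p $ i - w3 $ j * v $ i) +
      t ^ 5 * (w4 $ i * v $ j - w4 $ j * v $ i) = 0"
      by (simp add: algebra_simps power2_eq_square power3_eq_cube eval_nat_numeral)
  qed
  have step: "\<exists>n'. w' = n' *s p + n *s v"
    if "w = n *s p + m *s v"
      "\<And>i j. w' $ i * p $ j + w $ i * v $ j - w' $ j * p $ i - w $ j * v $ i = 0"
    for w w' m n
  proof -
    have "parallel p (w' - n *s v)"
      unfolding parallel_def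
    proof (intro allI)
      fix i j
      have "w' $ i * p $ j + (n * p $ i + m * v $ i) * v $ j - w' $ j * p $ i
          - (n * p $ j + m * v $ j) * v $ i = 0"
        using that(2)[of i j] unfolding that(1) by simp
      then have "p $ i * (w' $ j - n * v $ j) = p $ j * (w' $ i - n * v $ i)"
        by algebra
      then show "p $ i * (w' - n *s v) $ j = p $ j * (w' - n *s v) $ i"
        by simp
    qed
    then obtain k where "w' - n *s v = k *s p"
      using parallel_imp_scale p by blast
    then have "w' = k *s p + n *s v"
      by (simp add: algebra_simps)
    then show ?thesis by blast
  qed
  obtain n1 where n1: "w1 = n1 *s p + n0 *s v"
    using step[of w0 n0 0 w1] w0 coeffs by auto
  obtain n2 where n2: "w2 = n2 *s p + n1 *s v"
    using step[of w1 n1 n0 w2] n1 coeffs by blast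
  obtain n3 where n3: "w3 = n3 *s p + n2 *s v"
    using step[of w2 n2 n1 w3] n2 coeffs by blast
  obtain n4 where n4: "w4 = n4 *s p + n3 *s v"
    using step[of w3 n3 n2 w4] n3 coeffs by blast
  have "parallel w4 v"
    using coeffs by (simp add: parallel_def)
  with n1 n2 n3 n4 show ?thesis by (rule that)
qed

lemma bilinear_composition_line:
  assumes b: "sym_bilinear b" and c: "sym_bilinear c"
    and par: "\<And>x. parallel (c (b x x) (b x x)) x"
  shows "parallel (c (b p p) (b p p) + t *s (4 *s c (b p p) (b p v)) +
    t\<^sup>2 *s (2 *s c (b p p) (b v v) + 4 *s c (b p v) (b p v)) +
    t ^ 3 *s (4 *s c (b p v) (b v v)) + t ^ 4 *s c (b v v) (b v v)) (p + t *s v)"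
proof -
  let ?B = "b p p + (2 * t) *s b p v + t\<^sup>2 *s b v v"
  have "b (p + t *s v) (p + t *s v) = ?B"
    using sym_bilinear_commute[OF b, of v p]
    by (simp add: sym_bilinear_simps[OF b] vec_eq_iff algebra_simps power2_eq_square)
  moreover have "c ?B ?B = c (b p p) (b p p) + t *s (4 *s c (b p p) (b p v)) +
    t\<^sup>2 *s (2 *s c (b p p) (b v v) + 4 *s c (b p v) (b p v)) +
    t ^ 3 *s (4 *s c (b p v) (b v v)) + t ^ 4 *s c (b v v) (b v v)"
    using sym_bilinear_commute[OF c, of "b p v" "b p p"] sym_bilinear_commute[OF c, of "b v v" "b p p"]
      sym_bilinear_commute[OF c, of "b v v" "b p v"]
    by (simp add: sym_bilinear_simps[OF c] vec_eq_iff algebra_simps power2_eq_square power3_eq_cube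
        eval_nat_numeral)
  ultimately show ?thesis
    using par[of "p + t *s v"] by simp
qed

section \<open>Normalising a Cremona transformation\<close>

lemma linear_matrix_exists:
  fixes f :: "complex^'n \<Rightarrow> complex^'m"
  assumes "\<And>x y. f (x + y) = f x + f y" "\<And>r x. f (r *s x) = r *s f x"
  obtains M where "\<And>x. M *v x = f x"
proof -
  have "Vector_Spaces.linear (*s) (*s) f"
    using assms by unfold_locales
  then show ?thesis
    by (intro that[of "matrix f"]) (rule matrix_works)
qed

lemma invertible_if_injective:
  fixes M :: "complex^'n^'n"
  assumes "\<And>x. M *v x = 0 \<Longrightarrow> x = 0"
  shows "invertible M"
  using assms matrix_left_invertible_ker[of M] invertible_left_inverse[of M] by blast

text \<open>\<open>e\<close> and \<open>\<tau>\<close> play the roles of the unity and the generic trace of an algebra whose adjoint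
  \<open>F\<close> has the polarisation \<open>b\<close>, whereas \<open>c\<close> is the polarisation of the inverse of \<open>F\<close>. That \<open>c = b\<close> is
  not part of the definition.\<close>

definition unital_pairing ::
  "complex^'n \<Rightarrow> (complex^'n \<Rightarrow> complex) \<Rightarrow> (complex^'n \<Rightarrow> complex^'n \<Rightarrow> complex^'n) \<Rightarrow>
    (complex^'n \<Rightarrow> complex^'n \<Rightarrow> complex^'n) \<Rightarrow> bool" where
  "unital_pairing e \<tau> b c \<longleftrightarrow> sym_bilinear b \<and> sym_bilinear c \<and> e \<noteq> 0 \<and> \<tau> e = 3 \<and>
    (\<forall>x y. \<tau> (x + y) = \<tau> x + \<tau> y) \<and> (\<forall>r x. \<tau> (r *s x) = r * \<tau> x) \<and>
    (\<forall>x. b e x = (1 / 2) *s (\<tau> x *s e - x)) \<and> (\<forall>x. c e x = (1 / 2) *s (\<tau> x *s e - x)) \<and>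
    (\<forall>x. parallel (c (b x x) (b x x)) x) \<and> (\<forall>y. parallel (b (c y y) (c y y)) y)"

lemma normalise_cremona:
  fixes b c :: "complex^'n \<Rightarrow> complex^'n \<Rightarrow> complex^'n"
  assumes b: "sym_bilinear b" and c: "sym_bilinear c"
    and par: "\<And>x. parallel (c (b x x) (b x x)) x" "\<And>y. parallel (b (c y y) (c y y)) y"
    and nz: "c (b x0 x0) (b x0 x0) \<noteq> 0"
  obtains L e \<tau> c' where "invertible L" "unital_pairing e \<tau> (\<lambda>x y. L *v b x y) c'"
proof -
  let ?f = "b x0 x0"
  note bs = sym_bilinear_simps[OF b] and cs = sym_bilinear_simps[OF c]
  obtain n where n: "x0 = n *s c ?f ?f"
    using parallel_imp_scale[OF par(1) nz] .
  have e0: "x0 \<noteq> 0"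
    using nz by (auto simp: bs cs)
  define m where "m = inverse n"
  have "n \<noteq> 0"
    using n e0 by auto
  then have m: "c ?f ?f = m *s x0" "m \<noteq> 0"
    using arg_cong[OF n, of "\<lambda>x. m *s x"] by (simp_all add: m_def)
  have "\<exists>s. 4 *s c ?f (b x0 v) = s *s x0 + m *s v" for v
    using parallel_line_coefficients[OF bilinear_composition_line[OF b c par(1), of x0 _ v] e0 m(1)]
    by metis
  then obtain s where s: "\<And>v. 4 *s c ?f (b x0 v) = s v *s x0 + m *s v"
    by metis
  have s_inj: "s1 = s2" if "s1 *s x0 = s2 *s x0" for s1 s2
    using that e0 by simp
  have s_add: "s (x + y) = s x + s y" for x y
  proof (rule s_inj)
    have "4 *s c ?f (b x0 (x + y)) = 4 *s c ?f (b x0 x) + 4 *s c ?f (b x0 y)"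
      by (simp add: bs cs vector_add_ldistrib)
    then show "s (x + y) *s x0 = (s x + s y) *s x0"
      unfolding s by (simp add: vec_eq_iff algebra_simps)
  qed
  have s_scale: "s (r *s x) = r * s x" for r x
  proof (rule s_inj)
    have "4 *s c ?f (b x0 (r *s x)) = r *s (4 *s c ?f (b x0 x))"
      by (simp add: bs cs mult.commute)
    then show "s (r *s x) *s x0 = (r * s x) *s x0"
      unfolding s by (simp add: vec_eq_iff algebra_simps)
  qed
  \<comment> \<open>At v = x0 the linear coefficient is 4 m x0, of which m x0 is the part
    \<open>m *s v\<close>.\<close>
  have s_e: "s x0 = 3 * m"
  proof (rule s_inj)
    have "4 *s (m *s x0) = s x0 *s x0 + m *s x0"
      using s[of x0] m(1) by simp
    then have "s x0 *s x0 = 4 *s (m *s x0) - m *s x0"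
      by (simp add: algebra_simps)
    also have "\<dots> = (3 * m) *s x0"
      by (simp add: vec_eq_iff algebra_simps)
    finally show "s x0 *s x0 = (3 * m) *s x0" .
  qed
  define \<tau> where "\<tau> x = s x / m" for x
  have s_\<tau>: "s x = m * \<tau> x" for x
    using m(2) by (simp add: \<tau>_def)
  have \<tau>: "\<tau> (x + y) = \<tau> x + \<tau> y" "\<tau> (r *s x) = r * \<tau> x" "\<tau> x0 = 3" for x y r
    using m(2) by (simp_all add: \<tau>_def s_add s_scale s_e add_divide_distrib)
  have \<tau>_diff: "\<tau> (x - y) = \<tau> x - \<tau> y" for x y
    using \<tau>(1)[of "x - y" y] by simp
  \<comment> \<open>The inverse of \<sigma>: x \<mapsto> (\<tau>(x) x0 - x) / 2. The matrix
    \<open>L'\<close> then sends \<sigma>(x) to \<open>b x0 x\<close>, so its inverse gives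
    \<open>L *v b x0 x\<close> the value required by \<open>unital_pairing\<close>.\<close>
  define \<rho> where "\<rho> x = \<tau> x *s x0 - 2 *s x" for x
  have \<tau>_\<rho>: "\<tau> (\<rho> x) = \<tau> x" for x
    by (simp add: \<rho>_def \<tau>_diff \<tau>(2,3))
  obtain L' where L': "\<And>x. L' *v x = b x0 (\<rho> x)"
  proof (rule linear_matrix_exists)
    show "b x0 (\<rho> (x + y)) = b x0 (\<rho> x) + b x0 (\<rho> y)" for x y
      by (simp add: \<rho>_def \<tau> bs vec_eq_iff algebra_simps)
    show "b x0 (\<rho> (r *s x)) = r *s b x0 (\<rho> x)" for r x
      by (simp add: \<rho>_def \<tau> bs vec_eq_iff algebra_simps)
  qed (rule that)
  \<comment> \<open>For \<open>x\<close> in the kernel, the linear coefficient at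
    \<open>\<rho> x\<close> makes \<open>\<rho> x\<close> a multiple of \<open>x0\<close>; since
    \<open>b x0 x0\<close> is nonzero this multiple is 0.\<close>
  have "invertible L'"
  proof (rule invertible_if_injective)
    fix x assume "L' *v x = 0"
    then have 0: "b x0 (\<rho> x) = 0"
      by (simp add: L')
    then have eq: "s (\<rho> x) *s x0 + m *s \<rho> x = 0"
      using s[of "\<rho> x"] by (simp add: cs)
    then have "m *s \<rho> x = (- s (\<rho> x)) *s x0"
      by (simp add: vec_eq_iff eq_neg_iff_add_eq_0 add.commute)
    then have "inverse m *s (m *s \<rho> x) = inverse m *s ((- s (\<rho> x)) *s x0)"
      by simp
    then have \<rho>: "\<rho> x = (inverse m * - s (\<rho> x)) *s x0"
      using m(2) by simp
    then have "b x0 (\<rho> x) = (inverse m * - s (\<rho> x)) *s ?f"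
      using bs(4) by metis
    moreover have "?f \<noteq> 0"
      using nz by (auto simp: cs)
    ultimately have "inverse m * - s (\<rho> x) = 0"
      using 0 by simp
    then have "\<rho> x = 0"
      using \<rho> by (metis vector_smult_lzero)
    moreover from this have "\<tau> x = 0"
      using \<tau>_\<rho>[of x] \<tau>(2)[of 0 0] by simp
    ultimately show "x = 0"
      by (simp add: \<rho>_def)
  qed
  then obtain L where L: "invertible L" "\<And>x. L' *v (L *v x) = x" "\<And>x. L *v (L' *v x) = x"
    by (rule invertible_inverse) (rule that)
  \<comment> \<open>Precomposition with \<open>L'\<close> undoes the change of the target by
    \<open>L\<close>, and \<open>inverse m\<close> normalises \<open>c' x0 x0\<close> to
    \<open>x0\<close>.\<close>
  define c' where "c' x y = inverse m *s c (L' *v x) (L' *v y)" for x y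
  have half: "\<rho> ((1 / 2) *s (\<tau> x *s x0 - x)) = x" for x
    by (simp add: \<rho>_def \<tau> \<tau>_diff vec_eq_iff algebra_simps)
  have 1: "L *v b x0 x = (1 / 2) *s (\<tau> x *s x0 - x)" for x
    using L(3)[of "(1 / 2) *s (\<tau> x *s x0 - x)"] unfolding L' half .
  have "L' *v x0 = ?f"
    by (simp add: L' \<rho>_def \<tau> vec_eq_iff algebra_simps bs)
  then have 2: "c' x0 x = (1 / 2) *s (\<tau> x *s x0 - x)" for x
  proof -
    have "c' x0 x = inverse (4 * m) *s (4 *s c ?f (b x0 (\<rho> x)))"
      using \<open>L' *v x0 = ?f\<close> by (simp add: c'_def L')
    also have "\<dots> = inverse (4 * m) *s ((m * \<tau> x) *s x0 + m *s (\<tau> x *s x0 - 2 *s x))"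
      unfolding s s_\<tau> \<tau>_\<rho> by (simp add: \<rho>_def)
    also have "\<dots> = (1 / 2) *s (\<tau> x *s x0 - x)"
      using m(2) by (simp add: vec_eq_iff field_simps)
    finally show ?thesis .
  qed
  have "sym_bilinear (\<lambda>x y. L *v b x y)"
    using sym_bilinear_commute[OF b]
    by (simp add: sym_bilinear_def bs matrix_vector_right_distrib vector_scalar_commute)
  moreover have "sym_bilinear c'"
    using sym_bilinear_commute[OF c]
    by (simp add: sym_bilinear_def c'_def cs matrix_vector_right_distrib vector_scalar_commute
        vector_add_ldistrib mult.commute)
  moreover have "parallel (c' (L *v b x x) (L *v b x x)) x" for x
    using par(1)[of x] by (simp add: c'_def L parallel_scale)
  moreover have "parallel (L *v b (c' y y) (c' y y)) y" for y
  proof -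
    have "parallel (L *v b (c (L' *v y) (L' *v y)) (c (L' *v y) (L' *v y))) (L *v (L' *v y))"
      by (intro parallel_matrix par(2))
    then show ?thesis
      by (simp add: c'_def L bs vector_scalar_commute parallel_scale)
  qed
  ultimately have "unital_pairing x0 \<tau> (\<lambda>x y. L *v b x y) c'"
    using e0 1 2 \<tau> unfolding unital_pairing_def by blast
  with L(1) show ?thesis by (rule that)
qed

section \<open>Independent vectors and the equations of second order\<close>

definition independent3 :: "complex^'n \<Rightarrow> complex^'n \<Rightarrow> complex^'n \<Rightarrow> bool" where
  "independent3 u v w \<longleftrightarrow> (\<forall>r s t. r *s u + s *s v + t *s w = 0 \<longrightarrow> r = 0 \<and> s = 0 \<and> t = 0)"

lemma independent3_matrix:
  fixes u v w :: "complex^3"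
  assumes "independent3 u v w"
  obtains P :: "complex^3^3" where "invertible P" "\<And>x. P *v x = x $ 1 *s u + x $ 2 *s v + x $ 3 *s w"
proof -
  let ?f = "\<lambda>x :: complex^3. x $ 1 *s u + x $ 2 *s v + x $ 3 *s w"
  obtain P where P: "\<And>x. P *v x = ?f x"
  proof (rule linear_matrix_exists)
    show "?f (x + y) = ?f x + ?f y" "?f (r *s x) = r *s ?f x" for x y r
      by (simp_all add: vec_eq_iff algebra_simps)
  qed (rule that)
  moreover have "invertible P"
  proof (rule invertible_if_injective)
    fix x assume "P *v x = 0"
    then have "x $ 1 = 0 \<and> x $ 2 = 0 \<and> x $ 3 = 0"
      using assms unfolding P independent3_def by blast
    then show "x = 0"
      by (simp add: vec3_eq_iff)
  qed
  ultimately show ?thesis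
    using that by blast
qed

lemma extend_to_independent3:
  fixes e :: "complex^3"
  assumes "e \<noteq> 0"
  obtains u v where "independent3 e u v"
proof -
  consider "e $ 1 \<noteq> 0" | "e $ 2 \<noteq> 0" | "e $ 3 \<noteq> 0"
    using assms by (auto simp: vec3_eq_iff)
  then show ?thesis
  proof cases
    case 1
    then show ?thesis
      by (intro that[of "vector [0, 1, 0]" "vector [0, 0, 1]"])
        (auto simp: independent3_def vec3_eq_iff vector_3)
  next
    case 2
    then show ?thesis
      by (intro that[of "vector [1, 0, 0]" "vector [0, 0, 1]"])
        (auto simp: independent3_def vec3_eq_iff vector_3)
  next
    case 3
    then show ?thesis
      by (intro that[of "vector [1, 0, 0]" "vector [0, 1, 0]"])
        (auto simp: independent3_def vec3_eq_iff vector_3)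
  qed
qed

text \<open>The coefficients of \<open>t\<^sup>2\<close>, \<open>t\<^sup>3\<close> and \<open>t\<^sup>4\<close> of the composite map at \<open>e + tv\<close>.\<close>

lemma unital_pairing_second_order:
  assumes bc: "unital_pairing e \<tau> b c" and indep: "\<not> parallel e v"
  defines "f \<equiv> b v v"
  obtains k l m where "c v v = f + (k - \<tau> f) *s e"
    "2 *s c v f = (\<tau> v * \<tau> f) *s e - \<tau> v *s f - l *s e - k *s v" "c f f = l *s v"
proof -
  have b: "sym_bilinear b" and c: "sym_bilinear c" and e: "e \<noteq> 0" "\<tau> e = 3"
    and \<tau>: "\<And>x y. \<tau> (x + y) = \<tau> x + \<tau> y" "\<And>r x. \<tau> (r *s x) = r * \<tau> x"
    and be: "\<And>x. b e x = (1 / 2) *s (\<tau> x *s e - x)" and ce: "\<And>x. c e x = (1 / 2) *s (\<tau> x *s e - x)"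
    and par: "\<And>x. parallel (c (b x x) (b x x)) x"
    using bc unfolding unital_pairing_def by blast+
  note cs = sym_bilinear_simps[OF c]
  have \<tau>_diff: "\<tau> (x - y) = \<tau> x - \<tau> y" for x y
    using \<tau>(1)[of "x - y" y] by simp
  have bee: "b e e = e" and cee: "c e e = e"
    by (simp_all add: be ce e vec_eq_iff)
  have cve: "c v e = (1 / 2) *s (\<tau> v *s e - v)" "c f e = (1 / 2) *s (\<tau> f *s e - f)"
    using sym_bilinear_commute[OF c] ce by metis+
  have "c (b e e) (b e e) = 1 *s e"
    by (simp add: bee cee)
  from parallel_line_coefficients[OF bilinear_composition_line[OF b c par, of e _ v] e(1) this]
  obtain n1 n2 n3 n4 where w: "4 *s c (b e e) (b e v) = n1 *s e + 1 *s v"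
      "2 *s c (b e e) (b v v) + 4 *s c (b e v) (b e v) = n2 *s e + n1 *s v"
      "4 *s c (b e v) (b v v) = n3 *s e + n2 *s v" "c (b v v) (b v v) = n4 *s e + n3 *s v"
      "parallel (c (b v v) (b v v)) v"
    by metis
  have "4 *s c (b e e) (b e v) = \<tau> v *s e + v"
    unfolding bee unfolding ce unfolding be by (simp add: e \<tau> \<tau>_diff vec_eq_iff field_simps)
  then have "n1 *s e = \<tau> v *s e"
    using w(1) by simp
  then have n1: "n1 = \<tau> v"
    using e(1) by simp
  \<comment> \<open>The coefficient of t^4 is parallel to \<open>v\<close>, and \<open>e\<close> is
    not, so its part along \<open>e\<close> vanishes.\<close>
  have "n4 * (e $ i * v $ j - e $ j * v $ i) = 0" for i j
  proof -
    have "(n4 *s e + n3 *s v) $ i * v $ j = (n4 *s e + n3 *s v) $ j * v $ i"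
      using w(5) unfolding w(4) parallel_def by blast
    then show ?thesis
      unfolding vector_add_component vector_smult_component by algebra
  qed
  then have n4: "n4 = 0"
    using indep unfolding parallel_def by (metis eq_iff_diff_eq_0 mult_eq_0_iff)
  have "2 *s c (b e e) (b v v) + 4 *s c (b e v) (b e v) = \<tau> f *s e - f + \<tau> v *s v + c v v"
    unfolding bee f_def[symmetric] unfolding be unfolding cs unfolding cee cve ce e by (simp add: vec_eq_iff algebra_simps)
  with w(2) n1 have "\<tau> f *s e - f + \<tau> v *s v + c v v = n2 *s e + \<tau> v *s v"
    by simp
  then have 1: "c v v = f + (n2 - \<tau> f) *s e"
    by (simp add: vec_eq_iff algebra_simps)
  have "4 *s c (b e v) f = (\<tau> v * \<tau> f) *s e - \<tau> v *s f - 2 *s c v f"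
    unfolding be unfolding cs unfolding ce by (simp add: vec_eq_iff algebra_simps)
  with w(3) have "(\<tau> v * \<tau> f) *s e - \<tau> v *s f - 2 *s c v f = n3 *s e + n2 *s v"
    by (simp add: f_def)
  then have 2: "2 *s c v f = (\<tau> v * \<tau> f) *s e - \<tau> v *s f - n3 *s e - n2 *s v"
    by (simp add: vec_eq_iff algebra_simps)
  show ?thesis
    using that[OF 1 2] w(4) n4 by (simp add: f_def)
qed

lemma unital_pairing_commute: "unital_pairing e \<tau> b c \<Longrightarrow> unital_pairing e \<tau> c b"
  unfolding unital_pairing_def by blast

lemma independent3_not_parallel:
  assumes "independent3 u v w"
  shows "\<not> parallel u v" "\<not> parallel u w" "u \<noteq> 0"
proof -
  show "u \<noteq> 0"
  proof
    assume "u = 0"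
    then have "1 *s u + 0 *s v + 0 *s w = 0" by simp
    then show False using assms unfolding independent3_def by (metis zero_neq_one)
  qed
  show "\<not> parallel u v"
  proof
    assume "parallel u v"
    then obtain k where "v = k *s u"
      using parallel_imp_scale \<open>u \<noteq> 0\<close> by blast
    then have "(- k) *s u + 1 *s v + 0 *s w = 0" by simp
    then show False using assms unfolding independent3_def by (metis zero_neq_one)
  qed
  show "\<not> parallel u w"
  proof
    assume "parallel u w"
    then obtain k where "w = k *s u"
      using parallel_imp_scale \<open>u \<noteq> 0\<close> by blast
    then have "(- k) *s u + 0 *s v + 1 *s w = 0" by simp
    then show False using assms unfolding independent3_def by (metis zero_neq_one)
  qed
qed

text \<open>At first \<open>c v v\<close> and \<open>f\<close> agree only up to a multiple
  \<open>d\<close> of \<open>e\<close>. The second-order identities are used three times: for (b, c)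
  at \<open>v\<close>, for (c, b) at \<open>v\<close>, and for (b, c) at \<open>f\<close>. Together
  they give two expressions for \<open>b (c v v) (c v v)\<close>, and independence of e, v, f yields
  d = 0.\<close>

lemma unital_pairing_multiplication_table:
  assumes bc: "unital_pairing e \<tau> b c" and indep: "independent3 e v (b v v)"
  defines "f \<equiv> b v v"
  obtains n where "2 *s b v f = (\<tau> v * \<tau> f - n) *s e - \<tau> f *s v - \<tau> v *s f" "b f f = n *s v"
proof -
  have b: "sym_bilinear b" and c: "sym_bilinear c" and e: "e \<noteq> 0" "\<tau> e = 3"
    and \<tau>: "\<And>x y. \<tau> (x + y) = \<tau> x + \<tau> y" "\<And>r x. \<tau> (r *s x) = r * \<tau> x"
    and be: "\<And>x. b e x = (1 / 2) *s (\<tau> x *s e - x)"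
    using bc unfolding unital_pairing_def by blast+
  note bs = sym_bilinear_simps[OF b]
  have ind: "r = 0 \<and> s = 0 \<and> t = 0" if "r *s e + s *s v + t *s f = 0" for r s t
    using indep that unfolding independent3_def f_def by blast
  note np = independent3_not_parallel(1,2)[OF indep, folded f_def]
  have bee: "b e e = e"
    by (simp add: be e vec_eq_iff)
  obtain k l where 1: "c v v = f + (k - \<tau> f) *s e" "c f f = l *s v"
    using unital_pairing_second_order[OF bc np(1)] unfolding f_def by metis
  obtain k' l' where 2: "f = c v v + (k' - \<tau> (c v v)) *s e"
    "2 *s b v (c v v) = (\<tau> v * \<tau> (c v v)) *s e - \<tau> v *s c v v - l' *s e - k' *s v"
    "b (c v v) (c v v) = l' *s v"
    using unital_pairing_second_order[OF unital_pairing_commute[OF bc] np(1)] unfolding f_def by metis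
  obtain k'' where 3: "c f f = b f f + k'' *s e"
    using unital_pairing_second_order[OF bc np(2)] by metis
  define d where "d = k - \<tau> f"
  have g: "c v v = f + d *s e"
    using 1(1) by (simp add: d_def)
  have "(d + (k' - \<tau> (c v v))) *s e = 0"
    using 2(1) unfolding g by (simp add: vec_eq_iff algebra_simps)
  then have "d + (k' - \<tau> (c v v)) = 0"
    using e(1) unfolding vector_mul_eq_0 by blast
  moreover have "\<tau> (c v v) = \<tau> f + 3 * d"
    by (simp add: g \<tau> e)
  ultimately have k': "k' = \<tau> f + 2 * d"
    by algebra
  have bff: "b f f = l *s v - k'' *s e"
    using 1(2) 3 by (metis add_diff_cancel)
  have bfe: "b f e = (1 / 2) *s (\<tau> f *s e - f)"
    using sym_bilinear_commute[OF b] be by metis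
  have "b (c v v) (c v v) = l *s v - k'' *s e + d *s (\<tau> f *s e - f) + (d * d) *s e"
    unfolding g bs bff bfe bee unfolding be by (simp add: vec_eq_iff algebra_simps)
  \<comment> \<open>One expression is \<open>l' *s v\<close>, the other the expansion at
    \<open>f + d *s e\<close>; the term in \<open>f\<close> occurs only in the expansion, with
    coefficient - d.\<close>
  then have "(d * \<tau> f + d * d - k'') *s e + (l - l') *s v + (- d) *s f = 0"
    unfolding 2(3) by (simp add: vec_eq_iff algebra_simps)
  from ind[OF this] have d: "d = 0" "l = l'" "k'' = 0"
    by auto
  show ?thesis
  proof (rule that[of l])
    show "2 *s b v f = (\<tau> v * \<tau> f - l) *s e - \<tau> f *s v - \<tau> v *s f"
      using 2(2) g d k' by (simp add: vec_eq_iff algebra_simps)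
    show "b f f = l *s v"
      using bff d by simp
  qed
qed

text \<open>If \<open>e\<close>, \<open>v\<close>, \<open>b v v\<close> are dependent for all \<open>v\<close>, then \<open>x \<mapsto> b x x\<close> vanishes at a point \<open>w + a e\<close> for
  each \<open>w\<close> with \<open>\<tau> w = 0\<close>. These points form a plane, and the linear form defining it is a common factor.\<close>

lemma independent_square_exists:
  fixes e :: "complex^3"
  assumes bc: "unital_pairing e \<tau> b c"
    and ncf: "\<And>s Q. poly_tuple Q \<Longrightarrow> Vector_Spaces.linear (*s) (*) s \<Longrightarrow>
      (\<And>x. b x x = s x *s Q x) \<Longrightarrow> (\<And>x. s x = 0)"
  obtains v where "independent3 e v (b v v)"
proof -
  have b: "sym_bilinear b" and c: "sym_bilinear c" and e: "e \<noteq> 0" "\<tau> e = 3"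
    and \<tau>: "\<And>x y. \<tau> (x + y) = \<tau> x + \<tau> y" "\<And>r x. \<tau> (r *s x) = r * \<tau> x"
    and be: "\<And>x. b e x = (1 / 2) *s (\<tau> x *s e - x)" and ce: "\<And>x. c e x = (1 / 2) *s (\<tau> x *s e - x)"
    and par: "\<And>x. parallel (c (b x x) (b x x)) x"
    using bc unfolding unital_pairing_def by blast+
  note bs = sym_bilinear_simps[OF b] and cs = sym_bilinear_simps[OF c]
  have bee: "b e e = e" and cee: "c e e = e"
    by (simp_all add: be ce e vec_eq_iff)
  have bxe: "b x e = (1 / 2) *s (\<tau> x *s e - x)" for x
    using sym_bilinear_commute[OF b] be by metis
  have \<tau>_diff: "\<tau> (x - y) = \<tau> x - \<tau> y" for x y
    using \<tau>(1)[of "x - y" y] by simp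
  show ?thesis
  proof (cases "\<exists>v. independent3 e v (b v v)")
    case True
    then show ?thesis using that by blast
  next
    case False
    have base: "\<exists>a. b (w + a *s e) (w + a *s e) = 0" if w: "\<tau> w = 0" for w
    proof (cases "w = 0")
      case True
      then have "b (w + 0 *s e) (w + 0 *s e) = 0"
        by (simp add: bs)
      then show ?thesis by blast
    next
      case nz: False
      have np: "\<not> parallel e w"
      proof
        assume "parallel e w"
        then obtain k where "w = k *s e"
          using parallel_imp_scale e(1) by blast
        then show False
          using w nz \<tau>(2)[of k e] e by auto
      qed
      obtain r s t where rst: "r *s e + s *s w + t *s b w w = 0" "\<not> (r = 0 \<and> s = 0 \<and> t = 0)"
        using False unfolding independent3_def by blast
      have "t \<noteq> 0"
      proof
        assume t: "t = 0"
        with rst have rs: "r *s e + s *s w = 0" "s \<noteq> 0"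
          using e(1) by auto
        then have "parallel (s *s w) e"
          by (metis add_eq_0_iff parallel_scale_self vector_sneg_minus1 parallel_scale)
        then show False
          using np rs(2) parallel_unscale parallel_sym by blast
      qed
      define a a' where "a = - s / t" and "a' = - r / t"
      have "(inverse t) *s (r *s e + s *s w + t *s b w w) = 0"
        using rst by simp
      then have bww: "b w w = a *s w + a' *s e"
        using \<open>t \<noteq> 0\<close> by (simp add: a_def a'_def vec_eq_iff field_simps) (metis add.commute add_eq_0_iff)
      \<comment> \<open>Because \<tau>(w) = 0, the cross term 2 a \<open>b w e\<close> is - a w and
        cancels the part of \<open>b w w\<close> along \<open>w\<close>.\<close>
      let ?y = "w + a *s e"
      have y: "b ?y ?y = (a' + a * a) *s e"
        unfolding bs bww bee unfolding be bxe w by (simp add: e vec_eq_iff algebra_simps)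
      have cke: "c (k *s e) (k *s e) = k\<^sup>2 *s e" for k
        by (simp add: cs cee power2_eq_square)
      \<comment> \<open>The composite at \<open>?y\<close> is a multiple of \<open>e\<close> but
        must be proportional to \<open>?y\<close>, which is not parallel to \<open>e\<close>; so it
        is 0.\<close>
      have "parallel ((a' + a * a)\<^sup>2 *s e) ?y"
        using par[of ?y] unfolding y cke .
      then have "((a' + a * a)\<^sup>2 *s e) $ i * ?y $ j = ((a' + a * a)\<^sup>2 *s e) $ j * ?y $ i" for i j
        unfolding parallel_def by blast
      note eq = this[unfolded vector_add_component vector_smult_component]
      have "(a' + a * a)\<^sup>2 * (e $ i * w $ j - e $ j * w $ i) = 0" for i j
        using eq[of i j] by algebra
      then have "a' + a * a = 0"
        using np unfolding parallel_def by (metis eq_iff_diff_eq_0 mult_eq_0_iff power2_eq_square)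
      then have "b ?y ?y = 0"
        using y by simp
      then show ?thesis by blast
    qed
    obtain u0 z0 where ind0: "independent3 e u0 z0"
      using extend_to_independent3[OF e(1)] .
    \<comment> \<open>Projections to the kernel of \<tau> along \<open>e\<close>; the 3 is
      \<tau>(e).\<close>
    define u z where "u = u0 - (\<tau> u0 / 3) *s e" and "z = z0 - (\<tau> z0 / 3) *s e"
    have \<tau>uz: "\<tau> u = 0" "\<tau> z = 0"
      by (simp_all add: u_def z_def \<tau>_diff \<tau> e)
    have ind: "r = 0 \<and> s = 0 \<and> t = 0" if "r *s e + s *s u + t *s z = 0" for r s t
    proof -
      have "(r - s * (\<tau> u0 / 3) - t * (\<tau> z0 / 3)) *s e + s *s u0 + t *s z0 = 0"
        using that by (simp add: u_def z_def vec_eq_iff algebra_simps)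
      then have "r - s * (\<tau> u0 / 3) - t * (\<tau> z0 / 3) = 0 \<and> s = 0 \<and> t = 0"
        using ind0 unfolding independent3_def by blast
      then show ?thesis by auto
    qed
    obtain a1 where a1: "b (u + a1 *s e) (u + a1 *s e) = 0"
      using base[OF \<tau>uz(1)] by blast
    obtain a2 where a2: "b (z + a2 *s e) (z + a2 *s e) = 0"
      using base[OF \<tau>uz(2)] by blast
    \<comment> \<open>The shifts at \<open>u\<close> and \<open>z\<close> are chosen separately, and
      the zeros they give need not span a plane of zeros. The zeros over u + z and u - z measure by
      \<open>d\<close> and \<open>d'\<close> how far the shifts are from additive; d = 0 gives
      \<open>b y1 y2 = 0\<close>.\<close>
    have "\<tau> (u + z) = 0" "\<tau> (u - z) = 0"
      by (simp_all add: \<tau> \<tau>_diff \<tau>uz)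
    then obtain a3 a4 where a3: "b (u + z + a3 *s e) (u + z + a3 *s e) = 0"
      and a4: "b (u - z + a4 *s e) (u - z + a4 *s e) = 0"
      using base by metis
    define y1 y2 where "y1 = u + a1 *s e" and "y2 = z + a2 *s e"
    define d d' where "d = a3 - a1 - a2" and "d' = a4 - a1 + a2"
    have y: "b y1 y1 = 0" "b y2 y2 = 0" "b y2 y1 = b y1 y2"
      using a1 a2 sym_bilinear_commute[OF b] by (auto simp: y1_def y2_def)
    have \<tau>y: "\<tau> y1 = 3 * a1" "\<tau> y2 = 3 * a2"
      by (simp_all add: y1_def y2_def \<tau> \<tau>uz e)
    have "u + z + a3 *s e = y1 + y2 + d *s e" "u - z + a4 *s e = y1 - y2 + d' *s e"
      by (simp_all add: y1_def y2_def d_def d'_def vec_eq_iff algebra_simps)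
    then have "b (y1 + y2 + d *s e) (y1 + y2 + d *s e) = 0" "b (y1 - y2 + d' *s e) (y1 - y2 + d' *s e) = 0"
      using a3 a4 by simp_all
    moreover have "b (y1 + y2 + d *s e) (y1 + y2 + d *s e) =
        2 *s b y1 y2 + d *s ((3 * a1 + 3 * a2) *s e - (y1 + y2)) + (d * d) *s e"
      "b (y1 - y2 + d' *s e) (y1 - y2 + d' *s e) =
        - (2 *s b y1 y2) + d' *s ((3 * a1 - 3 * a2) *s e - (y1 - y2)) + (d' * d') *s e"
      unfolding bs y bee unfolding be bxe \<tau>y by (simp_all add: vec_eq_iff algebra_simps)
    ultimately have q: "2 *s b y1 y2 + d *s ((3 * a1 + 3 * a2) *s e - (y1 + y2)) + (d * d) *s e = 0"
      "- (2 *s b y1 y2) + d' *s ((3 * a1 - 3 * a2) *s e - (y1 - y2)) + (d' * d') *s e = 0"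
      by simp_all
    define \<beta> where "\<beta> = b y1 y2"
    \<comment> \<open>The sum of the two equations eliminates \<beta>, and its coefficients at
      \<open>u\<close> and \<open>z\<close> are - (d + d') and - (d - d').\<close>
    have "(d * (3 * a1 + 3 * a2) + d * d + d' * (3 * a1 - 3 * a2) + d' * d'
      - (d + d') * a1 - (d - d') * a2) *s e + (- (d + d')) *s u + (- (d - d')) *s z =
      (2 *s \<beta> + d *s ((3 * a1 + 3 * a2) *s e - (y1 + y2)) + (d * d) *s e) +
      (- (2 *s \<beta>) + d' *s ((3 * a1 - 3 * a2) *s e - (y1 - y2)) + (d' * d') *s e)"
      by (simp add: y1_def y2_def vec_eq_iff algebra_simps)
    also have "\<dots> = 0"
      unfolding \<beta>_def q by simp
    finally have "(d * (3 * a1 + 3 * a2) + d * d + d' * (3 * a1 - 3 * a2) + d' * d'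
      - (d + d') * a1 - (d - d') * a2) *s e + (- (d + d')) *s u + (- (d - d')) *s z = 0" .
    from ind[OF this] have "d + d' = 0" "d - d' = 0"
      by auto
    then have d: "d = 0"
      by (metis add.right_neutral add_self_div_2 diff_add_cancel eq_iff_diff_eq_0 mult_2 mult_eq_0_iff zero_neq_numeral)
    then have by12: "b y1 y2 = 0"
      using q(1) by simp
    have "independent3 e y1 y2"
      unfolding independent3_def
    proof (intro allI impI)
      fix r s t assume "r *s e + s *s y1 + t *s y2 = 0"
      then have "(r + s * a1 + t * a2) *s e + s *s u + t *s z = 0"
        by (simp add: y1_def y2_def vec_eq_iff algebra_simps)
      from ind[OF this] show "r = 0 \<and> s = 0 \<and> t = 0" by auto
    qed
    then obtain P :: "complex^3^3" where P: "invertible P" "\<And>x. P *v x = x $ 1 *s e + x $ 2 *s y1 + x $ 3 *s y2"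
      by (rule independent3_matrix) (rule that)
    obtain P' where P': "invertible P'" "\<And>x. P *v (P' *v x) = x" "\<And>x. P' *v (P *v x) = x"
      using P(1) by (rule invertible_inverse) (rule that)
    \<comment> \<open>The coordinate along \<open>e\<close> in the basis e, y1, y2. All products
      among \<open>y1\<close> and \<open>y2\<close> vanish, so each remaining term of
      \<open>b x x\<close> contains this coordinate; it is a common factor with value 1 at
      \<open>e\<close>.\<close>
    define s where "s x = (P' *v x) $ 1" for x
    define R where "R = (\<lambda>\<xi> :: complex^3. \<xi> $ 1 *s e + \<xi> $ 2 *s (2 *s b e y1) + \<xi> $ 3 *s (2 *s b e y2))"
    have by1e: "b y1 e = b e y1" "b y2 e = b e y2"
      using sym_bilinear_commute[OF b] by blast+
    have "poly_tuple R"
      unfolding R_def poly_tuple_def vector_add_component vector_smult_component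
      by (intro allI polyfun_intros polyfun_nth)
    then have "poly_tuple (R \<circ> (*v) P')"
      by (rule poly_tuple_compose[OF _ poly_tuple_matrix])
    moreover have "Vector_Spaces.linear (*s) (*) s"
      unfolding s_def by (rule linear_matrix_nth)
    moreover have "b x x = s x *s (R \<circ> (*v) P') x" for x
    proof -
      let ?\<xi> = "P' *v x"
      have "b x x = b (P *v ?\<xi>) (P *v ?\<xi>)"
        by (simp add: P')
      also have "\<dots> = ?\<xi> $ 1 *s R ?\<xi>"
        unfolding P(2) R_def by (simp only: bs bee y by12 by1e) (simp add: vec_eq_iff algebra_simps)
      finally show ?thesis
        by (simp add: s_def)
    qed
    ultimately have "s e = 0"
      by (rule ncf)
    moreover have "P *v vector [1, 0, 0] = e"
      by (simp add: P(2) vector_3)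
    then have "P' *v e = vector [1, 0, 0]"
      using P'(3) by metis
    then have "s e = 1"
      by (simp add: s_def vector_3)
    ultimately show ?thesis by simp
  qed
qed

section \<open>Normal forms\<close>

text \<open>The adjoint of \<open>\<complex>[t]/(t\<^sup>3 - T t\<^sup>2 + S t - N)\<close> in the basis consisting of \<open>1\<close>, \<open>t\<close> and the adjoint of \<open>t\<close>.\<close>

definition normal_map :: "complex \<Rightarrow> complex \<Rightarrow> complex \<Rightarrow> complex^3 \<Rightarrow> complex^3" where
  "normal_map T S N v = (let a = v $ 1; b = v $ 2; c = v $ 3 in vector [
     a\<^sup>2 + a * b * T + a * c * S + b * c * (T * S - N),
     N * c\<^sup>2 - a * b - b * c * S,
     b\<^sup>2 - a * c - b * c * T])"

text \<open>The columns of \<open>Q\<close> are the unity, an element with the given characteristic polynomial and its adjoint,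
  in the algebra that belongs to the multiplicities of the roots.\<close>

lemma normal_map_conjugate:
  obtains F Q where "F \<in> {map_1, map_2, map_3}" "invertible Q"
    "\<And>v. F (Q *v v) = Q *v normal_map T S N v"
proof -
  note witness = that
  obtain \<alpha> \<beta> \<gamma> where roots: "T = \<alpha> + \<beta> + \<gamma>" "S = \<alpha> * \<beta> + \<alpha> * \<gamma> + \<beta> * \<gamma>" "N = \<alpha> * \<beta> * \<gamma>"
    using cubic_roots .
  have nth: "normal_map T S N v $ 1 = (v $ 1)\<^sup>2 + v $ 1 * v $ 2 * T + v $ 1 * v $ 3 * S + v $ 2 * v $ 3 * (T * S - N)"
    "normal_map T S N v $ 2 = N * (v $ 3)\<^sup>2 - v $ 1 * v $ 2 - v $ 2 * v $ 3 * S"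
    "normal_map T S N v $ 3 = (v $ 2)\<^sup>2 - v $ 1 * v $ 3 - v $ 2 * v $ 3 * T" for v
    by (simp_all add: normal_map_def Let_def vector_3)
  have double: thesis
    if ab: "a \<noteq> b" and roots: "T = a + b + b" "S = a * b + a * b + b * b" "N = a * b * b" for a b
  proof -
    have "independent3 (vector [1, 1, 0]) (vector [a, b, 1]) (vector [b\<^sup>2, a * b, - a] :: complex^3)"
      unfolding independent3_def
    proof (intro allI impI)
      fix r s t assume "r *s vector [1, 1, 0] + s *s vector [a, b, 1] + t *s vector [b\<^sup>2, a * b, - a] = (0 :: complex^3)"
      then have eqs: "r * 1 + s * a + t * b\<^sup>2 = 0" "r * 1 + s * b + t * (a * b) = 0"
        "r * 0 + s * 1 + t * - a = 0"
        by (simp_all only: vec3_eq_iff vector_add_component vector_smult_component vector_3 zero_index)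
      then have "t * (a - b)\<^sup>2 = 0"
        by algebra
      then have "t = 0"
        using ab by simp
      with eqs show "r = 0 \<and> s = 0 \<and> t = 0" by simp
    qed
    then obtain Q :: "complex^3^3" where Q: "invertible Q"
      "\<And>x. Q *v x = x $ 1 *s vector [1, 1, 0] + x $ 2 *s vector [a, b, 1] + x $ 3 *s vector [b\<^sup>2, a * b, - a]"
      by (rule independent3_matrix) (rule that)
    have "map_2 (Q *v v) = Q *v normal_map T S N v" for v
      unfolding vec3_eq_iff map_components Q(2) vector_add_component vector_smult_component nth vector_3
      unfolding roots
      by (intro conjI; algebra)
    then show thesis
      using witness[of map_2 Q] Q(1) by blast
  qed
  consider "\<alpha> \<noteq> \<beta>" "\<alpha> \<noteq> \<gamma>" "\<beta> \<noteq> \<gamma>" | "\<alpha> \<noteq> \<beta>" "\<beta> = \<gamma>" | "\<alpha> \<noteq> \<beta>" "\<alpha> = \<gamma>"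
    | "\<alpha> \<noteq> \<gamma>" "\<alpha> = \<beta>" | "\<alpha> = \<beta>" "\<beta> = \<gamma>"
    by blast
  then show thesis
  proof cases
    case 1
    have "independent3 (vector [1, 1, 1]) (vector [\<alpha>, \<beta>, \<gamma>]) (vector [\<beta> * \<gamma>, \<alpha> * \<gamma>, \<alpha> * \<beta>] :: complex^3)"
      unfolding independent3_def
    proof (intro allI impI)
      fix r s t
      assume "r *s vector [1, 1, 1] + s *s vector [\<alpha>, \<beta>, \<gamma>] + t *s vector [\<beta> * \<gamma>, \<alpha> * \<gamma>, \<alpha> * \<beta>] = (0 :: complex^3)"
      then have eqs: "r * 1 + s * \<alpha> + t * (\<beta> * \<gamma>) = 0" "r * 1 + s * \<beta> + t * (\<alpha> * \<gamma>) = 0"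
        "r * 1 + s * \<gamma> + t * (\<alpha> * \<beta>) = 0"
        by (simp_all only: vec3_eq_iff vector_add_component vector_smult_component vector_3 zero_index)
      then have "(\<alpha> - \<beta>) * (s - t * \<gamma>) = 0" "(\<alpha> - \<gamma>) * (s - t * \<beta>) = 0"
        by algebra+
      then have st: "s - t * \<gamma> = 0" "s - t * \<beta> = 0"
        using 1 by simp_all
      then have "t * (\<beta> - \<gamma>) = 0"
        by algebra
      then have "t = 0"
        using 1 by simp
      with st eqs show "r = 0 \<and> s = 0 \<and> t = 0" by simp
    qed
    then obtain Q :: "complex^3^3" where Q: "invertible Q"
      "\<And>x. Q *v x = x $ 1 *s vector [1, 1, 1] + x $ 2 *s vector [\<alpha>, \<beta>, \<gamma>]
        + x $ 3 *s vector [\<beta> * \<gamma>, \<alpha> * \<gamma>, \<alpha> * \<beta>]"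
      by (rule independent3_matrix) (rule that)
    have "map_1 (Q *v v) = Q *v normal_map T S N v" for v
      unfolding vec3_eq_iff map_components Q(2) vector_add_component vector_smult_component nth vector_3
      unfolding roots
      by (intro conjI; algebra)
    then show thesis
      using witness[of map_1 Q] Q(1) by blast
  next
    case 2
    then show thesis
      using double[of \<alpha> \<beta>] roots by simp
  next
    case 3
    then show thesis
      using double[of \<beta> \<alpha>] roots by (simp add: mult.commute add.commute add.left_commute)
  next
    case 4
    then show thesis
      using double[of \<gamma> \<alpha>] roots by (simp add: mult.commute add.commute add.left_commute)
  next
    case 5
    have "independent3 (vector [1, 0, 0]) (vector [\<alpha>, 1, 0]) (vector [\<alpha>\<^sup>2, - \<alpha>, 1] :: complex^3)"
      by (auto simp: independent3_def vec3_eq_iff vector_3)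
    then obtain Q :: "complex^3^3" where Q: "invertible Q"
      "\<And>x. Q *v x = x $ 1 *s vector [1, 0, 0] + x $ 2 *s vector [\<alpha>, 1, 0] + x $ 3 *s vector [\<alpha>\<^sup>2, - \<alpha>, 1]"
      by (rule independent3_matrix) (rule that)
    have roots: "T = 3 * \<alpha>" "S = 3 * \<alpha>\<^sup>2" "N = \<alpha> ^ 3"
      using roots 5 by (simp_all add: power2_eq_square power3_eq_cube)
    have "map_3 (Q *v v) = Q *v normal_map T S N v" for v
      unfolding vec3_eq_iff map_components Q(2) vector_add_component vector_smult_component nth vector_3
      unfolding roots
      by (intro conjI; algebra)
    then show thesis
      using witness[of map_3 Q] Q(1) by blast
  qed
qed

lemma cremona_equivalent_to_normal_form:
  fixes f :: "3 ratmap"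
  assumes "quadro_quadric_cremona f"
  shows "\<exists>F\<in>{map_1, map_2, map_3}. linearly_equivalent f (projectivization F)"
proof -
  obtain F b c where f: "f = projectivization F" "form_map 2 F" "no_common_factor F"
    and bc: "sym_bilinear b" "sym_bilinear c" "\<And>x. F x = b x x"
    and par: "\<And>x. parallel (c (F x) (F x)) x" "\<And>y. parallel (F (c y y)) y"
    and nz: "\<exists>x. c (F x) (F x) \<noteq> 0"
    using cremona_representatives[OF assms] by metis
  obtain x0 where x0: "c (b x0 x0) (b x0 x0) \<noteq> 0"
    using nz bc(3) by auto
  obtain L e \<tau> c' where L: "invertible L" and up: "unital_pairing e \<tau> (\<lambda>x y. L *v b x y) c'"
    by (rule normalise_cremona[OF bc(1,2) _ _ x0]) (use par bc(3) in \<open>auto intro: that\<close>)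
  obtain L' where L': "\<And>x. L' *v (L *v x) = x"
    using invertible_inverse[OF L] by metis
  \<comment> \<open>Here the absence of a common factor enters: a linear common factor would be
    constant, hence 0.\<close>
  obtain v where v: "independent3 e v (L *v b v v)"
  proof (rule independent_square_exists[OF up])
    fix s :: "complex^3 \<Rightarrow> complex" and Q :: "complex^3 \<Rightarrow> complex^3" and x
    assume Q: "poly_tuple Q" and s: "Vector_Spaces.linear (*s) (*) s"
      and eq: "\<And>x. L *v b x x = s x *s Q x"
    interpret s: Vector_Spaces.linear "(*s)" "(*)" s by (rule s)
    have FQ: "F x = s x *s (L' *v Q x)" for x
      using L'[of "b x x"] unfolding eq bc(3) by (simp add: vector_scalar_commute)
    have "poly_tuple ((*v) L' \<circ> Q)"
      by (rule poly_tuple_compose[OF poly_tuple_matrix Q])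
    then have "\<exists>g. polyfun (*s) g \<and> (\<forall>x. F x $ i = s x * g x)" for i
      unfolding poly_tuple_def by (intro exI[of _ "\<lambda>x. (L' *v Q x) $ i"]) (simp add: FQ)
    with polyfun.linear[OF s] have "\<exists>k. \<forall>x. s x = k"
      using f(3)[unfolded no_common_factor_def, rule_format, of s] by blast
    then show "s x = 0"
      using s.zero by metis
  qed (rule that)
  define g where "g = L *v b v v"
  define T S where "T = \<tau> v" and "S = \<tau> g"
  have be: "L *v b e x = (1 / 2) *s (\<tau> x *s e - x)" and \<tau>e: "\<tau> e = 3" for x
    using up unfolding unital_pairing_def by blast+
  obtain N where N: "2 *s (L *v b v g) = (T * S - N) *s e - S *s v - T *s g" "L *v b g g = N *s v"
    using unital_pairing_multiplication_table[OF up v] unfolding T_def S_def g_def by metis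
  obtain P :: "complex^3^3" where P: "invertible P" "\<And>x. P *v x = x $ 1 *s e + x $ 2 *s v + x $ 3 *s g"
    using independent3_matrix[OF v] unfolding g_def by metis
  obtain P' where P': "invertible P'" "\<And>x. P' *v (P *v x) = x"
    using invertible_inverse[OF P(1)] by metis
  \<comment> \<open>All products of e, v, g are known: those with \<open>e\<close> by the
    normalisation, that of \<open>v\<close> with itself by definition of \<open>g\<close>, the other
    two by the multiplication table.\<close>
  have LF: "L *v F (P *v x) = P *v normal_map T S N x" for x
  proof -
    define p q r where "p = x $ 1" and "q = x $ 2" and "r = x $ 3"
    note bs = sym_bilinear_simps[OF bc(1)]
    have com: "b v e = b e v" "b g e = b e g" "b g v = b v g"
      using sym_bilinear_commute[OF bc(1)] by blast+
    have "F (P *v x) = p\<^sup>2 *s b e e + q\<^sup>2 *s b v v + r\<^sup>2 *s b g g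
      + (p * q) *s (2 *s b e v) + (p * r) *s (2 *s b e g) + (q * r) *s (2 *s b v g)"
      unfolding bc(3) P(2) p_def[symmetric] q_def[symmetric] r_def[symmetric] bs com
      by (simp add: vec_eq_iff algebra_simps power2_eq_square)
    then have "L *v F (P *v x) = p\<^sup>2 *s (L *v b e e) + q\<^sup>2 *s (L *v b v v) + r\<^sup>2 *s (L *v b g g)
      + (p * q) *s (2 *s (L *v b e v)) + (p * r) *s (2 *s (L *v b e g)) + (q * r) *s (2 *s (L *v b v g))"
      by (simp add: matrix_vector_right_distrib vector_scalar_commute)
    also have "\<dots> = p\<^sup>2 *s e + q\<^sup>2 *s g + r\<^sup>2 *s (N *s v) + (p * q) *s (T *s e - v)
      + (p * r) *s (S *s e - g) + (q * r) *s ((T * S - N) *s e - S *s v - T *s g)"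
      unfolding N be \<tau>e g_def[symmetric] T_def[symmetric] S_def[symmetric]
      by (simp add: vec_eq_iff algebra_simps)
    also have "\<dots> = P *v normal_map T S N x"
      unfolding P(2) by (simp add: normal_map_def Let_def vector_3 vec_eq_iff p_def q_def r_def algebra_simps)
    finally show ?thesis .
  qed
  obtain G Q where G: "G \<in> {map_1, map_2, map_3}" and Q: "invertible Q"
    "\<And>x. G (Q *v x) = Q *v normal_map T S N x"
    by (rule normal_map_conjugate) (rule that)
  obtain Q' where Q': "invertible Q'" "\<And>x. Q *v (Q' *v x) = x"
    using invertible_inverse[OF Q(1)] by metis
  \<comment> \<open>Both \<open>G\<close> and the normalised \<open>F\<close> are conjugate to the
    same \<open>normal_map\<close>, through \<open>Q\<close> and \<open>P\<close>; eliminating it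
    leaves only matrices around \<open>F\<close>.\<close>
  have "G x = (Q ** P' ** L) *v F ((P ** Q') *v x)" for x
  proof -
    have "G x = Q *v normal_map T S N (Q' *v x)"
      using Q(2)[of "Q' *v x"] by (simp add: Q')
    also have "normal_map T S N (Q' *v x) = P' *v (L *v F (P *v (Q' *v x)))"
      unfolding LF by (simp add: P')
    finally show ?thesis
      by (simp add: matrix_vector_mul_assoc matrix_mul_assoc)
  qed
  then have "projectivization G = projectivization (\<lambda>x. (Q ** P' ** L) *v F ((P ** Q') *v x))"
    by presburger
  moreover have "invertible (Q ** P' ** L)" "invertible (P ** Q')"
    using Q(1) P' P(1) Q' L by (auto intro: invertible_mult)
  ultimately have "linearly_equivalent f (projectivization G)"
    unfolding f(1) linearly_equivalent_projectivization_iff[OF f(2)] by blast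
  with G show ?thesis by blast
qed

lemma cremona_normal_form_unique:
  fixes f :: "3 ratmap"
  assumes "quadro_quadric_cremona f"
  shows "\<exists>!F. F \<in> {map_1, map_2, map_3} \<and> linearly_equivalent f (projectivization F)"
proof -
  obtain F where F: "f = projectivization F" "form_map 2 F"
    using assms unfolding quadro_quadric_cremona_def quadratic_ratmap_def by blast
  note nb = not_both_linearly_equivalent[OF F(2), folded F(1)]
  have "G = G'" if "G \<in> {map_1, map_2, map_3}" "linearly_equivalent f (projectivization G)"
    "G' \<in> {map_1, map_2, map_3}" "linearly_equivalent f (projectivization G')" for G G'
    using that nb[of G G'] nb[of G' G] by auto
  with cremona_equivalent_to_normal_form[OF assms] show ?thesis
    by blast
qed

theorem mainTheorem7:
  shows
    "(jordan_algebra alg_CCC \<and> has_rank alg_CCC 3 \<and> alg_dim alg_CCC = 3 \<and> associative alg_CCC) \<and>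
     (jordan_algebra alg_C_eps2 \<and> has_rank alg_C_eps2 3 \<and> alg_dim alg_C_eps2 = 3 \<and>
        associative alg_C_eps2) \<and>
     (jordan_algebra alg_eps3 \<and> has_rank alg_eps3 3 \<and> alg_dim alg_eps3 = 3 \<and>
        associative alg_eps3) \<and>
     \<not> isomorphic alg_CCC alg_C_eps2 \<and>
     \<not> isomorphic alg_CCC alg_eps3 \<and>
     \<not> isomorphic alg_C_eps2 alg_eps3 \<and>
     (\<forall>A :: 'a::ab_group_add calgebra.
        jordan_algebra A \<and> has_rank A 3 \<and> alg_dim A = 3 \<longrightarrow>
        isomorphic A alg_CCC \<or> isomorphic A alg_C_eps2 \<or> isomorphic A alg_eps3) \<and>
     (\<forall>F\<in>{map_1, map_2, map_3}. quadro_quadric_cremona (projectivization F)) \<and>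
     (\<forall>f :: 3 ratmap. quadro_quadric_cremona f \<longrightarrow>
        (\<exists>!F. F \<in> {map_1, map_2, map_3} \<and> linearly_equivalent f (projectivization F))) \<and>
     adjoint_in_coordinates alg_CCC map_1 \<and>
     adjoint_in_coordinates alg_C_eps2 map_2 \<and>
     adjoint_in_coordinates alg_eps3 map_3"
proof (intro conjI)
  show "\<forall>A :: 'a::ab_group_add calgebra. jordan_algebra A \<and> has_rank A 3 \<and> alg_dim A = 3 \<longrightarrow>
      isomorphic A alg_CCC \<or> isomorphic A alg_C_eps2 \<or> isomorphic A alg_eps3"
    using isomorphic_if_rank_3 by blast
  show "\<forall>F\<in>{map_1, map_2, map_3}. quadro_quadric_cremona (projectivization F)"
    using quadro_quadric_maps by blast
  show "\<forall>f :: 3 ratmap. quadro_quadric_cremona f \<longrightarrow>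
      (\<exists>!F. F \<in> {map_1, map_2, map_3} \<and> linearly_equivalent f (projectivization F))"
    using cremona_normal_form_unique by blast
qed (use algs_properties in blast | fact not_isomorphic_CCC_C_eps2 not_isomorphic_CCC_eps3
    not_isomorphic_C_eps2_eps3 adjoint_CCC adjoint_C_eps2 adjoint_eps3)+

end
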